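(* Let $L\subseteq\mathbb{R}^n$ be any $n$-dimensional lattice. Then the flat torus $\mathbb{R}^n/L$ has a finite-dimensional least Euclidean distortion embedding, i.e. there is a Euclidean embedding $\varphi:\mathbb{R}^n/L\to H$ into a finite-dimensional Hilbert space $H$ with $\mathrm{dist}(\varphi)=c_2(\mathbb{R}^n/L)$. In particular, the program (P) for $L$ has an optimal solution $(C,z)$ such that: (1) for every coset $v+2L^*$ of $L^*/2L^*$, the set $\mathrm{supp}(z)\cap(v+2L^* )$ contains at most one vector up to sign (i.e. it is either empty or of the form $\{u,-u\}$); (2) every $u\in\mathrm{supp}(z)$ is primitive in $L^*$.
   Context: An $n$-dimensional lattice $L\subseteq\mathbb{R}^n$ is the set of all integral linear combinations of a basis of $\mathbb{R}^n$; $|x|=\sqrt{x^{\mathsf T}x}$. The flat torus $\mathbb{R}^n/L$ has the metric $d_{\mathbb{R}^n/L}(x,y)=\min_{v\in L}|x-y-v|$. The dual lattice is $L^*=\{u\in\mathbb{R}^n: u^{\mathsf T}v\in\mathbb{Z}\text{ for all }v\in L\}$. The Voronoi cell is $V(L)=\{x\in\mathbb{R}^n: |x|\le|x-v|\text{ for all }v\in L\}$. A Euclidean embedding of $\mathbb{R}^n/L$ is an injective function $\varphi:\mathbb{R}^n/L\to H$ into some (complex) Hilbert space $H$. Its distortion is $$\mathrm{dist}(\varphi)=\sup_{x\ne y}\frac{\|\varphi(x)-\varphi(y)\|}{d_{\mathbb{R}^n/L}(x,y)}\cdot\sup_{x\neq y}\frac{d_{\mathbb{R}^n/L}(x,y)}{\|\varphi(x)-\varphi(y)\|},$$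 with suprema over distinct $x,y\in\mathbb{R}^n/L$. The least (Euclidean) distortion is $c_2(\mathbb{R}^n/L)=\inf\{\mathrm{dist}(\varphi)\}$ over all Euclidean embeddings $\varphi$ of $\mathbb{R}^n/L$ into Hilbert spaces. $\ell^1(L^* )=\{z:L^*\to\mathbb{C}:\sum_{u\in L^*}|z(u)|<\infty\}$; $\mathbb{R}_+$ denotes the nonnegative reals; $I$ is the $n\times n$ identity matrix; $\mathcal{S}^n_+$ is the cone of real symmetric positive semidefinite $n\times n$ matrices; $\mathrm{supp}(z)=\{u\in L^*:z(u)\ne0\}$. Program (P) for $L$, whose optimal value is $c_2(\mathbb{R}^n/L)^2$: minimize $C$ subject to $C\in\mathbb{R}_+$, $z\in\ell^1(L^* )$, $z(u)=z(-u)\ge0$ for all $u\in L^*$, $|x|^2\le2\sum_{u\in L^*}z(u)(1-\cos(2\pi u^{\mathsf T}x))$ for all $x\in V(L)$, and $CI-4\pi^2\sum_{u\in L^*}z(u)uu^{\mathsf T}\in\mathcal{S}^n_+$ (the last constraint includes convergence of the series). An optimal solution is a feasible pair $(C,z)$ with $C$ minimal. A vector $v$ of a lattice $M$ is primitive in $M$ if $v=\alpha w$ with $\alpha\in\mathbb{Z}$ and $w\in M$ implies $\alpha=\pm1$ (in particular $0$ is not primitive). *)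

theory Defs
  imports "HOL-Analysis.Analysis" "HOL-Algebra.Module"
begin

section \<open>Lattices and flat tori\<close>

definition full_lattice :: "(real^'n) set \<Rightarrow> bool" where
  "full_lattice L \<longleftrightarrow>
    (\<exists>B. independent B \<and> span B = (UNIV :: (real^'n) set) \<and>
         L = {\<Sum>b\<in>B. of_int (k b) *\<^sub>R b | k :: real^'n \<Rightarrow> int. True})"

definition dual_lattice :: "(real^'n) set \<Rightarrow> (real^'n) set" where
  "dual_lattice L = {u. \<forall>v\<in>L. u \<bullet> v \<in> \<int>}"

definition voronoi_cell :: "(real^'n) set \<Rightarrow> (real^'n) set" where
  "voronoi_cell L = {x. \<forall>v\<in>L. norm x \<le> norm (x - v)}"

definition primitive_in :: "(real^'n) set \<Rightarrow> real^'n \<Rightarrow> bool" where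
  "primitive_in M v \<longleftrightarrow>
    v \<in> M \<and> (\<forall>\<alpha>::int. \<forall>w\<in>M. v = of_int \<alpha> *\<^sub>R w \<longrightarrow> \<alpha> = 1 \<or> \<alpha> = -1)"

definition lattice_rel :: "(real^'n) set \<Rightarrow> ((real^'n) \<times> (real^'n)) set" where
  "lattice_rel L = {(x, y). x - y \<in> L}"

definition flat_torus :: "(real^'n) set \<Rightarrow> (real^'n) set set" where
  "flat_torus L = UNIV // lattice_rel L"

text \<open>The distance of two cosets is computed from arbitrary representatives; independence of their
  choice is lemma \<open>torus_dist_class\<close>, and the infimum is a minimum by \<open>torus_dist_attained\<close>.\<close>

definition torus_dist :: "(real^'n) set \<Rightarrow> (real^'n) set \<Rightarrow> (real^'n) set \<Rightarrow> real" where
  "torus_dist L X Y = (INF v\<in>L. norm ((SOME x. x \<in> X) - (SOME y. y \<in> Y) - v))"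

section \<open>Complex Hilbert spaces\<close>

text \<open>Hilbert spaces are carrier-based, so that one can quantify over all of them inside a formula.
  The form \<open>ip\<close> is linear in its first argument. The ring fields \<open>mult\<close> and \<open>one\<close> of the module
  record play no role.\<close>

definition complex_field :: "complex ring" where
  "complex_field = \<lparr>carrier = UNIV, mult = (*), one = 1, zero = 0, add = (+)\<rparr>"

record 'a hilbert = "(complex, 'a) module" +
  ip :: "'a \<Rightarrow> 'a \<Rightarrow> complex"

definition hnorm :: "'a hilbert \<Rightarrow> 'a \<Rightarrow> real" where
  "hnorm H x = sqrt (Re (ip H x x))"

definition hdist :: "'a hilbert \<Rightarrow> 'a \<Rightarrow> 'a \<Rightarrow> real" where
  "hdist H x y = hnorm H (x \<ominus>\<^bsub>H\<^esub> y)"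

locale hilbert_space = module complex_field H for H :: "'a hilbert" (structure) +
  assumes ip_add_left:
      "\<lbrakk>x \<in> carrier H; y \<in> carrier H; w \<in> carrier H\<rbrakk>
        \<Longrightarrow> ip H (x \<oplus> y) w = ip H x w + ip H y w"
    and ip_smult_left:
      "\<lbrakk>x \<in> carrier H; y \<in> carrier H\<rbrakk> \<Longrightarrow> ip H (c \<odot> x) y = c * ip H x y"
    and ip_commute: "\<lbrakk>x \<in> carrier H; y \<in> carrier H\<rbrakk> \<Longrightarrow> ip H y x = cnj (ip H x y)"
    and ip_pos: "\<lbrakk>x \<in> carrier H; x \<noteq> \<zero>\<rbrakk> \<Longrightarrow> 0 < Re (ip H x x)"
    and hcomplete:
      "\<lbrakk>\<And>k. s k \<in> carrier H; \<forall>e>0. \<exists>N. \<forall>i\<ge>N. \<forall>j\<ge>N. hdist H (s i) (s j) < e\<rbrakk>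
        \<Longrightarrow> \<exists>l\<in>carrier H. (\<lambda>k. hdist H (s k) l) \<longlonglongrightarrow> 0"

definition finite_dimensional :: "'a hilbert \<Rightarrow> bool" where
  "finite_dimensional H \<longleftrightarrow>
    (\<exists>B. finite B \<and> B \<subseteq> carrier H \<and>
      (\<forall>x\<in>carrier H. \<exists>c. x = (\<Oplus>\<^bsub>H\<^esub>b\<in>B. c b \<odot>\<^bsub>H\<^esub> b)))"

section \<open>Euclidean embeddings and distortion\<close>

definition euclidean_embedding ::
    "(real^'n) set \<Rightarrow> 'a hilbert \<Rightarrow> ((real^'n) set \<Rightarrow> 'a) \<Rightarrow> bool" where
  "euclidean_embedding L H \<phi> \<longleftrightarrow>
    hilbert_space H \<and> \<phi> \<in> flat_torus L \<rightarrow> carrier H \<and> inj_on \<phi> (flat_torus L)"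

definition distinct_pairs :: "(real^'n) set \<Rightarrow> ((real^'n) set \<times> (real^'n) set) set" where
  "distinct_pairs L = {(X, Y). X \<in> flat_torus L \<and> Y \<in> flat_torus L \<and> X \<noteq> Y}"

definition distortion ::
    "(real^'n) set \<Rightarrow> 'a hilbert \<Rightarrow> ((real^'n) set \<Rightarrow> 'a) \<Rightarrow> ennreal" where
  "distortion L H \<phi> =
    (SUP (X, Y)\<in>distinct_pairs L. ennreal (hdist H (\<phi> X) (\<phi> Y) / torus_dist L X Y)) *
    (SUP (X, Y)\<in>distinct_pairs L. ennreal (torus_dist L X Y / hdist H (\<phi> X) (\<phi> Y)))"

text \<open>A formula cannot quantify over types, so the infimum is taken over all Hilbert spaces whose
  carrier is a set of functions \<open>real^'n \<Rightarrow> complex\<close>. This loses nothing: lemma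
  \<open>least_distortion_le\<close> bounds \<open>least_distortion L\<close> by the distortion of every embedding
  into a Hilbert space over an arbitrary type.\<close>

definition least_distortion :: "(real^'n) set \<Rightarrow> ennreal" where
  "least_distortion L =
    Inf {distortion L H \<phi> | (H :: (real^'n \<Rightarrow> complex) hilbert) \<phi>. euclidean_embedding L H \<phi>}"

section \<open>The optimization program\<close>

definition outer_square :: "real^'n \<Rightarrow> real^'n^'n" where
  "outer_square u = (\<chi> i j. u $ i * u $ j)"

definition psd :: "real^'n^'n \<Rightarrow> bool" where
  "psd A \<longleftrightarrow> transpose A = A \<and> (\<forall>x. 0 \<le> x \<bullet> (A *v x))"

text \<open>Only the values of \<open>z\<close> on \<open>dual_lattice L\<close> matter. They are nonnegative, hence real.\<close>

definition program_feasible :: "(real^'n) set \<Rightarrow> real \<Rightarrow> (real^'n \<Rightarrow> real) \<Rightarrow> bool" where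
  "program_feasible L C z \<longleftrightarrow>
    0 \<le> C \<and>
    (\<lambda>u. \<bar>z u\<bar>) summable_on dual_lattice L \<and>
    (\<forall>u\<in>dual_lattice L. z u = z (- u) \<and> 0 \<le> z u) \<and>
    (\<forall>x\<in>voronoi_cell L.
      (norm x)\<^sup>2 \<le> 2 * (\<Sum>\<^sub>\<infinity>u\<in>dual_lattice L. z u * (1 - cos (2 * pi * (u \<bullet> x))))) \<and>
    (\<lambda>u. z u *\<^sub>R outer_square u) summable_on dual_lattice L \<and>
    psd (C *\<^sub>R mat 1 - (4 * pi\<^sup>2) *\<^sub>R (\<Sum>\<^sub>\<infinity>u\<in>dual_lattice L. z u *\<^sub>R outer_square u))"

definition program_optimal :: "(real^'n) set \<Rightarrow> real \<Rightarrow> (real^'n \<Rightarrow> real) \<Rightarrow> bool" where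
  "program_optimal L C z \<longleftrightarrow>
    program_feasible L C z \<and> (\<forall>C' z'. program_feasible L C' z' \<longrightarrow> C \<le> C')"

definition program_supp :: "(real^'n) set \<Rightarrow> (real^'n \<Rightarrow> real) \<Rightarrow> (real^'n) set" where
  "program_supp L z = {u \<in> dual_lattice L. z u \<noteq> 0}"


section \<open>Justification of the encodings\<close>

lemma full_lattice_group:
  fixes L :: "(real^'n) set"
  assumes "full_lattice L"
  shows "0 \<in> L" and "\<And>x y. x \<in> L \<Longrightarrow> y \<in> L \<Longrightarrow> x - y \<in> L" and "\<And>x. x \<in> L \<Longrightarrow> - x \<in> L"
    and "\<And>x y. x \<in> L \<Longrightarrow> y \<in> L \<Longrightarrow> x + y \<in> L"
proof -
  obtain B where L: "L = {\<Sum>b\<in>B. of_int (k b) *\<^sub>R b | k :: real^'n \<Rightarrow> int. True}"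
    using assms unfolding full_lattice_def by blast
  show 0: "0 \<in> L" unfolding L by (auto intro!: exI[of _ "\<lambda>_. 0"])
  show d: "x - y \<in> L" if xy: "x \<in> L" "y \<in> L" for x y
  proof -
    obtain k l where "x = (\<Sum>b\<in>B. of_int (k b) *\<^sub>R b)" "y = (\<Sum>b\<in>B. of_int (l b) *\<^sub>R b)"
      using xy unfolding L by blast
    then have "x - y = (\<Sum>b\<in>B. of_int (k b - l b) *\<^sub>R b)"
      by (simp add: scaleR_left_diff_distrib sum_subtractf)
    then show ?thesis unfolding L by (auto intro!: exI[of _ "\<lambda>b. k b - l b"])
  qed
  show m: "- x \<in> L" if "x \<in> L" for x using d[OF 0 that] by simp
  show "x + y \<in> L" if "x \<in> L" "y \<in> L" for x y using d[OF that(1) m[OF that(2)]] by simp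
qed

lemma finite_lattice_ball:
  fixes L :: "(real^'n) set"
  assumes "full_lattice L"
  shows "finite {v\<in>L. norm (a - v) \<le> r}"
proof -
  obtain B where ind: "independent B" and sp: "span B = (UNIV :: (real^'n) set)"
    and L: "L = {\<Sum>b\<in>B. of_int (k b) *\<^sub>R b | k :: real^'n \<Rightarrow> int. True}"
    using assms unfolding full_lattice_def by blast
  have fB: "finite B" using ind independent_bound by blast
  have lin: "linear (\<lambda>v. representation B v b)" for b
    using ind sp by (intro linearI) (auto simp: representation_add representation_scale)
  have "\<forall>b. \<exists>M. \<forall>v. \<bar>representation B v b\<bar> \<le> M * norm v"
    using linear_bounded[OF lin] by (metis real_norm_def)
  then obtain M where M: "\<And>b v. \<bar>representation B v b\<bar> \<le> M b * norm v" by metis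
  define N where "N b = \<lceil>\<bar>M b\<bar> * (norm a + \<bar>r\<bar>)\<rceil>" for b
  have "{v\<in>L. norm (a - v) \<le> r} \<subseteq>
      (\<lambda>k. \<Sum>b\<in>B. of_int (k b) *\<^sub>R b) ` (PiE B (\<lambda>b. {- N b..N b}))"
  proof
    fix v assume v: "v \<in> {v\<in>L. norm (a - v) \<le> r}"
    then obtain k :: "real^'n \<Rightarrow> int" where k: "v = (\<Sum>b\<in>B. of_int (k b) *\<^sub>R b)"
      unfolding L by blast
    have nv: "norm v \<le> norm a + \<bar>r\<bar>"
      using v norm_triangle_sub[of v a] by (auto simp: norm_minus_commute)
    have "\<bar>k b\<bar> \<le> N b" if b: "b \<in> B" for b
    proof -
      have "representation B v b = (\<Sum>c\<in>B. of_int (k c) * representation B c b)"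
        unfolding k using linear_sum[OF lin, of "\<lambda>c. of_int (k c) *\<^sub>R c" B b]
        by (simp add: linear_scale[OF lin])
      also have "\<dots> = (\<Sum>c\<in>B. if c = b then of_int (k b) else 0)"
        by (rule sum.cong) (auto simp: representation_basis[OF ind])
      also have "\<dots> = of_int (k b)" using fB b by simp
      finally have "\<bar>real_of_int (k b)\<bar> \<le> M b * norm v" using M[of v b] by simp
      also have "\<dots> \<le> \<bar>M b\<bar> * (norm a + \<bar>r\<bar>)" by (intro mult_mono nv) auto
      finally show ?thesis unfolding N_def by linarith
    qed
    then have "restrict k B \<in> PiE B (\<lambda>b. {- N b..N b})" by (fastforce simp: abs_le_iff)
    moreover have "v = (\<Sum>b\<in>B. of_int (restrict k B b) *\<^sub>R b)"
      unfolding k by (intro sum.cong) auto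
    ultimately show "v \<in> (\<lambda>k. \<Sum>b\<in>B. of_int (k b) *\<^sub>R b) ` (PiE B (\<lambda>b. {- N b..N b}))"
      by blast
  qed
  moreover have "finite (PiE B (\<lambda>b. {- N b..N b}))" using fB by (intro finite_PiE) auto
  ultimately show ?thesis by (meson finite_imageI finite_subset)
qed

lemma torus_dist_class:
  fixes L :: "(real^'n) set"
  assumes L: "full_lattice L"
  shows "torus_dist L (lattice_rel L `` {x}) (lattice_rel L `` {y}) = (INF v\<in>L. norm (x - y - v))"
proof -
  note grp = full_lattice_group[OF L]
  define p q where "p = (SOME p. p \<in> lattice_rel L `` {x})" and "q = (SOME q. q \<in> lattice_rel L `` {y})"
  have "x \<in> lattice_rel L `` {x}" "y \<in> lattice_rel L `` {y}"
    using grp(1) by (auto simp: lattice_rel_def)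
  then have "p \<in> lattice_rel L `` {x}" "q \<in> lattice_rel L `` {y}"
    unfolding p_def q_def by (metis someI)+
  then have pq: "x - p \<in> L" "y - q \<in> L" by (auto simp: lattice_rel_def)
  define w where "w = (x - p) - (y - q)"
  have w: "w \<in> L" unfolding w_def using pq grp(2) by blast
  have "(\<lambda>v. norm (p - q - v)) ` L = (\<lambda>v. norm (x - y - v)) ` L"
  proof (intro equalityI subsetI)
    fix r assume "r \<in> (\<lambda>v. norm (p - q - v)) ` L"
    then obtain v where v: "v \<in> L" "r = norm (p - q - v)" by blast
    have "v + w \<in> L" using v w grp(4) by blast
    moreover have "p - q - v = x - y - (v + w)" unfolding w_def by simp
    ultimately show "r \<in> (\<lambda>v. norm (x - y - v)) ` L" using v by (metis imageI)
  next
    fix r assume "r \<in> (\<lambda>v. norm (x - y - v)) ` L"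
    then obtain v where v: "v \<in> L" "r = norm (x - y - v)" by blast
    have "v - w \<in> L" using v w grp(2) by blast
    moreover have "x - y - v = p - q - (v - w)" unfolding w_def by simp
    ultimately show "r \<in> (\<lambda>v. norm (p - q - v)) ` L" using v by (metis imageI)
  qed
  then show ?thesis unfolding torus_dist_def p_def[symmetric] q_def[symmetric] by simp
qed

lemma torus_dist_attained:
  fixes L :: "(real^'n) set"
  assumes L: "full_lattice L"
  shows "\<exists>v\<in>L. (INF v\<in>L. norm (x - y - v)) = norm (x - y - v)"
proof -
  define S where "S = {v\<in>L. norm (x - y - v) \<le> norm (x - y)}"
  have S: "finite S" "0 \<in> S"
    using finite_lattice_ball[OF L] full_lattice_group(1)[OF L] by (auto simp: S_def)
  define v where "v = arg_min_on (\<lambda>v. norm (x - y - v)) S"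
  have v: "v \<in> S" using S arg_min_if_finite(1)[of S] unfolding v_def by blast
  have least: "norm (x - y - v) \<le> norm (x - y - u)" if "u \<in> L" for u
  proof (cases "u \<in> S")
    case True
    then show ?thesis using arg_min_least[of S u "\<lambda>v. norm (x - y - v)"] S unfolding v_def by blast
  next
    case False
    then show ?thesis using that v by (auto simp: S_def)
  qed
  have "(INF v\<in>L. norm (x - y - v)) = norm (x - y - v)"
    by (rule cInf_eq_minimum) (use v least in \<open>auto simp: S_def\<close>)
  then show ?thesis using v by (auto simp: S_def)
qed

lemma complex_field_simps [simp]:
  "carrier complex_field = UNIV" "x \<otimes>\<^bsub>complex_field\<^esub> y = x * y" "\<one>\<^bsub>complex_field\<^esub> = 1"
  "x \<oplus>\<^bsub>complex_field\<^esub> y = x + y" "\<zero>\<^bsub>complex_field\<^esub> = 0"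
  by (simp_all add: complex_field_def)

lemma cring_complex_field: "cring complex_field"
proof (rule cringI)
  show "abelian_group complex_field"
    by (rule abelian_groupI) (auto simp: add.assoc add.commute intro: exI[of _ "- _"] add.left_inverse)
  show "Group.comm_monoid complex_field"
    by (rule comm_monoidI) (auto simp: mult.assoc mult.commute)
qed (auto simp: distrib_right)

context hilbert_space
begin

lemma ip_zero_left [simp]: "y \<in> carrier H \<Longrightarrow> ip H \<zero> y = 0"
  using ip_add_left[of "\<zero>" "\<zero>" y] by simp

lemma ip_diff_left:
  assumes "x \<in> carrier H" "y \<in> carrier H" "w \<in> carrier H"
  shows "ip H (x \<ominus> y) w = ip H x w - ip H y w"
proof -
  have "(x \<ominus> y) \<oplus> y = x" using assms by (simp add: a_minus_def M.a_assoc M.l_neg)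
  then show ?thesis using ip_add_left[of "x \<ominus> y" y w] assms by simp
qed

lemma ip_diff_right:
  assumes "x \<in> carrier H" "y \<in> carrier H" "w \<in> carrier H"
  shows "ip H w (x \<ominus> y) = ip H w x - ip H w y"
  using assms ip_diff_left[OF assms] ip_commute by (metis M.minus_closed complex_cnj_diff)

lemma ip_smult_right:
  assumes "x \<in> carrier H" "y \<in> carrier H"
  shows "ip H x (c \<odot> y) = cnj c * ip H x y"
  using assms ip_smult_left[of y x c] ip_commute
  by (metis UNIV_I complex_cnj_mult complex_field_simps(1) smult_closed)

lemma ip_self: "x \<in> carrier H \<Longrightarrow> ip H x x = of_real (Re (ip H x x))"
  using ip_commute[of x x] by (metis Reals_cnj_iff of_real_Re)

lemma ip_self_nonneg: "x \<in> carrier H \<Longrightarrow> 0 \<le> Re (ip H x x)"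
  using ip_pos[of x] by (cases "x = \<zero>") auto

lemma Cauchy_Schwarz:
  assumes x: "x \<in> carrier H" and y: "y \<in> carrier H"
  shows "cmod (ip H x y) \<le> hnorm H x * hnorm H y"
proof (cases "y = \<zero>")
  case True
  then have "ip H x y = 0" using x y ip_commute[of y x] by simp
  then show ?thesis using x y by (simp add: hnorm_def ip_self_nonneg)
next
  case False
  define a where "a = Re (ip H y y)"
  define b where "b = Re (ip H x x)"
  define c where "c = ip H x y"
  have a: "0 < a" "ip H y y = of_real a" using ip_pos[OF y False] ip_self[OF y] by (auto simp: a_def)
  have b: "ip H x x = of_real b" using ip_self[OF x] by (simp add: b_def)
  have c': "ip H y x = cnj c" using ip_commute[OF x y] by (simp add: c_def)
  define w where "w = (of_real a \<odot> x) \<ominus> (c \<odot> y)"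
  have w: "w \<in> carrier H" using x y by (simp add: w_def)
  have "ip H w w = of_real a * of_real a * of_real b - of_real a * (c * cnj c)"
    using x y unfolding w_def
    by (simp add: ip_diff_left ip_diff_right ip_smult_left ip_smult_right a b c' c_def[symmetric]
        algebra_simps)
  then have "ip H w w = of_real (a * (a * b - (cmod c)\<^sup>2))"
    by (simp add: complex_norm_square[symmetric] algebra_simps flip: of_real_power)
  then have "0 \<le> a * (a * b - (cmod c)\<^sup>2)" using ip_self_nonneg[OF w] by simp
  then have "(cmod c)\<^sup>2 \<le> b * a" using a by (simp add: zero_le_mult_iff mult.commute)
  then have "cmod c \<le> sqrt (b * a)" by (rule real_le_rsqrt)
  then show ?thesis by (simp add: hnorm_def a_def b_def c_def real_sqrt_mult)
qed

end

lemma least_distortion_le: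
  fixes L :: "(real^'n) set" and H :: "'a hilbert"
  assumes emb: "euclidean_embedding L H \<phi>"
  shows "least_distortion L \<le> distortion L H \<phi>"
proof -
  interpret hilbert_space H using emb by (simp add: euclidean_embedding_def)
  define T where "T = flat_torus L"
  have \<phi>: "\<phi> X \<in> carrier H" if "X \<in> T" for X
    using emb that by (auto simp: euclidean_embedding_def T_def)
  have inj\<phi>: "inj_on \<phi> T" using emb by (simp add: euclidean_embedding_def T_def)
  define K where "K = {h \<in> carrier H. \<forall>k\<in>carrier H. (\<forall>X\<in>T. ip H (\<phi> X) k = 0) \<longrightarrow> ip H h k = 0}"
  have Kc: "h \<in> carrier H" if "h \<in> K" for h using that by (simp add: K_def)
  have K0: "\<zero>\<^bsub>H\<^esub> \<in> K" by (simp add: K_def)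
  have Kadd: "h \<oplus>\<^bsub>H\<^esub> k \<in> K" if "h \<in> K" "k \<in> K" for h k
    using that by (auto simp: K_def ip_add_left)
  have Ksm: "c \<odot>\<^bsub>H\<^esub> h \<in> K" if "h \<in> K" for c h
    using that by (auto simp: K_def ip_smult_left)
  have Kdiff: "h \<ominus>\<^bsub>H\<^esub> k \<in> K" if "h \<in> K" "k \<in> K" for h k
    using that by (auto simp: K_def ip_diff_left)
  have K\<phi>: "\<phi> X \<in> K" if "X \<in> T" for X using that \<phi> by (auto simp: K_def)
  define cls where "cls x = lattice_rel L `` {x}" for x :: "real^'n"
  have cls: "cls x \<in> T" for x by (simp add: T_def flat_torus_def cls_def quotientI)
  have T: "\<exists>x. X = cls x" if "X \<in> T" for X
    using that by (auto simp: T_def flat_torus_def cls_def elim: quotientE)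
  define f where "f h = (\<lambda>x. ip H h (\<phi> (cls x)))" for h
  have f_add: "f (h \<oplus>\<^bsub>H\<^esub> k) = (\<lambda>x. f h x + f k x)" if "h \<in> K" "k \<in> K" for h k
    using that Kc \<phi> cls by (auto simp: f_def ip_add_left)
  have f_sm: "f (c \<odot>\<^bsub>H\<^esub> h) = (\<lambda>x. c * f h x)" if "h \<in> K" for c h
    using that Kc \<phi> cls by (auto simp: f_def ip_smult_left)
  have injf: "inj_on f K"
  proof (rule inj_onI)
    fix h k assume hk: "h \<in> K" "k \<in> K" and eq: "f h = f k"
    define d where "d = h \<ominus>\<^bsub>H\<^esub> k"
    have d: "d \<in> K" using Kdiff hk by (simp add: d_def)
    have "ip H (\<phi> X) d = 0" if X: "X \<in> T" for X
    proof -
      obtain x where x: "X = cls x" using T[OF X] by blast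
      have "ip H d (\<phi> X) = f h x - f k x"
        using hk Kc \<phi>[OF X] by (simp add: d_def ip_diff_left f_def x)
      then show ?thesis using eq ip_commute[OF Kc[OF d] \<phi>[OF X]] by simp
    qed
    then have "ip H d d = 0" using d by (auto simp: K_def)
    then have "d = \<zero>\<^bsub>H\<^esub>" using ip_pos[OF Kc[OF d]] by auto
    then have "(h \<ominus>\<^bsub>H\<^esub> k) \<oplus>\<^bsub>H\<^esub> k = k" using hk Kc by (simp add: d_def)
    then show "h = k" using hk Kc by (simp add: a_minus_def M.a_assoc M.l_neg)
  qed
  define g where "g = the_inv_into K f"
  have gf [simp]: "g (f h) = h" if "h \<in> K" for h
    using that injf by (simp add: g_def the_inv_into_f_f)
  define H' :: "(real^'n \<Rightarrow> complex) hilbert" where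
    "H' = \<lparr>carrier = f ` K, mult = undefined, one = undefined, zero = f \<zero>\<^bsub>H\<^esub>,
           add = (\<lambda>p q x. p x + q x), smult = (\<lambda>c p x. c * p x), ip = (\<lambda>p q. ip H (g p) (g q))\<rparr>"
  have H'_simps: "carrier H' = f ` K" "\<zero>\<^bsub>H'\<^esub> = f \<zero>\<^bsub>H\<^esub>" "ip H' p q = ip H (g p) (g q)" for p q
    by (simp_all add: H'_def)
  have add': "f h \<oplus>\<^bsub>H'\<^esub> f k = f (h \<oplus>\<^bsub>H\<^esub> k)" if "h \<in> K" "k \<in> K" for h k
    using f_add[OF that] by (simp add: H'_def)
  have sm': "c \<odot>\<^bsub>H'\<^esub> f h = f (c \<odot>\<^bsub>H\<^esub> h)" if "h \<in> K" for c h
    using f_sm[OF that] by (simp add: H'_def)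
  have grp': "abelian_group H'"
  proof (rule abelian_groupI)
    fix p assume "p \<in> carrier H'"
    then obtain h where h: "h \<in> K" "p = f h" by (auto simp: H'_simps)
    have n: "\<ominus>\<^bsub>H\<^esub> h \<in> K" using Kdiff[OF K0 h(1)] Kc[OF h(1)] by (simp add: a_minus_def)
    show "\<exists>y\<in>carrier H'. y \<oplus>\<^bsub>H'\<^esub> p = \<zero>\<^bsub>H'\<^esub>"
      using n h Kc[OF h(1)] by (intro bexI[of _ "f (\<ominus>\<^bsub>H\<^esub> h)"]) (simp_all add: H'_simps add' M.l_neg)
  qed (use Kc K0 Kadd in \<open>auto simp: H'_simps add' M.a_ac\<close>)
  interpret G: abelian_group H' by (rule grp')
  have minus': "f h \<ominus>\<^bsub>H'\<^esub> f k = f (h \<ominus>\<^bsub>H\<^esub> k)" if hk: "h \<in> K" "k \<in> K" for h k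
  proof -
    have "(h \<ominus>\<^bsub>H\<^esub> k) \<oplus>\<^bsub>H\<^esub> k = h" using hk Kc by (simp add: a_minus_def M.a_assoc M.l_neg)
    then have e: "f h = f (h \<ominus>\<^bsub>H\<^esub> k) \<oplus>\<^bsub>H'\<^esub> f k" using add'[OF Kdiff[OF hk] hk(2)] by simp
    have c: "f (h \<ominus>\<^bsub>H\<^esub> k) \<in> carrier H'" "f k \<in> carrier H'"
      using Kdiff[OF hk] hk by (auto simp: H'_simps)
    show ?thesis unfolding e using c by (simp add: a_minus_def G.a_assoc G.r_neg)
  qed
  have hdist': "hdist H' (f h) (f k) = hdist H h k" if "h \<in> K" "k \<in> K" for h k
    using that Kdiff by (simp add: hdist_def hnorm_def minus' H'_simps)
  have mod': "module complex_field H'"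
    by (rule moduleI)
       (use cring_complex_field grp' Kc K0 Kadd Ksm in
         \<open>auto simp: H'_simps sm' add' smult_l_distr smult_r_distr smult_assoc1
            simp flip: complex_field_simps(2-4)\<close>)
  have hilb: "hilbert_space H'"
  proof (intro hilbert_space.intro mod' hilbert_space_axioms.intro)
    fix s :: "nat \<Rightarrow> real^'n \<Rightarrow> complex" assume s: "\<And>k. s k \<in> carrier H'"
      and cau: "\<forall>e>0. \<exists>N. \<forall>i\<ge>N. \<forall>j\<ge>N. hdist H' (s i) (s j) < e"
    define t where "t = g \<circ> s"
    have t: "t k \<in> K" "s k = f (t k)" for k using s[of k] by (auto simp: H'_simps t_def)
    have "\<forall>e>0. \<exists>N. \<forall>i\<ge>N. \<forall>j\<ge>N. hdist H (t i) (t j) < e"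
      using cau t by (simp add: hdist')
    then obtain l where l: "l \<in> carrier H" and lim: "(\<lambda>k. hdist H (t k) l) \<longlonglongrightarrow> 0"
      using hcomplete[of t] t(1) Kc by blast
    have "ip H l k = 0" if k: "k \<in> carrier H" and orth: "\<forall>X\<in>T. ip H (\<phi> X) k = 0" for k
    proof -
      have "cmod (ip H l k) \<le> hdist H (t i) l * hnorm H k" for i
      proof -
        have "ip H (t i) k = 0" using t(1)[of i] k orth by (auto simp: K_def)
        then have "ip H (t i \<ominus>\<^bsub>H\<^esub> l) k = - ip H l k"
          using t(1)[of i] Kc l k by (simp add: ip_diff_left)
        then show ?thesis
          using Cauchy_Schwarz[of "t i \<ominus>\<^bsub>H\<^esub> l" k] t(1)[of i] Kc l k by (simp add: hdist_def)
      qed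
      moreover have "(\<lambda>i. hdist H (t i) l * hnorm H k) \<longlonglongrightarrow> 0 * hnorm H k"
        by (intro tendsto_mult lim tendsto_const)
      ultimately have "cmod (ip H l k) \<le> 0 * hnorm H k"
        by (intro LIMSEQ_le_const) auto
      then show ?thesis by simp
    qed
    then have "l \<in> K" using l by (simp add: K_def)
    then show "\<exists>l\<in>carrier H'. (\<lambda>k. hdist H' (s k) l) \<longlonglongrightarrow> 0"
      using lim t by (intro bexI[of _ "f l"]) (simp_all add: H'_simps hdist')
  qed (use Kc K0 Kadd Ksm in \<open>auto simp: H'_simps add' sm' ip_add_left ip_smult_left
         intro: ip_commute ip_pos\<close>)
  have "inj_on (f \<circ> \<phi>) T"
    using inj\<phi> injf K\<phi> by (intro comp_inj_on) (auto intro: inj_on_subset)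
  then have "euclidean_embedding L H' (f \<circ> \<phi>)"
    using hilb K\<phi> by (auto simp: euclidean_embedding_def T_def H'_simps)
  moreover have "distortion L H' (f \<circ> \<phi>) = distortion L H \<phi>"
    unfolding distortion_def
    by (intro arg_cong2[of _ _ _ _ "(*)"] SUP_cong)
       (auto simp: distinct_pairs_def T_def[symmetric] hdist' K\<phi>)
  ultimately show ?thesis
    unfolding least_distortion_def by (intro Inf_lower) (auto intro!: exI[of _ H'] exI[of _ "f \<circ> \<phi>"])
qed

end

theory Submission
  imports Defs
begin

text \<open>
  Put \<open>energy z x = 2 * (\<Sum>\<^sub>\<infinity>u. z u * (1 - cos (2 * pi * (u \<bullet> x))))\<close>. This is the squared distance between the
  images of \<open>y + x\<close> and \<open>y\<close> under the map whose coordinates are \<open>sqrt (z u)\<close> times the characters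
  \<open>exp (2 * pi * \<i> * (u \<bullet> y))\<close>, where \<open>u\<close> runs over the dual lattice. The first constraint of the program says
  that this map does not contract the torus metric. The second one, after a second order Taylor
  expansion at the origin, says that it stretches the metric by a factor at most \<open>sqrt C\<close>. So feasible points are
  the same thing as translation-invariant embeddings with distortion at most \<open>sqrt C\<close>
  (\<open>trig_embedding\<close> gives one direction for finite supports).

  An arbitrary embedding becomes translation-invariant when its Gram kernel is averaged over the
  torus. The average is taken over the finite group \<open>(1/N) L / L\<close> of torsion points, where positivity
  and inversion of the Fourier transform are statements on finite sums. For \<open>N = 3 ^ k\<close>
  this gives weights which satisfy the constraints on the points of \<open>(1/N) L\<close> and whose second moments
  \<open>\<Sum>u. z u * (norm u)\<^sup>2\<close> are bounded independently of \<open>N\<close>. The weights with such a bound form a compact set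
  for pointwise convergence, and the energy is continuous on it because the mass outside a ball of
  radius \<open>r\<close> is \<open>O(1/r\<^sup>2)\<close>. A limit point satisfies the constraints on a dense set, hence
  everywhere (\<open>kernel_imp_certificate\<close>, \<open>embedding_imp_certificate\<close>). Thus no embedding beats the
  optimum of the program.

  The same compactness gives an optimal solution, and among the optimal ones a solution of maximal
  total mass \<open>\<Sum>u. z u\<close> (\<open>ex_optimal_certificate\<close>). Maximality yields the structure of the support
  because of two exchanges which preserve the second moment matrix, do not decrease the energy, and
  increase the mass:

  \<^item> if \<open>u = a + w\<close> and \<open>v = a - w\<close> both carry weight \<open>t\<close>, move it to weight \<open>2 * t\<close> on \<open>a\<close> and on \<open>w\<close> (and likewise
    for the negatives); the gain in energy is governed by \<open>(1 - cos \<alpha>) * (1 - cos \<beta>) \<ge> 0\<close> (\<open>maximal_mass_parity\<close>);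
  \<^item> if \<open>u = k w\<close> carries weight \<open>t\<close>, move it to weight \<open>k\<^sup>2 * t\<close> on \<open>w\<close>, using
    \<open>1 - cos (k * \<theta>) \<le> k\<^sup>2 * (1 - cos \<theta>)\<close> (\<open>maximal_mass_primitive\<close>).

  Two vectors \<open>u\<close>, \<open>v\<close> can be written as \<open>a + w\<close>, \<open>a - w\<close> with \<open>a\<close>, \<open>w\<close> in the dual lattice exactly if they are
  congruent modulo twice the dual lattice. So every class contains at most one pair of support vectors,
  the support is finite since there are finitely many classes, and the corresponding trigonometric
  embedding is finite-dimensional with distortion \<open>sqrt C\<close>.
\<close>

section \<open>Lattice bases and the torus metric\<close>

text \<open>The basis is indexed by the coordinate type itself, so that coordinates become functions
  \<open>'n \<Rightarrow> int\<close>. The vectors \<open>b'\<close> form the dual basis, and \<open>x \<bullet> b' i\<close> are the coordinates of \<open>x\<close>.\<close>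

locale lattice_basis =
  fixes L :: "(real^'n) set" and b b' :: "'n \<Rightarrow> real^'n"
  assumes full: "full_lattice L"
    and biorthogonal: "b i \<bullet> b' j = (if i = j then 1 else 0)"
    and lattice_eq: "L = range (\<lambda>k :: 'n \<Rightarrow> int. \<Sum>i\<in>UNIV. of_int (k i) *\<^sub>R b i)"
    and expand: "x = (\<Sum>i\<in>UNIV. (x \<bullet> b' i) *\<^sub>R b i)"

lemma full_lattice_imp_basis:
  fixes L :: "(real^'n) set"
  assumes full: "full_lattice L"
  obtains b b' :: "'n \<Rightarrow> real^'n" where "lattice_basis L b b'"
proof -
  obtain B where ind: "independent B" and sp: "span B = (UNIV :: (real^'n) set)"
    and L: "L = {\<Sum>b\<in>B. of_int (k b) *\<^sub>R b | k :: real^'n \<Rightarrow> int. True}"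
    using full unfolding full_lattice_def by blast
  have fB: "finite B" using ind independent_bound by blast
  have "card B = CARD('n)"
    using dim_span_eq_card_independent[OF ind] sp by (simp add: dim_UNIV)
  then obtain b :: "'n \<Rightarrow> real^'n" where b: "bij_betw b UNIV B"
    using finite_same_card_bij[of "UNIV :: 'n set" B] fB by auto
  have bB: "b i \<in> B" for i using b by (auto simp: bij_betw_def)
  have binj: "b i = b j \<longleftrightarrow> i = j" for i j using b by (auto simp: bij_betw_def inj_on_def)
  have lin: "linear (\<lambda>v. representation B v c)" for c
    using ind sp by (intro linearI) (auto simp: representation_add representation_scale)
  \<comment> \<open>The Riesz representative of the i-th coordinate functional.\<close>
  define b' where "b' i = (\<Sum>e\<in>Basis. representation B e (b i) *\<^sub>R e)" for i
  have b': "x \<bullet> b' i = representation B x (b i)" for x i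
  proof -
    have "x \<bullet> b' i = (\<Sum>e\<in>Basis. (x \<bullet> e) * representation B e (b i))"
      by (simp add: b'_def inner_sum_right mult.commute)
    also have "\<dots> = representation B (\<Sum>e\<in>Basis. (x \<bullet> e) *\<^sub>R e) (b i)"
      using linear_sum[OF lin[of "b i"], of "\<lambda>e. (x \<bullet> e) *\<^sub>R e" Basis] by (simp add: linear_scale[OF lin])
    finally show ?thesis by (simp add: euclidean_representation)
  qed
  have reindex: "(\<Sum>c\<in>B. f c) = (\<Sum>i\<in>UNIV. f (b i))" for f :: "real^'n \<Rightarrow> real^'n"
    using sum.reindex_bij_betw[OF b, of f] by simp
  have "lattice_basis L b b'"
  proof
    show "full_lattice L" by fact
    show "b i \<bullet> b' j = (if i = j then 1 else 0)" for i j
      using representation_basis[OF ind bB[of i]] binj by (auto simp: b')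
    show "x = (\<Sum>i\<in>UNIV. (x \<bullet> b' i) *\<^sub>R b i)" for x
    proof -
      have "(\<Sum>c\<in>B. representation B x c *\<^sub>R c) = x"
        by (rule sum_representation_eq) (use ind sp fB in auto)
      then show ?thesis unfolding b' reindex by simp
    qed
    show "L = range (\<lambda>k :: 'n \<Rightarrow> int. \<Sum>i\<in>UNIV. of_int (k i) *\<^sub>R b i)"
    proof (intro equalityI subsetI)
      fix x assume "x \<in> L"
      then obtain k :: "real^'n \<Rightarrow> int" where "x = (\<Sum>c\<in>B. of_int (k c) *\<^sub>R c)" unfolding L by blast
      then show "x \<in> range (\<lambda>k :: 'n \<Rightarrow> int. \<Sum>i\<in>UNIV. of_int (k i) *\<^sub>R b i)"
        by (auto simp: reindex intro!: image_eqI[of _ _ "k \<circ> b"])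
    next
      fix x assume "x \<in> range (\<lambda>k :: 'n \<Rightarrow> int. \<Sum>i\<in>UNIV. of_int (k i) *\<^sub>R b i)"
      then obtain k :: "'n \<Rightarrow> int" where k: "x = (\<Sum>i\<in>UNIV. of_int (k i) *\<^sub>R b i)" by blast
      have "x = (\<Sum>c\<in>B. of_int (k (inv_into UNIV b c)) *\<^sub>R c)"
        unfolding reindex k using b by (simp add: bij_betw_def)
      then show "x \<in> L" unfolding L by (auto intro!: exI[of _ "k \<circ> inv_into UNIV b"])
    qed
  qed
  then show ?thesis by (rule that)
qed

context lattice_basis
begin

abbreviation "D \<equiv> dual_lattice L"

lemma expand_dual: "y = (\<Sum>i\<in>UNIV. (y \<bullet> b i) *\<^sub>R b' i)"
proof (subst vector_eq_ldot[symmetric], rule allI)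
  fix x
  have "x \<bullet> y = (\<Sum>i\<in>UNIV. (x \<bullet> b' i) *\<^sub>R b i) \<bullet> y" using expand[of x] by simp
  then show "x \<bullet> y = x \<bullet> (\<Sum>i\<in>UNIV. (y \<bullet> b i) *\<^sub>R b' i)"
    by (simp add: inner_sum_left inner_sum_right inner_commute mult.commute)
qed

lemma inner_combination_dual: "(\<Sum>i\<in>UNIV. c i *\<^sub>R b i) \<bullet> b' j = c j"
  by (simp add: inner_sum_left biorthogonal if_distrib cong: if_cong)

lemma inner_dual_combination: "(\<Sum>i\<in>UNIV. c i *\<^sub>R b' i) \<bullet> b j = c j"
  by (simp add: inner_sum_left inner_commute[of "b' _"] biorthogonal if_distrib cong: if_cong)

lemma inner_eq_sum_coordinates: "u \<bullet> x = (\<Sum>i\<in>UNIV. (u \<bullet> b i) * (x \<bullet> b' i))"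
  by (subst expand[of x]) (simp add: inner_sum_right mult.commute)

lemma mem_lattice_iff: "x \<in> L \<longleftrightarrow> (\<forall>i. x \<bullet> b' i \<in> \<int>)"
proof
  assume "x \<in> L" then show "\<forall>i. x \<bullet> b' i \<in> \<int>"
    by (auto simp: lattice_eq inner_combination_dual)
next
  assume "\<forall>i. x \<bullet> b' i \<in> \<int>"
  then have "x \<bullet> b' i = of_int \<lfloor>x \<bullet> b' i\<rfloor>" for i by (metis Ints_cases floor_of_int)
  then have "x = (\<Sum>i\<in>UNIV. of_int \<lfloor>x \<bullet> b' i\<rfloor> *\<^sub>R b i)" using expand[of x] by simp
  then show "x \<in> L" unfolding lattice_eq by (rule range_eqI[of _ _ "\<lambda>i. \<lfloor>x \<bullet> b' i\<rfloor>"])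
qed

lemma half_basis_vector_notin: "(1 / 2) *\<^sub>R b i \<notin> L"
proof -
  have "(1 / 2 :: real) \<notin> \<int>"
  proof
    assume "(1 / 2 :: real) \<in> \<int>"
    then obtain k where "(1 / 2 :: real) = of_int k" by (rule Ints_cases)
    then have "real_of_int (2 * k) = of_int 1" by simp
    then have "2 * k = 1" by (simp only: of_int_eq_iff)
    then show False by presburger
  qed
  then show ?thesis unfolding mem_lattice_iff by (auto simp: biorthogonal intro!: exI[of _ i])
qed

lemma mem_dual_iff: "u \<in> D \<longleftrightarrow> (\<forall>i. u \<bullet> b i \<in> \<int>)"
proof
  assume u: "u \<in> D"
  have "b i \<in> L" for i by (simp add: mem_lattice_iff biorthogonal)
  then show "\<forall>i. u \<bullet> b i \<in> \<int>" using u by (auto simp: dual_lattice_def)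
next
  assume "\<forall>i. u \<bullet> b i \<in> \<int>"
  then have "u \<bullet> v \<in> \<int>" if "v \<in> L" for v
    using that unfolding mem_lattice_iff by (subst inner_eq_sum_coordinates) (intro Ints_sum Ints_mult, auto)
  then show "u \<in> D" by (simp add: dual_lattice_def)
qed

lemma dual_group: "0 \<in> D" "u \<in> D \<Longrightarrow> - u \<in> D" "u \<in> D \<Longrightarrow> v \<in> D \<Longrightarrow> u + v \<in> D"
    "u \<in> D \<Longrightarrow> v \<in> D \<Longrightarrow> u - v \<in> D"
  by (auto simp: dual_lattice_def inner_add_left inner_diff_left)

text \<open>Cauchy--Schwarz for the expansion in the basis. Only some bound of this shape is needed, to compare the
  Euclidean norm with the coordinates.\<close>

lemma norm_sq_le_coordinates:
  "(norm x)\<^sup>2 \<le> (\<Sum>i\<in>UNIV. (x \<bullet> b' i)\<^sup>2) * (\<Sum>i\<in>UNIV. (norm (b i))\<^sup>2)"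
proof -
  have "norm x \<le> (\<Sum>i\<in>UNIV. \<bar>x \<bullet> b' i\<bar> * \<bar>norm (b i)\<bar>)"
    by (subst expand[of x]) (rule order_trans[OF norm_sum], simp)
  also have "\<dots> \<le> L2_set (\<lambda>i. x \<bullet> b' i) UNIV * L2_set (\<lambda>i. norm (b i)) UNIV"
    by (rule L2_set_mult_ineq)
  finally have "(norm x)\<^sup>2 \<le> (L2_set (\<lambda>i. x \<bullet> b' i) UNIV * L2_set (\<lambda>i. norm (b i)) UNIV)\<^sup>2"
    by (intro power_mono) auto
  then show ?thesis by (simp add: power_mult_distrib L2_set_def sum_nonneg)
qed

lemma dual_eq: "D = range (\<lambda>k :: 'n \<Rightarrow> int. \<Sum>i\<in>UNIV. of_int (k i) *\<^sub>R b' i)"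
proof (intro equalityI subsetI)
  fix u assume "u \<in> D"
  then have "u \<bullet> b i = of_int \<lfloor>u \<bullet> b i\<rfloor>" for i by (metis mem_dual_iff Ints_cases floor_of_int)
  then have "u = (\<Sum>i\<in>UNIV. of_int \<lfloor>u \<bullet> b i\<rfloor> *\<^sub>R b' i)" using expand_dual[of u] by simp
  then show "u \<in> range (\<lambda>k :: 'n \<Rightarrow> int. \<Sum>i\<in>UNIV. of_int (k i) *\<^sub>R b' i)"
    by (rule range_eqI[of _ _ "\<lambda>i. \<lfloor>u \<bullet> b i\<rfloor>"])
qed (auto simp: mem_dual_iff inner_dual_combination)

lemma full_lattice_dual: "full_lattice D"
  unfolding full_lattice_def
proof (intro exI[of _ "range b'"] conjI)
  have inj: "inj b'" by (metis biorthogonal injI zero_neq_one)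
  have sp: "x \<in> span (range b')" for x
    by (subst expand_dual[of x]) (intro span_sum span_scale span_base rangeI)
  then show "span (range b') = UNIV" by auto
  show "independent (range b')"
    by (rule card_le_dim_spanning[of _ UNIV])
       (use inj sp in \<open>auto simp: dim_UNIV card_image\<close>)
  have reindex: "(\<Sum>c\<in>range b'. f c) = (\<Sum>i\<in>UNIV. f (b' i))" for f :: "real^'n \<Rightarrow> real^'n"
    using sum.reindex[OF inj, of f] by simp
  show "D = {\<Sum>b\<in>range b'. of_int (k b) *\<^sub>R b | k :: real^'n \<Rightarrow> int. True}"
  proof (intro equalityI subsetI)
    fix u assume "u \<in> D"
    then obtain k :: "'n \<Rightarrow> int" where k: "u = (\<Sum>i\<in>UNIV. of_int (k i) *\<^sub>R b' i)"
      unfolding dual_eq by blast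
    have "u = (\<Sum>c\<in>range b'. of_int (k (inv_into UNIV b' c)) *\<^sub>R c)"
      unfolding reindex k using inj by simp
    then show "u \<in> {\<Sum>b\<in>range b'. of_int (k b) *\<^sub>R b | k :: real^'n \<Rightarrow> int. True}"
      by (auto intro!: exI[of _ "k \<circ> inv_into UNIV b'"])
  qed (auto simp: reindex mem_dual_iff inner_dual_combination)
qed

text \<open>Duality exchanges the two bases; this transfers local finiteness and the norm bound to
  the dual lattice.\<close>

lemma dual_lattice_basis: "lattice_basis (dual_lattice L) b' b"
proof
  show "b' i \<bullet> b j = (if i = j then 1 else 0)" for i j
    using biorthogonal[of j i] by (auto simp: inner_commute)
qed (fact full_lattice_dual dual_eq expand_dual)+

lemma finite_dual_ball: "finite {u\<in>D. norm u \<le> r}"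
  using finite_lattice_ball[OF lattice_basis.full[OF dual_lattice_basis], of 0 r] by simp

lemma norm_sq_le_dual_coordinates:
  "(norm u)\<^sup>2 \<le> (\<Sum>i\<in>UNIV. (u \<bullet> b i)\<^sup>2) * (\<Sum>i\<in>UNIV. (norm (b' i))\<^sup>2)"
  by (rule lattice_basis.norm_sq_le_coordinates[OF dual_lattice_basis])

lemma cos_lattice_shift: "u \<in> D \<Longrightarrow> v \<in> L \<Longrightarrow> cos (2 * pi * (u \<bullet> (x - v))) = cos (2 * pi * (u \<bullet> x))"
proof -
  assume "u \<in> D" "v \<in> L"
  then obtain k where k: "u \<bullet> v = of_int k" by (auto simp: dual_lattice_def elim: Ints_cases)
  have "cos (2 * pi * (u \<bullet> (x - v))) = cos (2 * pi * (u \<bullet> x) - 2 * pi * of_int k)"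
    by (simp add: inner_diff_right k algebra_simps)
  also have "\<dots> = cos (2 * pi * (u \<bullet> x))" by (simp add: cos_diff)
  finally show ?thesis .
qed

definition cls :: "real^'n \<Rightarrow> (real^'n) set" where
  "cls x = lattice_rel L `` {x}"

lemma flat_torus_eq: "flat_torus L = range cls"
  by (auto simp: flat_torus_def cls_def quotient_def)

lemma cls_eq_iff: "cls x = cls y \<longleftrightarrow> x - y \<in> L"
proof
  assume "cls x = cls y"
  then have "y \<in> cls x" using full_lattice_group(1)[OF full] by (auto simp: cls_def lattice_rel_def)
  then show "x - y \<in> L" by (simp add: cls_def lattice_rel_def)
next
  assume xy: "x - y \<in> L"
  have "x - w \<in> L \<longleftrightarrow> y - w \<in> L" for w
    using full_lattice_group(2)[OF full, of "x - w" "x - y"]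
      full_lattice_group(4)[OF full, of "y - w" "x - y"] xy by auto
  then show "cls x = cls y" by (auto simp: cls_def lattice_rel_def)
qed

lemma torus_dist_cls: "torus_dist L (cls x) (cls y) = infdist (x - y) L"
  using torus_dist_class[OF full, of x y] full_lattice_group(1)[OF full]
  by (auto simp: cls_def infdist_def dist_norm)

text \<open>Every point is congruent modulo the lattice to a point of the Voronoi cell. This turns constraints
  on the cell into constraints on the torus.\<close>

lemma infdist_lattice_attained:
  obtains v where "v \<in> L" "infdist x L = norm (x - v)" "x - v \<in> voronoi_cell L"
proof -
  note grp = full_lattice_group[OF full]
  have eq: "infdist x L = (INF v\<in>L. norm (x - 0 - v))"
    using grp(1) by (auto simp: infdist_def dist_norm)
  obtain v where v: "v \<in> L" "infdist x L = norm (x - v)"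
    using torus_dist_attained[OF full, of x 0] unfolding eq[symmetric] by auto
  have "norm (x - v) \<le> norm (x - v - w)" if "w \<in> L" for w
    using infdist_le[of "v + w" L x] grp(4)[OF v(1) that] v(2) by (simp add: dist_norm diff_diff_eq)
  then show ?thesis using that[OF v] by (auto simp: voronoi_cell_def)
qed

lemma infdist_voronoi: "x \<in> voronoi_cell L \<Longrightarrow> infdist x L = norm x"
proof -
  assume x: "x \<in> voronoi_cell L"
  have "infdist x L \<le> norm x"
    using infdist_le[of 0 L x] full_lattice_group(1)[OF full] by simp
  moreover obtain v where "v \<in> L" "infdist x L = norm (x - v)" by (rule infdist_lattice_attained)
  ultimately show ?thesis using x by (auto simp: voronoi_cell_def)
qed

lemma infdist_eq_0_iff: "infdist x L = 0 \<longleftrightarrow> x \<in> L"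
proof
  assume "infdist x L = 0"
  moreover obtain v where "v \<in> L" "infdist x L = norm (x - v)" by (rule infdist_lattice_attained)
  ultimately show "x \<in> L" by simp
qed simp

end

section \<open>Weights with bounded second moment\<close>

text \<open>The origin is excluded because \<open>1 - cos 0 = 0\<close>: a weight there would change the total mass but
  nothing else. The moment condition is put on finite partial sums, so that each condition involves finitely
  many values of \<open>z\<close> and is closed under pointwise convergence.\<close>

definition weights :: "(real^'n) set \<Rightarrow> real \<Rightarrow> (real^'n \<Rightarrow> real) set" where
  "weights D K = {z. (\<forall>u. u \<notin> D \<or> u = 0 \<longrightarrow> z u = 0) \<and> (\<forall>u. 0 \<le> z u \<and> z (- u) = z u) \<and>
     (\<forall>F. finite F \<and> F \<subseteq> D \<longrightarrow> (\<Sum>u\<in>F. z u * (norm u)\<^sup>2) \<le> K)}"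

lemma weights_bound:
  assumes z: "z \<in> weights D K"
  shows "z u \<le> (if u \<in> D \<and> u \<noteq> 0 then K / (norm u)\<^sup>2 else 0)"
proof (cases "u \<in> D \<and> u \<noteq> 0")
  case True
  have "(\<Sum>u\<in>{u}. z u * (norm u)\<^sup>2) \<le> K" using z True unfolding weights_def by blast
  then show ?thesis using True by (simp add: field_simps)
qed (use z in \<open>auto simp: weights_def\<close>)

lemma closed_weights: "closed (weights D K)"
proof -
  have c: "continuous_on UNIV (\<lambda>z :: real^'n \<Rightarrow> real. z u)" for u by simp
  have "weights D K = (\<Inter>u\<in>{u. u \<notin> D \<or> u = 0}. {z. z u = 0}) \<inter>
      (\<Inter>u. {z. 0 \<le> z u} \<inter> {z. z (- u) = z u}) \<inter>
      (\<Inter>F\<in>{F. finite F \<and> F \<subseteq> D}. {z. (\<Sum>u\<in>F. z u * (norm u)\<^sup>2) \<le> K})"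
    unfolding weights_def by blast
  moreover have "closed \<dots>"
    by (intro closed_Int closed_INT ballI closed_Collect_eq closed_Collect_le continuous_intros c)
  ultimately show ?thesis by simp
qed

text \<open>Tychonoff: the moment bound confines \<open>z u\<close> to the interval from \<open>0\<close> to \<open>K / (norm u)\<^sup>2\<close>.\<close>

lemma compact_weights: "compact (weights (D :: (real^'n) set) K)"
proof -
  define M where "M u = (if u \<in> D \<and> u \<noteq> 0 then K / (norm u)\<^sup>2 else 0)" for u
  have "compactin (product_topology (\<lambda>_. euclidean) UNIV) (PiE UNIV (\<lambda>u. {0..M u}))"
    by (subst compactin_PiE) (simp add: compactin_euclidean_iff)
  then have "compact (PiE UNIV (\<lambda>u. {0..M u}))"
    by (simp add: euclidean_product_topology compactin_euclidean_iff)
  moreover have "weights D K \<subseteq> PiE UNIV (\<lambda>u. {0..M u})"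
  proof
    fix z assume z: "z \<in> weights D K"
    then have "0 \<le> z u" for u by (simp add: weights_def)
    then show "z \<in> PiE UNIV (\<lambda>u. {0..M u})" using weights_bound[OF z] by (auto simp: M_def)
  qed
  ultimately show ?thesis using closed_weights compact_Int_closed by (metis inf.absorb_iff2)
qed

lemma weights_summable:
  assumes fin: "\<And>r. finite {u\<in>D. norm u \<le> r}" and z: "z \<in> weights D K"
    and f: "\<And>u. \<bar>f u\<bar> \<le> M"
  shows "(\<lambda>u. z u * f u) summable_on D"
proof -
  have nn: "0 \<le> z u" for u using z by (simp add: weights_def)
  have "z summable_on D"
  proof (rule nonneg_bdd_above_summable_on)
    show "bdd_above (sum z ` {F. F \<subseteq> D \<and> finite F})"
    proof (rule bdd_aboveI2)
      fix F assume F: "F \<in> {F. F \<subseteq> D \<and> finite F}"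
      define A where "A = {u\<in>D. norm u \<le> 1}"
      have "sum z F \<le> (\<Sum>u\<in>F. z u * (norm u)\<^sup>2 + (if u \<in> A then z u else 0))"
      proof (rule sum_mono)
        fix u assume "u \<in> F"
        then show "z u \<le> z u * (norm u)\<^sup>2 + (if u \<in> A then z u else 0)"
          using F nn[of u] mult_left_mono[of 1 "(norm u)\<^sup>2" "z u"] one_le_power[of "norm u" 2]
          by (auto simp: A_def)
      qed
      also have "\<dots> = (\<Sum>u\<in>F. z u * (norm u)\<^sup>2) + sum z (F \<inter> A)"
        using F by (simp add: sum.distrib sum.inter_restrict)
      also have "\<dots> \<le> K + sum z A"
      proof (rule add_mono)
        show "(\<Sum>u\<in>F. z u * (norm u)\<^sup>2) \<le> K" using z F by (simp add: weights_def)
        show "sum z (F \<inter> A) \<le> sum z A"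
          using fin[of 1] nn by (intro sum_mono2) (auto simp: A_def)
      qed
      finally show "sum z F \<le> K + sum z A" .
    qed
  qed (use nn in auto)
  then have "(\<lambda>u. M * z u) summable_on D" by (intro summable_on_cmult_right) auto
  then have "(\<lambda>u. norm (z u * f u)) summable_on D"
  proof (rule Infinite_Sum.abs_summable_on_comparison_test')
    show "norm (z u * f u) \<le> M * z u" for u
      using mult_right_mono[OF f[of u] nn[of u]] nn[of u] by (simp add: abs_mult mult.commute)
  qed
  then show ?thesis by (rule abs_summable_summable)
qed

text \<open>Chebyshev's inequality: outside the ball of radius \<open>r\<close> the mass of \<open>z\<close> is at most \<open>K / r\<^sup>2\<close>, uniformly in \<open>z\<close>.
  Without this uniformity mass could escape to infinity in a pointwise limit.\<close>

lemma weights_tail: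
  assumes fin: "\<And>r. finite {u\<in>D. norm u \<le> r}" and z: "z \<in> weights D K"
    and f: "\<And>u. \<bar>f u\<bar> \<le> M" and r: "0 < r"
  shows "\<bar>(\<Sum>\<^sub>\<infinity>u\<in>D. z u * f u) - (\<Sum>u\<in>{u\<in>D. norm u \<le> r}. z u * f u)\<bar> \<le> M * K / r\<^sup>2"
proof -
  have nn: "0 \<le> z u" for u using z by (simp add: weights_def)
  have M: "0 \<le> M" using f[of 0] by linarith
  define A where "A = {u\<in>D. norm u \<le> r}"
  have A: "finite A" "A \<subseteq> D" using fin by (auto simp: A_def)
  have sm: "(\<lambda>u. z u * f u) summable_on D" using weights_summable[OF fin z f] .
  have "(\<lambda>u. z u * \<bar>f u\<bar>) summable_on D"
    by (rule weights_summable[OF fin z, of _ M]) (simp add: f)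
  then have sa: "(\<lambda>u. z u * \<bar>f u\<bar>) summable_on (D - A)"
    by (rule summable_on_subset_banach) auto
  have abs: "norm (z u * f u) = z u * \<bar>f u\<bar>" for u using nn by (simp add: abs_mult)
  have "(\<Sum>\<^sub>\<infinity>u\<in>D. z u * f u) - (\<Sum>u\<in>A. z u * f u) = (\<Sum>\<^sub>\<infinity>u\<in>D - A. z u * f u)"
    using infsum_Diff[OF sm _ A(2)] A(1) by simp
  also have "\<bar>\<dots>\<bar> \<le> (\<Sum>\<^sub>\<infinity>u\<in>D - A. z u * \<bar>f u\<bar>)"
    using norm_infsum_bound[of "\<lambda>u. z u * f u" "D - A", unfolded abs, OF sa] by simp
  also have "\<dots> \<le> M * K / r\<^sup>2"
  proof (rule infsum_le_finite_sums[OF sa])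
    fix F assume F: "finite F" "F \<subseteq> D - A"
    have "(\<Sum>u\<in>F. z u * \<bar>f u\<bar>) \<le> (\<Sum>u\<in>F. M / r\<^sup>2 * (z u * (norm u)\<^sup>2))"
    proof (rule sum_mono)
      fix u assume "u \<in> F"
      then have "r \<le> norm u" using F by (auto simp: A_def)
      then have "1 \<le> (norm u)\<^sup>2 / r\<^sup>2" using r by (simp add: power_mono)
      then have "z u * \<bar>f u\<bar> * 1 \<le> z u * M * ((norm u)\<^sup>2 / r\<^sup>2)"
        using nn M f by (intro mult_mono mult_left_mono) auto
      then show "z u * \<bar>f u\<bar> \<le> M / r\<^sup>2 * (z u * (norm u)\<^sup>2)" by (simp add: field_simps)
    qed
    also have "\<dots> = M / r\<^sup>2 * (\<Sum>u\<in>F. z u * (norm u)\<^sup>2)" by (simp add: sum_distrib_left)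
    also have "\<dots> \<le> M / r\<^sup>2 * K"
      using z F M by (intro mult_left_mono) (auto simp: weights_def)
    finally show "(\<Sum>u\<in>F. z u * \<bar>f u\<bar>) \<le> M * K / r\<^sup>2" by simp
  qed
  finally show ?thesis unfolding A_def .
qed

text \<open>By the tail bound the series is a uniform limit of its partial sums over balls, which
  depend continuously on finitely many values of \<open>z\<close>. Joint continuity is stated because both the
  dependence on \<open>z\<close> (for compactness) and on \<open>x\<close> (for density arguments) are used.\<close>

lemma continuous_on_weights_infsum:
  fixes f :: "real^'n \<Rightarrow> 'b::topological_space \<Rightarrow> real"
  assumes fin: "\<And>r. finite {u\<in>D. norm u \<le> r}"
    and cont: "\<And>u. continuous_on UNIV (f u)" and f: "\<And>u x. \<bar>f u x\<bar> \<le> M"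
  shows "continuous_on (weights D K \<times> UNIV) (\<lambda>(z, x). \<Sum>\<^sub>\<infinity>u\<in>D. z u * f u x)"
proof (rule uniform_limit_theorem)
  define part where "part k = (\<lambda>(z, x). \<Sum>u\<in>{u\<in>D. norm u \<le> real (Suc k)}. z u * f u x)" for k
  have c: "continuous_on UNIV (\<lambda>p :: (real^'n \<Rightarrow> real) \<times> 'b. f u (snd p))" for u
    by (rule continuous_on_compose2[OF cont continuous_on_snd]) (auto intro: continuous_on_id)
  have d: "continuous_on UNIV (\<lambda>p :: (real^'n \<Rightarrow> real) \<times> 'b. fst p u)" for u
    by (rule continuous_on_compose2[OF continuous_on_product_coordinates continuous_on_fst])
       (auto intro: continuous_on_id)
  show "\<forall>\<^sub>F k in sequentially. continuous_on (weights D K \<times> UNIV) (part k)"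
    unfolding part_def case_prod_beta
    by (intro always_eventually allI continuous_on_sum continuous_on_mult)
       (auto intro: continuous_on_subset[OF c] continuous_on_subset[OF d])
  show "uniform_limit (weights D K \<times> UNIV) part (\<lambda>(z, x). \<Sum>\<^sub>\<infinity>u\<in>D. z u * f u x) sequentially"
  proof (rule uniform_limitI)
    fix e :: real assume "0 < e"
    have "(\<lambda>k. M * K / (real (Suc k))\<^sup>2) \<longlonglongrightarrow> 0"
      by (intro tendsto_divide_0[OF tendsto_const] filterlim_at_top_imp_at_infinity
          filterlim_pow_at_top filterlim_compose[OF filterlim_real_sequentially] filterlim_Suc) auto
    then have "\<forall>\<^sub>F k in sequentially. M * K / (real (Suc k))\<^sup>2 < e"
      using \<open>0 < e\<close> by (rule order_tendstoD)
    then show "\<forall>\<^sub>F k in sequentially. \<forall>p\<in>weights D K \<times> UNIV.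
        dist (part k p) (case p of (z, x) \<Rightarrow> \<Sum>\<^sub>\<infinity>u\<in>D. z u * f u x) < e"
    proof (rule eventually_mono)
      fix k assume k: "M * K / (real (Suc k))\<^sup>2 < e"
      show "\<forall>p\<in>weights D K \<times> UNIV.
          dist (part k p) (case p of (z, x) \<Rightarrow> \<Sum>\<^sub>\<infinity>u\<in>D. z u * f u x) < e"
      proof clarify
        fix z x assume z: "z \<in> weights D K"
        show "dist (part k (z, x)) (\<Sum>\<^sub>\<infinity>u\<in>D. z u * f u x) < e"
          using weights_tail[OF fin z, of "\<lambda>u. f u x" M "real (Suc k)"] f k
          by (simp add: part_def dist_real_def abs_minus_commute)
      qed
    qed
  qed
qed auto

section \<open>The program\<close>

text \<open>Jordan's inequality, that is, concavity of the sine on \<open>[0, pi]\<close>, in the form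
  \<open>2 * s \<le> sin (pi * s)\<close>.\<close>

lemma one_minus_cos_ge:
  assumes "\<bar>s\<bar> \<le> 1 / 2"
  shows "8 * s\<^sup>2 \<le> 1 - cos (2 * pi * s)"
proof -
  have conc: "concave_on {0..pi} sin"
  proof (rule f''_le0_imp_concave)
    show "(sin has_real_derivative cos x) (at x)" "(cos has_real_derivative - sin x) (at x)" for x
      by (auto intro!: derivative_eq_intros)
    show "- sin x \<le> 0" if "x \<in> {0..pi}" for x using that by (simp add: sin_ge_zero)
  qed simp
  have "(1 - 2 * \<bar>s\<bar>) * sin 0 + (2 * \<bar>s\<bar>) * sin (pi / 2) \<le> sin ((1 - 2 * \<bar>s\<bar>) *\<^sub>R 0 + (2 * \<bar>s\<bar>) *\<^sub>R (pi / 2))"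
    using assms by (intro concave_onD[OF conc]) auto
  then have "2 * \<bar>s\<bar> \<le> sin (pi * \<bar>s\<bar>)" by (simp add: mult.commute)
  then have "(2 * \<bar>s\<bar>)\<^sup>2 \<le> (sin (pi * \<bar>s\<bar>))\<^sup>2" by (intro power_mono) auto
  moreover have "(sin (pi * \<bar>s\<bar>))\<^sup>2 = (sin (pi * s))\<^sup>2" by (cases "0 \<le> s") auto
  moreover have "cos (2 * pi * s) = 1 - 2 * (sin (pi * s))\<^sup>2"
    using cos_double_sin[of "pi * s"] by (simp add: mult.assoc)
  ultimately show ?thesis by simp
qed

lemma norm_outer_square: "norm (outer_square u) = (norm u)\<^sup>2"
proof -
  have "outer_square u $ i = (u $ i) *\<^sub>R u" for i by (simp add: outer_square_def vec_eq_iff)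
  then have "norm (outer_square u) = L2_set (\<lambda>i. norm u * \<bar>u $ i\<bar>) UNIV"
    by (simp add: norm_vec_def[of "outer_square u"] mult.commute)
  also have "\<dots> = norm u * L2_set (\<lambda>i. \<bar>u $ i\<bar>) UNIV" by (simp add: L2_set_right_distrib)
  also have "\<dots> = norm u * norm u" by (simp add: norm_vec_def)
  finally show ?thesis by (simp add: power2_eq_square)
qed

lemma outer_square_quadratic: "x \<bullet> (outer_square u *v x) = (u \<bullet> x)\<^sup>2"
proof -
  have "outer_square u *v x = (u \<bullet> x) *\<^sub>R u"
    by (simp add: vec_eq_iff matrix_vector_mult_def outer_square_def inner_vec_def
        sum_distrib_left mult_ac)
  then show ?thesis by (simp add: power2_eq_square inner_commute)
qed

lemma bounded_linear_quadratic: "bounded_linear (\<lambda>A :: real^'n^'n. x \<bullet> (A *v x))"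
  by (intro linear_conv_bounded_linear[THEN iffD1] linearI)
     (simp_all add: matrix_vector_mult_add_rdistrib inner_add_right scaleR_matrix_vector_assoc[symmetric])

lemma bounded_linear_transpose: "bounded_linear (transpose :: real^'n^'n \<Rightarrow> real^'n^'n)"
  by (intro linear_conv_bounded_linear[THEN iffD1] linearI) (simp_all add: transpose_def vec_eq_iff)

lemma sum_norm_sq_eq: "(norm u)\<^sup>2 = (\<Sum>e\<in>Basis. (u \<bullet> e)\<^sup>2)"
  by (subst power2_norm_eq_inner, subst euclidean_inner) (simp add: power2_eq_square)

context lattice_basis
begin

definition energy :: "(real^'n \<Rightarrow> real) \<Rightarrow> real^'n \<Rightarrow> real" where
  "energy z x = 2 * (\<Sum>\<^sub>\<infinity>u\<in>D. z u * (1 - cos (2 * pi * (u \<bullet> x))))"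

text \<open>Feasibility in a form which is stable under pointwise limits: the matrix inequality is replaced by its
  quadratic forms for all finite partial sums, and the weight at the origin is normalised to \<open>0\<close>. The equivalence with
  \<open>program_feasible\<close> is given by \<open>certificate_imp_feasible\<close> and \<open>feasible_imp_certificate\<close>.\<close>

definition certificate :: "real \<Rightarrow> (real^'n \<Rightarrow> real) \<Rightarrow> bool" where
  "certificate C z \<longleftrightarrow>
     (\<forall>u. u \<notin> D \<or> u = 0 \<longrightarrow> z u = 0) \<and> (\<forall>u. 0 \<le> z u \<and> z (- u) = z u) \<and>
     (\<forall>x\<in>voronoi_cell L. (norm x)\<^sup>2 \<le> energy z x) \<and>
     (\<forall>F x. finite F \<and> F \<subseteq> D \<longrightarrow> 4 * pi\<^sup>2 * (\<Sum>u\<in>F. z u * (u \<bullet> x)\<^sup>2) \<le> C * (norm x)\<^sup>2)"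

lemma certificate_nonneg:
  assumes "certificate C z" shows "0 \<le> C"
proof -
  have "4 * pi\<^sup>2 * (\<Sum>u\<in>{}. z u * (u \<bullet> axis undefined 1)\<^sup>2) \<le> C * (norm (axis undefined 1 :: real^'n))\<^sup>2"
    using assms unfolding certificate_def by blast
  then show ?thesis by simp
qed

definition moment_bound :: "real \<Rightarrow> real" where
  "moment_bound C = real CARD('n) * C / (4 * pi\<^sup>2)"

text \<open>The trace of the matrix inequality, evaluated on an orthonormal basis, bounds the second moment.\<close>

lemma certificate_imp_weights:
  assumes z: "certificate C z" and C: "C \<le> C0"
  shows "z \<in> weights D (moment_bound C0)"
proof -
  have "(\<Sum>u\<in>F. z u * (norm u)\<^sup>2) \<le> moment_bound C0" if F: "finite F" "F \<subseteq> D" for F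
  proof -
    have "4 * pi\<^sup>2 * (\<Sum>u\<in>F. z u * (norm u)\<^sup>2) = 4 * pi\<^sup>2 * (\<Sum>u\<in>F. \<Sum>e\<in>Basis. z u * (u \<bullet> e)\<^sup>2)"
      by (simp add: sum_norm_sq_eq sum_distrib_left)
    also have "\<dots> = (\<Sum>e\<in>Basis. 4 * pi\<^sup>2 * (\<Sum>u\<in>F. z u * (u \<bullet> e)\<^sup>2))"
      by (subst sum.swap) (simp add: sum_distrib_left)
    also have "\<dots> \<le> (\<Sum>e\<in>(Basis :: (real^'n) set). C0)"
    proof (rule sum_mono)
      fix e :: "real^'n" assume "e \<in> Basis"
      moreover have "4 * pi\<^sup>2 * (\<Sum>u\<in>F. z u * (u \<bullet> e)\<^sup>2) \<le> C * (norm e)\<^sup>2"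
        using z F unfolding certificate_def by blast
      ultimately show "4 * pi\<^sup>2 * (\<Sum>u\<in>F. z u * (u \<bullet> e)\<^sup>2) \<le> C0" using C by simp
    qed
    finally show ?thesis by (simp add: moment_bound_def field_simps)
  qed
  then show ?thesis using z by (auto simp: weights_def certificate_def)
qed

lemma abs_one_minus_cos_le: "\<bar>1 - cos t\<bar> \<le> (2 :: real)"
  using cos_ge_minus_one[of t] cos_le_one[of t] by linarith

lemma energy_summable:
  assumes "z \<in> weights D K"
  shows "(\<lambda>u. z u * (1 - cos (2 * pi * (u \<bullet> x)))) summable_on D"
  by (rule weights_summable[OF finite_dual_ball assms abs_one_minus_cos_le])

lemma weights_summable_one:
  assumes "z \<in> weights D K" shows "z summable_on D"
  using weights_summable[OF finite_dual_ball assms, of "\<lambda>_. 1" 1] by simp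

lemma energy_continuous: "continuous_on (weights D K \<times> UNIV) (\<lambda>(z, x). energy z x)"
proof -
  have "continuous_on (weights D K \<times> UNIV)
      (\<lambda>(z, x). \<Sum>\<^sub>\<infinity>u\<in>D. z u * (1 - cos (2 * pi * (u \<bullet> (x :: real^'n)))))"
    by (rule continuous_on_weights_infsum[OF finite_dual_ball _ abs_one_minus_cos_le])
       (intro continuous_intros)
  then show ?thesis unfolding energy_def case_prod_beta by (intro continuous_intros)
qed

lemma energy_continuous_left: "continuous_on (weights D K) (\<lambda>z. energy z x)"
proof -
  have "continuous_on (weights D K) (\<lambda>z. (z, x))"
    by (intro continuous_on_Pair continuous_on_id continuous_on_const)
  from continuous_on_compose2[OF energy_continuous this] show ?thesis by auto
qed

lemma energy_continuous_right: "continuous_on UNIV (energy z)" if "z \<in> weights D K"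
proof -
  have "continuous_on UNIV (\<lambda>x :: real^'n. (z, x))"
    by (intro continuous_on_Pair continuous_on_id continuous_on_const)
  from continuous_on_compose2[OF energy_continuous this] show ?thesis using that by auto
qed

lemma mass_continuous: "continuous_on (weights D K) (\<lambda>z. infsum z D)"
proof -
  have c: "continuous_on (weights D K \<times> UNIV) (\<lambda>(z, x :: real). \<Sum>\<^sub>\<infinity>u\<in>D. z u * 1)"
    by (rule continuous_on_weights_infsum[OF finite_dual_ball, of _ 1]) auto
  have "continuous_on (weights D K) (\<lambda>z. (z, 0 :: real))"
    by (intro continuous_on_Pair continuous_on_id continuous_on_const)
  from continuous_on_compose2[OF c this] show ?thesis by auto
qed

lemma energy_eq_sum:
  assumes "finite S" "S \<subseteq> D" "\<And>u. u \<notin> S \<Longrightarrow> z u = 0"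
  shows "energy z x = 2 * (\<Sum>u\<in>S. z u * (1 - cos (2 * pi * (u \<bullet> x))))"
proof -
  have "(\<Sum>\<^sub>\<infinity>u\<in>D. z u * (1 - cos (2 * pi * (u \<bullet> x)))) = (\<Sum>\<^sub>\<infinity>u\<in>S. z u * (1 - cos (2 * pi * (u \<bullet> x))))"
    by (rule infsum_cong_neutral) (use assms(2,3) in auto)
  then show ?thesis using assms(1) by (simp add: energy_def)
qed

lemma energy_shift: "v \<in> L \<Longrightarrow> energy z (x - v) = energy z x"
  unfolding energy_def by (simp add: cos_lattice_shift cong: infsum_cong)

lemma certificate_lower:
  assumes "certificate C z" shows "(infdist x L)\<^sup>2 \<le> energy z x"
proof -
  obtain v where "v \<in> L" "infdist x L = norm (x - v)" "x - v \<in> voronoi_cell L"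
    by (rule infdist_lattice_attained)
  then show ?thesis using assms energy_shift[of v z x] by (auto simp: certificate_def)
qed

text \<open>The matrix series converges absolutely since \<open>outer_square u\<close> has norm \<open>(norm u)\<^sup>2\<close>.\<close>

lemma weights_matrix:
  assumes z: "z \<in> weights D K"
  shows "(\<lambda>u. z u *\<^sub>R outer_square u) summable_on D"
    and "transpose (\<Sum>\<^sub>\<infinity>u\<in>D. z u *\<^sub>R outer_square u) = (\<Sum>\<^sub>\<infinity>u\<in>D. z u *\<^sub>R outer_square u)"
proof -
  have "(\<lambda>u. z u * (norm u)\<^sup>2) summable_on D"
    by (rule nonneg_bdd_above_summable_on) (use z in \<open>auto simp: weights_def intro!: bdd_aboveI2\<close>)
  moreover have "norm (z u *\<^sub>R outer_square u) = z u * (norm u)\<^sup>2" for u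
    using z by (simp add: norm_outer_square weights_def)
  ultimately show sm: "(\<lambda>u. z u *\<^sub>R outer_square u) summable_on D"
    using abs_summable_summable[of "\<lambda>u. z u *\<^sub>R outer_square u" D] by simp
  have "transpose (z u *\<^sub>R outer_square u) = z u *\<^sub>R outer_square u" for u
    by (simp add: transpose_def outer_square_def vec_eq_iff mult_ac)
  then show "transpose (\<Sum>\<^sub>\<infinity>u\<in>D. z u *\<^sub>R outer_square u) = (\<Sum>\<^sub>\<infinity>u\<in>D. z u *\<^sub>R outer_square u)"
    using infsumI[OF has_sum_bounded_linear[OF bounded_linear_transpose has_sum_infsum[OF sm]]]
    by simp
qed

lemma quadratic_has_sum:
  assumes "(\<lambda>u. z u *\<^sub>R outer_square u) summable_on D"
  shows "((\<lambda>u. z u * (u \<bullet> x)\<^sup>2) has_sum (x \<bullet> ((\<Sum>\<^sub>\<infinity>u\<in>D. z u *\<^sub>R outer_square u) *v x))) D"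
  using has_sum_bounded_linear[OF bounded_linear_quadratic has_sum_infsum[OF assms], of x]
  by (simp add: scaleR_matrix_vector_assoc[symmetric] outer_square_quadratic)

lemma quadratic_of_slack:
  fixes A :: "real^'n^'n"
  shows "x \<bullet> ((C *\<^sub>R mat 1 - (4 * pi\<^sup>2) *\<^sub>R A) *v x) = C * (norm x)\<^sup>2 - 4 * pi\<^sup>2 * (x \<bullet> (A *v x))"
  unfolding matrix_vector_mult_diff_rdistrib scaleR_matrix_vector_assoc[symmetric] inner_diff_right
  by (simp add: power2_norm_eq_inner)

lemma certificate_imp_feasible:
  assumes z: "certificate C z" shows "program_feasible L C z"
proof -
  have w: "z \<in> weights D (moment_bound C)" by (rule certificate_imp_weights[OF z order_refl])
  have nn: "0 \<le> z u" "z (- u) = z u" for u using w by (auto simp: weights_def)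
  have "x \<bullet> ((\<Sum>\<^sub>\<infinity>u\<in>D. z u *\<^sub>R outer_square u) *v x) \<le> C * (norm x)\<^sup>2 / (4 * pi\<^sup>2)" for x
  proof (rule has_sum_le_finite_sums[OF quadratic_has_sum[OF weights_matrix(1)[OF w]]])
    fix F assume F: "finite F" "F \<subseteq> D"
    then have "4 * pi\<^sup>2 * (\<Sum>u\<in>F. z u * (u \<bullet> x)\<^sup>2) \<le> C * (norm x)\<^sup>2"
      using z unfolding certificate_def by blast
    then show "(\<Sum>u\<in>F. z u * (u \<bullet> x)\<^sup>2) \<le> C * (norm x)\<^sup>2 / (4 * pi\<^sup>2)" by (simp add: field_simps)
  qed
  then have "4 * pi\<^sup>2 * (x \<bullet> ((\<Sum>\<^sub>\<infinity>u\<in>D. z u *\<^sub>R outer_square u) *v x)) \<le> C * (norm x)\<^sup>2" for x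
    by (simp add: field_simps)
  moreover have "transpose (C *\<^sub>R mat 1 - (4 * pi\<^sup>2) *\<^sub>R A) = C *\<^sub>R mat 1 - (4 * pi\<^sup>2) *\<^sub>R transpose A"
    for A :: "real^'n^'n" by (auto simp: transpose_def vec_eq_iff mat_def)
  ultimately have "psd (C *\<^sub>R mat 1 - (4 * pi\<^sup>2) *\<^sub>R (\<Sum>\<^sub>\<infinity>u\<in>D. z u *\<^sub>R outer_square u))"
    unfolding psd_def quadratic_of_slack by (simp add: weights_matrix(2)[OF w])
  then show ?thesis
    using z certificate_nonneg[OF z] weights_matrix(1)[OF w] weights_summable_one[OF w] nn
    by (simp add: program_feasible_def certificate_def energy_def)
qed

lemma feasible_imp_certificate:
  assumes z: "program_feasible L C z"
  shows "certificate C (\<lambda>u. if u \<in> D \<and> u \<noteq> 0 then z u else 0)"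
proof -
  let ?z = "\<lambda>u. if u \<in> D \<and> u \<noteq> 0 then z u else 0"
  have nn: "0 \<le> z u" "z (- u) = z u" if "u \<in> D" for u
    using z that by (auto simp: program_feasible_def)
  have minus: "- u \<in> D \<longleftrightarrow> u \<in> D" for u using dual_group(2)[of u] dual_group(2)[of "- u"] by auto
  have energy: "energy ?z x = energy z x" for x
    unfolding energy_def by (auto intro!: arg_cong[of _ _ "(*) 2"] infsum_cong)
  have "4 * pi\<^sup>2 * (\<Sum>u\<in>F. ?z u * (u \<bullet> x)\<^sup>2) \<le> C * (norm x)\<^sup>2" if F: "finite F" "F \<subseteq> D" for F x
  proof -
    have sm: "(\<lambda>u. z u *\<^sub>R outer_square u) summable_on D" using z by (simp add: program_feasible_def)
    have "(\<Sum>u\<in>F. ?z u * (u \<bullet> x)\<^sup>2) \<le> (\<Sum>u\<in>F. z u * (u \<bullet> x)\<^sup>2)"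
      by (rule sum_mono) (use F nn in auto)
    also have "\<dots> \<le> x \<bullet> ((\<Sum>\<^sub>\<infinity>u\<in>D. z u *\<^sub>R outer_square u) *v x)"
      by (rule finite_sum_le_has_sum[OF quadratic_has_sum[OF sm] F]) (use nn in auto)
    finally have "4 * pi\<^sup>2 * (\<Sum>u\<in>F. ?z u * (u \<bullet> x)\<^sup>2)
        \<le> 4 * pi\<^sup>2 * (x \<bullet> ((\<Sum>\<^sub>\<infinity>u\<in>D. z u *\<^sub>R outer_square u) *v x))"
      by (intro mult_left_mono) auto
    moreover have "0 \<le> x \<bullet> ((C *\<^sub>R mat 1 - (4 * pi\<^sup>2) *\<^sub>R (\<Sum>\<^sub>\<infinity>u\<in>D. z u *\<^sub>R outer_square u)) *v x)"
      using z unfolding program_feasible_def psd_def by blast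
    ultimately show ?thesis unfolding quadratic_of_slack by linarith
  qed
  moreover have "(norm x)\<^sup>2 \<le> energy ?z x" if "x \<in> voronoi_cell L" for x
    unfolding energy using z that by (simp add: program_feasible_def energy_def)
  ultimately show ?thesis using nn minus by (simp add: certificate_def)
qed

text \<open>Equal weights \<open>t\<close> on the vectors of the dual basis and their negatives are feasible for suitable \<open>t\<close>: shift \<open>x\<close> by a
  lattice vector until all its coordinates lie in \<open>[-1/2, 1/2]\<close>, which can only lengthen a point of the Voronoi
  cell, and apply Jordan's inequality in each coordinate.\<close>

lemma ex_certificate: "\<exists>C z. certificate C z"
proof -
  \<comment> \<open>The factor 16 is the factor 2 in the energy times the constant 8 of Jordan's inequality.\<close>
  define t where "t = (\<Sum>i\<in>UNIV. (norm (b i))\<^sup>2) / 16"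
  define S where "S = range b' \<union> uminus ` range b'"
  define z where "z u = (if u \<in> S then t else 0)" for u
  define C where "C = 4 * pi\<^sup>2 * (\<Sum>u\<in>S. t * (norm u)\<^sup>2)"
  have t: "0 \<le> t" by (simp add: t_def sum_nonneg)
  have b'D: "b' i \<in> D" for i by (simp add: mem_dual_iff inner_commute[of "b' i"] biorthogonal)
  have b'0: "b' i \<noteq> 0" for i using biorthogonal[of i i] by auto
  have S: "finite S" "S \<subseteq> D" "0 \<notin> S" "- u \<in> S \<longleftrightarrow> u \<in> S" for u
    using b'D dual_group(2) b'0 by (auto simp: S_def image_iff) (metis minus_minus)+
  have upper: "4 * pi\<^sup>2 * (\<Sum>u\<in>F. z u * (u \<bullet> x)\<^sup>2) \<le> C * (norm x)\<^sup>2" if F: "finite F" "F \<subseteq> D" for F x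
  proof -
    have "(\<Sum>u\<in>F. z u * (u \<bullet> x)\<^sup>2) = (\<Sum>u\<in>F \<inter> S. t * (u \<bullet> x)\<^sup>2)"
      using F by (intro sum.mono_neutral_cong_right) (auto simp: z_def)
    also have "\<dots> \<le> (\<Sum>u\<in>S. t * (u \<bullet> x)\<^sup>2)" using S t by (intro sum_mono2) auto
    also have "\<dots> \<le> (\<Sum>u\<in>S. t * (norm u)\<^sup>2 * (norm x)\<^sup>2)"
    proof (rule sum_mono)
      fix u
      have "(u \<bullet> x)\<^sup>2 \<le> (norm u)\<^sup>2 * (norm x)\<^sup>2"
        using power_mono[OF Cauchy_Schwarz_ineq2[of u x], of 2] by (simp add: power_mult_distrib)
      from mult_left_mono[OF this t] show "t * (u \<bullet> x)\<^sup>2 \<le> t * (norm u)\<^sup>2 * (norm x)\<^sup>2"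
        by (simp add: mult.assoc)
    qed
    finally show ?thesis by (simp add: C_def sum_distrib_right[symmetric])
  qed
  have "(norm x)\<^sup>2 \<le> energy z x" if x: "x \<in> voronoi_cell L" for x
  proof -
    define v where "v = (\<Sum>i\<in>UNIV. of_int (round (x \<bullet> b' i)) *\<^sub>R b i)"
    have v: "v \<in> L" unfolding v_def lattice_eq by (rule range_eqI) (rule refl)
    define s where "s i = (x - v) \<bullet> b' i" for i
    have s: "\<bar>s i\<bar> \<le> 1 / 2" for i
      using of_int_round_abs_le[of "x \<bullet> b' i"]
      by (simp add: s_def v_def inner_diff_left inner_combination_dual abs_minus_commute)
    have inj: "inj b'" by (metis biorthogonal injI zero_neq_one)
    have "(norm x)\<^sup>2 \<le> (norm (x - v))\<^sup>2"
      using x v by (intro power_mono) (auto simp: voronoi_cell_def)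
    also have "\<dots> \<le> (\<Sum>i\<in>UNIV. (s i)\<^sup>2) * (16 * t)"
      using norm_sq_le_coordinates[of "x - v"] by (simp add: s_def t_def)
    also have "\<dots> = 2 * (\<Sum>i\<in>UNIV. t * (8 * (s i)\<^sup>2))"
      by (simp add: sum_distrib_left sum_distrib_right mult_ac)
    also have "\<dots> \<le> 2 * (\<Sum>i\<in>UNIV. t * (1 - cos (2 * pi * (b' i \<bullet> (x - v)))))"
      using t one_minus_cos_ge[OF s]
      by (intro mult_left_mono sum_mono) (auto simp: s_def inner_commute)
    also have "\<dots> = 2 * (\<Sum>u\<in>range b'. t * (1 - cos (2 * pi * (u \<bullet> (x - v)))))"
      by (simp add: sum.reindex[OF inj])
    also have "\<dots> \<le> 2 * (\<Sum>u\<in>S. t * (1 - cos (2 * pi * (u \<bullet> (x - v)))))"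
      using S t by (intro mult_left_mono sum_mono2) (auto simp: S_def)
    also have "\<dots> = energy z (x - v)"
      using S by (subst energy_eq_sum[of S]) (auto simp: z_def)
    also have "\<dots> = energy z x" by (rule energy_shift[OF v])
    finally show ?thesis .
  qed
  then have "certificate C z"
    using S t upper by (auto simp: certificate_def z_def)
  then show ?thesis by blast
qed

text \<open>Certificates with \<open>C \<le> C0\<close> form a compact set of pairs. Minimising \<open>C\<close> on it, and then maximising
  the total mass on the compact set of minimisers, gives the solution to which the exchange
  arguments apply.\<close>

lemma ex_optimal_certificate:
  obtains C z where "certificate C z"
    and "\<And>C' z'. certificate C' z' \<Longrightarrow> C \<le> C'"
    and "\<And>z'. certificate C z' \<Longrightarrow> infsum z' D \<le> infsum z D"
proof -
  obtain C0 z0 where 0: "certificate C0 z0" using ex_certificate by blast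
  define K where "K = moment_bound C0"
  define W where "W = {0..C0} \<times> weights D K"
  have W: "compact W" unfolding W_def by (intro compact_Times compact_weights) simp
  have cl: "closed W" unfolding W_def by (intro closed_Times closed_weights) simp
  define X where "X = {p\<in>W. certificate (fst p) (snd p)}"
  have memX: "(C, z) \<in> X \<longleftrightarrow> certificate C z \<and> C \<le> C0" for C z
    using certificate_imp_weights[of C z C0] certificate_nonneg[of C z]
    by (auto simp: X_def W_def K_def)
  have coord: "continuous_on A (\<lambda>p :: real \<times> (real^'n \<Rightarrow> real). snd p u)" for u A
    by (rule continuous_on_compose2[OF continuous_on_product_coordinates continuous_on_snd])
       (auto intro: continuous_on_id)
  have en: "continuous_on W (\<lambda>p. energy (snd p) x)" for x
    by (rule continuous_on_compose2[OF energy_continuous_left[of K x] continuous_on_snd])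
       (auto simp: W_def intro: continuous_on_id)
  have "X = W \<inter> (\<Inter>x\<in>voronoi_cell L. {p\<in>W. (norm x)\<^sup>2 \<le> energy (snd p) x}) \<inter>
      (\<Inter>F\<in>{F. finite F \<and> F \<subseteq> D}. \<Inter>x. {p\<in>W. 4 * pi\<^sup>2 * (\<Sum>u\<in>F. snd p u * (u \<bullet> x)\<^sup>2) \<le> fst p * (norm x)\<^sup>2})"
    unfolding X_def certificate_def W_def by (auto simp: weights_def)
  moreover have "closed \<dots>"
    by (intro closed_Int closed_INT ballI cl continuous_on_closed_Collect_le en continuous_intros coord)
  ultimately have "closed X" by simp
  moreover have "W \<inter> X = X" by (auto simp: X_def)
  ultimately have X: "compact X" using compact_Int_closed[OF W] by metis
  obtain p where p: "p \<in> X" "\<And>q. q \<in> X \<Longrightarrow> fst p \<le> fst q"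
    using continuous_attains_inf[OF X _ continuous_on_fst[OF continuous_on_id]] 0 memX by blast
  define C where "C = fst p"
  define Y where "Y = X \<inter> {q. fst q = C}"
  have Y: "compact Y" unfolding Y_def
    by (intro compact_Int_closed X closed_Collect_eq continuous_intros)
  have "continuous_on Y (\<lambda>q. infsum (snd q) D)"
    by (rule continuous_on_compose2[OF mass_continuous[of K] continuous_on_snd])
       (auto simp: Y_def X_def W_def intro: continuous_on_id)
  moreover have "Y \<noteq> {}" using p(1) by (auto simp: Y_def C_def)
  ultimately obtain q where q: "q \<in> Y" "\<And>r. r \<in> Y \<Longrightarrow> infsum (snd r) D \<le> infsum (snd q) D"
    using continuous_attains_sup[OF Y] by blast
  show ?thesis
  proof (rule that[of C "snd q"])
    show "certificate C (snd q)" using q(1) by (auto simp: Y_def X_def)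
    have C0: "C \<le> C0" using p(2)[of "(C0, z0)"] 0 memX by (simp add: C_def)
    show "C \<le> C'" if "certificate C' z'" for C' z'
      using p(2)[of "(C', z')"] that memX C0 by (cases "C' \<le> C0") (auto simp: C_def)
    show "infsum z' D \<le> infsum (snd q) D" if "certificate C z'" for z'
      using q(2)[of "(C, z')"] that memX C0 by (simp add: Y_def)
  qed
qed

end

section \<open>Certificates of maximal mass\<close>

lemma abs_sin_of_nat_mult_le: "\<bar>sin (of_nat n * x)\<bar> \<le> of_nat n * \<bar>sin x\<bar>" for x :: real
proof (induction n)
  case (Suc n)
  have "\<bar>sin (of_nat (Suc n) * x)\<bar> = \<bar>sin (of_nat n * x) * cos x + cos (of_nat n * x) * sin x\<bar>"
    by (simp add: distrib_right sin_add algebra_simps)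
  also have "\<dots> \<le> \<bar>sin (of_nat n * x)\<bar> * \<bar>cos x\<bar> + \<bar>cos (of_nat n * x)\<bar> * \<bar>sin x\<bar>"
    by (metis abs_mult abs_triangle_ineq)
  also have "\<dots> \<le> \<bar>sin (of_nat n * x)\<bar> * 1 + 1 * \<bar>sin x\<bar>"
    by (intro add_mono mult_left_mono mult_right_mono) auto
  finally show ?case using Suc by (simp add: distrib_right)
qed simp

text \<open>Half-angle form of \<open>\<bar>sin (k * x)\<bar> \<le> \<bar>k\<bar> * \<bar>sin x\<bar>\<close>.\<close>

lemma one_minus_cos_of_int_mult_le:
  "1 - cos (of_int k * x) \<le> (of_int k)\<^sup>2 * (1 - cos x)" for x :: real
proof -
  have half: "1 - cos y = 2 * (sin (y / 2))\<^sup>2" for y :: real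
    using cos_double_sin[of "y / 2"] by simp
  have "\<bar>sin (of_int k * (x / 2))\<bar> = \<bar>sin (of_nat (nat \<bar>k\<bar>) * (x / 2))\<bar>"
    by (cases "0 \<le> k") auto
  also have "\<dots> \<le> \<bar>of_int k\<bar> * \<bar>sin (x / 2)\<bar>" using abs_sin_of_nat_mult_le[of "nat \<bar>k\<bar>" "x / 2"] by simp
  finally have "\<bar>sin (of_int k * (x / 2))\<bar>\<^sup>2 \<le> (\<bar>of_int k\<bar> * \<bar>sin (x / 2)\<bar>)\<^sup>2"
    by (intro power_mono) auto
  then show ?thesis by (simp add: half power_mult_distrib)
qed

definition pair_indicator :: "'a::ab_group_add \<Rightarrow> 'a \<Rightarrow> real" where
  "pair_indicator u w = (if w = u \<or> w = - u then 1 else 0)"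

lemma pair_indicator_minus [simp]: "pair_indicator u (- w) = pair_indicator u w"
  by (auto simp: pair_indicator_def)

lemma sum_pair_indicator:
  fixes u :: "real^'n"
  assumes "finite S" "u \<in> S" "- u \<in> S" "u \<noteq> 0" "g (- u) = (g u :: real)"
  shows "(\<Sum>w\<in>S. pair_indicator u w * g w) = 2 * g u"
proof -
  have ne: "u \<noteq> - u" using assms(4) by (simp add: eq_neg_iff_add_eq_0 flip: scaleR_2)
  have "(\<Sum>w\<in>S. pair_indicator u w * g w) = (\<Sum>w\<in>{u, - u}. g w)"
    using assms by (intro sum.mono_neutral_cong_right) (auto simp: pair_indicator_def)
  then show ?thesis using ne assms(5) by simp
qed

context lattice_basis
begin

text \<open>The common part of the two exchanges: a finitely supported symmetric change that keeps the weights
  nonnegative is admissible as soon as it lowers no energy and raises no second moment.\<close>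

lemma certificate_perturb:
  assumes z: "certificate C z" and S: "finite S" "S \<subseteq> D - {0}"
    and \<Delta>: "\<And>w. w \<notin> S \<Longrightarrow> \<Delta> w = 0" "\<And>w. \<Delta> (- w) = \<Delta> w" "\<And>w. 0 \<le> z w + \<Delta> w"
    and moment: "\<And>x. (\<Sum>w\<in>S. \<Delta> w * (w \<bullet> x)\<^sup>2) \<le> 0"
    and gain: "\<And>x. 0 \<le> (\<Sum>w\<in>S. \<Delta> w * (1 - cos (2 * pi * (w \<bullet> x))))"
  shows "certificate C (\<lambda>w. z w + \<Delta> w)"
    and "infsum (\<lambda>w. z w + \<Delta> w) D = infsum z D + sum \<Delta> S"
proof -
  have w: "z \<in> weights D (moment_bound C)" by (rule certificate_imp_weights[OF z order_refl])
  have split: "(\<Sum>\<^sub>\<infinity>w\<in>D. (z w + \<Delta> w) * g w) = (\<Sum>\<^sub>\<infinity>w\<in>D. z w * g w) + (\<Sum>w\<in>S. \<Delta> w * g w)"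
    if "(\<lambda>w. z w * g w) summable_on D" for g
  proof -
    have eq: "(\<Sum>\<^sub>\<infinity>w\<in>D. \<Delta> w * g w) = (\<Sum>\<^sub>\<infinity>w\<in>S. \<Delta> w * g w)"
      by (rule infsum_cong_neutral) (use S \<Delta>(1) in auto)
    have "(\<lambda>w. \<Delta> w * g w) summable_on D \<longleftrightarrow> (\<lambda>w. \<Delta> w * g w) summable_on S"
      by (rule summable_on_cong_neutral) (use S \<Delta>(1) in auto)
    then have "(\<lambda>w. \<Delta> w * g w) summable_on D" using S(1) by simp
    then show ?thesis using infsum_add[OF that] eq S(1) by (simp add: distrib_right)
  qed
  show "infsum (\<lambda>w. z w + \<Delta> w) D = infsum z D + sum \<Delta> S"
    using split[of "\<lambda>_. 1"] weights_summable_one[OF w] by simp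
  have "(norm x)\<^sup>2 \<le> energy (\<lambda>w. z w + \<Delta> w) x" if "x \<in> voronoi_cell L" for x
  proof -
    have "(norm x)\<^sup>2 \<le> energy z x" using z that by (simp add: certificate_def)
    also have "\<dots> \<le> energy (\<lambda>w. z w + \<Delta> w) x"
      using gain[of x] by (simp add: energy_def split[OF energy_summable[OF w]])
    finally show ?thesis .
  qed
  moreover have "4 * pi\<^sup>2 * (\<Sum>w\<in>F. (z w + \<Delta> w) * (w \<bullet> x)\<^sup>2) \<le> C * (norm x)\<^sup>2"
    if F: "finite F" "F \<subseteq> D" for F x
  proof -
    have "(\<Sum>w\<in>F. (z w + \<Delta> w) * (w \<bullet> x)\<^sup>2) \<le> (\<Sum>w\<in>F \<union> S. (z w + \<Delta> w) * (w \<bullet> x)\<^sup>2)"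
      using F S \<Delta>(3) by (intro sum_mono2) auto
    also have "\<dots> = (\<Sum>w\<in>F \<union> S. z w * (w \<bullet> x)\<^sup>2) + (\<Sum>w\<in>F \<union> S. \<Delta> w * (w \<bullet> x)\<^sup>2)"
      by (simp add: distrib_right sum.distrib)
    also have "(\<Sum>w\<in>F \<union> S. \<Delta> w * (w \<bullet> x)\<^sup>2) = (\<Sum>w\<in>S. \<Delta> w * (w \<bullet> x)\<^sup>2)"
      using F S \<Delta>(1) by (intro sum.mono_neutral_right) auto
    finally have "(\<Sum>w\<in>F. (z w + \<Delta> w) * (w \<bullet> x)\<^sup>2) \<le> (\<Sum>w\<in>F \<union> S. z w * (w \<bullet> x)\<^sup>2)"
      using moment[of x] by simp
    then have "4 * pi\<^sup>2 * (\<Sum>w\<in>F. (z w + \<Delta> w) * (w \<bullet> x)\<^sup>2) \<le> 4 * pi\<^sup>2 * (\<Sum>w\<in>F \<union> S. z w * (w \<bullet> x)\<^sup>2)"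
      by (intro mult_left_mono) auto
    moreover have "finite (F \<union> S)" "F \<union> S \<subseteq> D" using F S by auto
    then have "4 * pi\<^sup>2 * (\<Sum>w\<in>F \<union> S. z w * (w \<bullet> x)\<^sup>2) \<le> C * (norm x)\<^sup>2"
      using z unfolding certificate_def by blast
    ultimately show ?thesis by (rule order_trans)
  qed
  moreover have "\<Delta> w = 0" if "w \<notin> D \<or> w = 0" for w using that S(2) \<Delta>(1) by blast
  ultimately show "certificate C (\<lambda>w. z w + \<Delta> w)"
    using z \<Delta>(2,3) by (simp add: certificate_def)
qed

text \<open>With \<open>a = v + w\<close> one has \<open>u = a + w\<close> and \<open>v = a - w\<close>. By the parallelogram law for \<open>(u \<bullet> x)\<^sup>2\<close>, moving weight \<open>t\<close>
  from each of \<open>\<plusminus>u\<close>, \<open>\<plusminus>v\<close> to weight \<open>2 * t\<close> on each of \<open>\<plusminus>a\<close>, \<open>\<plusminus>w\<close> keeps all second moments. It adds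
  \<open>4 * t\<close> to the mass, so it must be impossible; the only obstruction is \<open>a = 0\<close> or \<open>w = 0\<close>.\<close>

lemma maximal_mass_parity:
  assumes z: "certificate C z"
    and max: "\<And>z'. certificate C z' \<Longrightarrow> infsum z' D \<le> infsum z D"
    and u: "z u \<noteq> 0" and v: "z v \<noteq> 0" and w: "w \<in> D" "u - v = 2 *\<^sub>R w"
  shows "u = v \<or> u = - v"
proof (rule ccontr)
  assume ne: "\<not> ?thesis"
  define a where "a = v + w"
  have uv: "u = a + w" "v = a - w" using w(2) by (simp_all add: a_def scaleR_2 algebra_simps)
  have nn: "0 \<le> z x" "z (- x) = z x" and z0: "x \<notin> D \<or> x = 0 \<Longrightarrow> z x = 0" for x
    using z by (auto simp: certificate_def)
  have mem: "u \<in> D - {0}" "v \<in> D - {0}" using z0 u v by blast+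
  have "a \<noteq> 0" "w \<noteq> 0" using ne uv by auto
  then have mem': "a \<in> D - {0}" "w \<in> D - {0}" using dual_group(3)[of v w] mem w by (auto simp: a_def)
  define t where "t = min (z u) (z v)"
  have t: "0 < t" "t \<le> z u" "t \<le> z v" using nn(1)[of u] nn(1)[of v] u v by (auto simp: t_def)
  define S where "S = {u, - u, v, - v, a, - a, w, - w}"
  have S: "finite S" "S \<subseteq> D - {0}" using mem mem' dual_group(2) by (auto simp: S_def)
  \<comment> \<open>Indicators are added up, so the formula also covers coincidences
    between the old and the new vectors, such as \<open>v = - 3 u\<close>, where \<open>a = - u\<close>.\<close>
  define \<Delta> where "\<Delta> x = 2 * t * (pair_indicator a x + pair_indicator w x)
      - t * (pair_indicator u x + pair_indicator v x)" for x
  have sum_\<Delta>: "(\<Sum>x\<in>S. \<Delta> x * g x) = 4 * t * g a + 4 * t * g w - 2 * t * g u - 2 * t * g v"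
    if even: "\<And>x. g (- x) = g x" for g
  proof -
    have "(\<Sum>x\<in>S. pair_indicator y x * g x) = 2 * g y" if "y \<in> S" "- y \<in> S" for y
      by (rule sum_pair_indicator) (use that S even in auto)
    from this[of a] this[of w] this[of u] this[of v] show ?thesis
      by (simp add: \<Delta>_def S_def[symmetric] left_diff_distrib distrib_right distrib_left sum_subtractf
          sum.distrib mult.assoc sum_distrib_left[symmetric]) (simp add: S_def algebra_simps)
  qed
  have "0 \<le> z x + \<Delta> x" for x
  proof -
    have "t * (pair_indicator u x + pair_indicator v x) \<le> z x"
      using t nn ne by (auto simp: pair_indicator_def)
    moreover have "0 \<le> 2 * t * (pair_indicator a x + pair_indicator w x)"
      using t by (auto simp: pair_indicator_def)
    ultimately show ?thesis by (simp add: \<Delta>_def)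
  qed
  moreover have "\<Delta> x = 0" if "x \<notin> S" for x using that by (auto simp: \<Delta>_def pair_indicator_def S_def)
  moreover have "\<Delta> (- x) = \<Delta> x" for x by (simp add: \<Delta>_def)
  moreover have "(\<Sum>y\<in>S. \<Delta> y * (y \<bullet> x)\<^sup>2) \<le> 0" for x
    by (subst sum_\<Delta>) (auto simp: uv inner_add_left inner_diff_left power2_eq_square algebra_simps)
  moreover have "0 \<le> (\<Sum>y\<in>S. \<Delta> y * (1 - cos (2 * pi * (y \<bullet> x))))" for x
  proof -
    define \<alpha> \<beta> where "\<alpha> = 2 * pi * (a \<bullet> x)" and "\<beta> = 2 * pi * (w \<bullet> x)"
    have "(\<Sum>y\<in>S. \<Delta> y * (1 - cos (2 * pi * (y \<bullet> x))))
        = 4 * t * (1 - cos \<alpha>) + 4 * t * (1 - cos \<beta>) - 2 * t * (1 - cos (\<alpha> + \<beta>)) - 2 * t * (1 - cos (\<alpha> - \<beta>))"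
      by (subst sum_\<Delta>) (auto simp: uv \<alpha>_def \<beta>_def inner_add_left inner_diff_left algebra_simps)
    also have "\<dots> = 4 * t * ((1 - cos \<alpha>) * (1 - cos \<beta>))"
      by (simp add: cos_add cos_diff algebra_simps)
    also have "\<dots> \<ge> 0" using t by (intro mult_nonneg_nonneg) auto
    finally show ?thesis .
  qed
  ultimately have "infsum z D + sum \<Delta> S \<le> infsum z D"
    using max certificate_perturb[OF z S, of \<Delta>] by metis
  moreover have "sum \<Delta> S = 4 * t" using sum_\<Delta>[of "\<lambda>_. 1"] by simp
  ultimately show False using t by simp
qed

text \<open>If \<open>u = k w\<close> with \<open>\<bar>k\<bar> \<ge> 2\<close>, moving weight \<open>t\<close> from \<open>\<plusminus>u\<close> to weight \<open>k\<^sup>2 * t\<close> on \<open>\<plusminus>w\<close> keeps the second moments and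
  multiplies the moved mass by \<open>k\<^sup>2\<close>.\<close>

lemma maximal_mass_primitive:
  assumes z: "certificate C z"
    and max: "\<And>z'. certificate C z' \<Longrightarrow> infsum z' D \<le> infsum z D"
    and u: "z u \<noteq> 0"
  shows "primitive_in D u"
proof -
  have nn: "0 \<le> z x" "z (- x) = z x" and z0: "x \<notin> D \<or> x = 0 \<Longrightarrow> z x = 0" for x
    using z by (auto simp: certificate_def)
  have mem: "u \<in> D - {0}" using z0 u by blast
  have False if w: "w \<in> D" "u = of_int k *\<^sub>R w" and k: "k \<noteq> 1" "k \<noteq> - 1" for k :: int and w
  proof -
    have "w \<noteq> 0" "k \<noteq> 0" using mem w by auto
    then have "1 < \<bar>real_of_int k\<bar>" using k by linarith
    then have k2: "1 < (real_of_int k)\<^sup>2" using one_less_power[of "\<bar>real_of_int k\<bar>" 2] by simp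
    define t where "t = z u"
    have t: "0 < t" using nn(1)[of u] u by (simp add: t_def)
    define S where "S = {u, - u, w, - w}"
    have S: "finite S" "S \<subseteq> D - {0}" using mem w \<open>w \<noteq> 0\<close> dual_group(2) by (auto simp: S_def)
    define \<Delta> where "\<Delta> x = (real_of_int k)\<^sup>2 * t * pair_indicator w x - t * pair_indicator u x" for x
    have sum_\<Delta>: "(\<Sum>x\<in>S. \<Delta> x * g x) = 2 * t * ((real_of_int k)\<^sup>2 * g w - g u)"
      if even: "\<And>x. g (- x) = g x" for g
    proof -
      have "(\<Sum>x\<in>S. pair_indicator y x * g x) = 2 * g y" if "y \<in> S" "- y \<in> S" for y
        by (rule sum_pair_indicator) (use that S even in auto)
      from this[of w] this[of u] show ?thesis
        by (simp add: \<Delta>_def S_def[symmetric] left_diff_distrib sum_subtractf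
            mult.assoc sum_distrib_left[symmetric]) (simp add: S_def algebra_simps)
    qed
    have "0 \<le> z x + \<Delta> x" for x
    proof -
      have "t * pair_indicator u x \<le> z x" using nn by (auto simp: pair_indicator_def t_def)
      moreover have "0 \<le> (real_of_int k)\<^sup>2 * t * pair_indicator w x"
        using t by (auto simp: pair_indicator_def)
      ultimately show ?thesis by (simp add: \<Delta>_def)
    qed
    moreover have "\<Delta> x = 0" if "x \<notin> S" for x using that by (auto simp: \<Delta>_def pair_indicator_def S_def)
    moreover have "\<Delta> (- x) = \<Delta> x" for x by (simp add: \<Delta>_def)
    moreover have "(\<Sum>y\<in>S. \<Delta> y * (y \<bullet> x)\<^sup>2) \<le> 0" for x
      by (subst sum_\<Delta>) (auto simp: w(2) power_mult_distrib)
    moreover have "0 \<le> (\<Sum>y\<in>S. \<Delta> y * (1 - cos (2 * pi * (y \<bullet> x))))" for x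
    proof -
      have "1 - cos (2 * pi * (u \<bullet> x)) \<le> (real_of_int k)\<^sup>2 * (1 - cos (2 * pi * (w \<bullet> x)))"
        using one_minus_cos_of_int_mult_le[of k "2 * pi * (w \<bullet> x)"] by (simp add: w(2) mult_ac)
      then show ?thesis using t by (subst sum_\<Delta>) auto
    qed
    ultimately have "infsum z D + sum \<Delta> S \<le> infsum z D"
      using max certificate_perturb[OF z S, of \<Delta>] by metis
    moreover have "sum \<Delta> S = 2 * t * ((real_of_int k)\<^sup>2 - 1)" using sum_\<Delta>[of "\<lambda>_. 1"] by simp
    moreover have "0 < 2 * t * ((real_of_int k)\<^sup>2 - 1)" using t k2 by simp
    ultimately show False by simp
  qed
  then show ?thesis using mem unfolding primitive_in_def by blast
qed

text \<open>The parities of the coordinates determine the class modulo twice the dual lattice, and a class contains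
  at most one pair of support vectors.\<close>

lemma maximal_mass_finite_support:
  assumes z: "certificate C z"
    and max: "\<And>z'. certificate C z' \<Longrightarrow> infsum z' D \<le> infsum z D"
  shows "finite {u. z u \<noteq> 0}"
proof -
  define parity where "parity u = (\<lambda>i. even \<lfloor>u \<bullet> b i\<rfloor>)" for u
  have fibre: "u = v \<or> u = - v" if uv: "z u \<noteq> 0" "z v \<noteq> 0" "parity u = parity v" for u v
  proof -
    have D: "u \<in> D" "v \<in> D" using z uv by (auto simp: certificate_def)
    have "((1 / 2) *\<^sub>R (u - v)) \<bullet> b i \<in> \<int>" for i
    proof -
      obtain k l where kl: "u \<bullet> b i = of_int k" "v \<bullet> b i = of_int l"
        using D by (metis mem_dual_iff Ints_cases)
      have "even k \<longleftrightarrow> even l" using fun_cong[OF uv(3), of i] by (simp add: parity_def kl)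
      then have "even (k - l)" by simp
      then obtain m where m: "k - l = 2 * m" by (rule evenE)
      have "real_of_int k - of_int l = 2 * of_int m" using arg_cong[OF m, of real_of_int] by simp
      then have "((1 / 2) *\<^sub>R (u - v)) \<bullet> b i = of_int m" by (simp add: inner_diff_left kl)
      then show ?thesis by simp
    qed
    then have "(1 / 2) *\<^sub>R (u - v) \<in> D" by (simp add: mem_dual_iff)
    then show ?thesis using maximal_mass_parity[OF z max uv(1,2)] by simp
  qed
  have "finite {u. z u \<noteq> 0 \<and> parity u = p}" for p
  proof (cases "\<exists>v. z v \<noteq> 0 \<and> parity v = p")
    case True
    then obtain v where v: "z v \<noteq> 0" "parity v = p" by blast
    have "u \<in> {v, - v}" if "z u \<noteq> 0" "parity u = p" for u
      using fibre[of u v] that v by simp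
    then have "{u. z u \<noteq> 0 \<and> parity u = p} \<subseteq> {v, - v}" by auto
    then show ?thesis by (rule finite_subset) simp
  next
    case False
    then have "{u. z u \<noteq> 0 \<and> parity u = p} = {}" by blast
    then show ?thesis by (simp only: finite.emptyI)
  qed
  then have "finite (\<Union>p\<in>UNIV. {u. z u \<noteq> 0 \<and> parity u = p})" by (rule finite_UN_I[OF finite])
  moreover have "{u. z u \<noteq> 0} \<subseteq> (\<Union>p\<in>UNIV. {u. z u \<noteq> 0 \<and> parity u = p})"
  proof
    fix u assume "u \<in> {u. z u \<noteq> 0}"
    then show "u \<in> (\<Union>p\<in>UNIV. {u. z u \<noteq> 0 \<and> parity u = p})"
      by (intro UN_I[of "parity u"]) simp_all
  qed
  ultimately show ?thesis by (rule rev_finite_subset)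
qed

end

section \<open>Trigonometric embeddings into finite-dimensional spaces\<close>

text \<open>The coordinates are extended by \<open>0\<close> off \<open>S\<close>, so that the spaces for all \<open>S\<close> share one type, over which
  the least distortion ranges.\<close>

definition fin_hilbert :: "'a set \<Rightarrow> ('a \<Rightarrow> complex) hilbert" where
  "fin_hilbert S = \<lparr>carrier = {f. \<forall>u. u \<notin> S \<longrightarrow> f u = 0}, mult = undefined, one = undefined,
     zero = (\<lambda>_. 0), add = (\<lambda>f g u. f u + g u), smult = (\<lambda>c f u. c * f u),
     ip = (\<lambda>f g. \<Sum>u\<in>S. f u * cnj (g u))\<rparr>"

lemma fin_hilbert_simps:
  "f \<in> carrier (fin_hilbert S) \<longleftrightarrow> (\<forall>u. u \<notin> S \<longrightarrow> f u = 0)"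
  "\<zero>\<^bsub>fin_hilbert S\<^esub> = (\<lambda>_. 0)" "f \<oplus>\<^bsub>fin_hilbert S\<^esub> g = (\<lambda>u. f u + g u)"
  "c \<odot>\<^bsub>fin_hilbert S\<^esub> f = (\<lambda>u. c * f u)" "ip (fin_hilbert S) f g = (\<Sum>u\<in>S. f u * cnj (g u))"
  by (simp_all add: fin_hilbert_def)

lemma abelian_group_fin_hilbert: "abelian_group (fin_hilbert S)"
proof (rule abelian_groupI)
  fix f assume "f \<in> carrier (fin_hilbert S)"
  then show "\<exists>g\<in>carrier (fin_hilbert S). g \<oplus>\<^bsub>fin_hilbert S\<^esub> f = \<zero>\<^bsub>fin_hilbert S\<^esub>"
    by (intro bexI[of _ "\<lambda>u. - f u"]) (auto simp: fin_hilbert_simps)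
qed (auto simp: fin_hilbert_simps add_ac)

lemma fin_hilbert_minus:
  assumes "f \<in> carrier (fin_hilbert S)" "g \<in> carrier (fin_hilbert S)"
  shows "f \<ominus>\<^bsub>fin_hilbert S\<^esub> g = (\<lambda>u. f u - g u)"
proof -
  interpret abelian_group "fin_hilbert S" by (rule abelian_group_fin_hilbert)
  define d where "d = (\<lambda>u. f u - g u)"
  have d: "d \<in> carrier (fin_hilbert S)" using assms by (auto simp: d_def fin_hilbert_simps)
  have "f = d \<oplus>\<^bsub>fin_hilbert S\<^esub> g" by (simp add: d_def fin_hilbert_simps)
  then have "f \<ominus>\<^bsub>fin_hilbert S\<^esub> g = d" using assms d by (simp add: a_minus_def a_assoc r_neg)
  then show ?thesis by (simp add: d_def)
qed

lemma hdist_fin_hilbert: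
  assumes "f \<in> carrier (fin_hilbert S)" "g \<in> carrier (fin_hilbert S)"
  shows "hdist (fin_hilbert S) f g = sqrt (\<Sum>u\<in>S. (cmod (f u - g u))\<^sup>2)"
  unfolding hdist_def hnorm_def fin_hilbert_minus[OF assms] fin_hilbert_simps complex_norm_square[symmetric]
  by (simp flip: of_real_power of_real_sum)

lemma hilbert_space_fin_hilbert:
  assumes S: "finite S" shows "hilbert_space (fin_hilbert S)"
proof (intro hilbert_space.intro hilbert_space_axioms.intro)
  show "module complex_field (fin_hilbert S)"
    by (rule moduleI)
       (use cring_complex_field abelian_group_fin_hilbert in
         \<open>auto simp: fin_hilbert_simps distrib_left distrib_right mult.assoc\<close>)
next
  fix f assume f: "f \<in> carrier (fin_hilbert S)" "f \<noteq> \<zero>\<^bsub>fin_hilbert S\<^esub>"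
  then obtain u where "f u \<noteq> 0" by (auto simp: fin_hilbert_simps fun_eq_iff)
  with f(1) have "u \<in> S" "f u \<noteq> 0" by (auto simp: fin_hilbert_simps)
  then have "0 < (\<Sum>u\<in>S. (cmod (f u))\<^sup>2)" by (intro sum_pos2[OF S, of u]) auto
  then show "0 < Re (ip (fin_hilbert S) f f)"
    by (simp add: fin_hilbert_simps flip: complex_norm_square of_real_power of_real_sum)
next
  fix s :: "nat \<Rightarrow> 'a \<Rightarrow> complex"
  assume s: "\<And>k. s k \<in> carrier (fin_hilbert S)"
    and cau: "\<forall>e>0. \<exists>N. \<forall>i\<ge>N. \<forall>j\<ge>N. hdist (fin_hilbert S) (s i) (s j) < e"
  have coord: "cmod (s i u - s j u) \<le> hdist (fin_hilbert S) (s i) (s j)" for i j u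
  proof (cases "u \<in> S")
    case True
    have "(cmod (s i u - s j u))\<^sup>2 \<le> (\<Sum>u\<in>S. (cmod (s i u - s j u))\<^sup>2)"
      by (rule member_le_sum[OF True _ S]) simp
    then show ?thesis unfolding hdist_fin_hilbert[OF s s] by (rule real_le_rsqrt)
  next
    case False
    then show ?thesis using s by (simp add: fin_hilbert_simps hdist_fin_hilbert[OF s s] sum_nonneg)
  qed
  have "Cauchy (\<lambda>k. s k u)" for u
    unfolding Cauchy_def dist_norm using cau coord by (meson le_less_trans)
  then have "\<exists>l. (\<lambda>k. s k u) \<longlonglongrightarrow> l" for u by (simp add: Cauchy_convergent_iff convergent_def)
  then obtain l where l: "\<And>u. (\<lambda>k. s k u) \<longlonglongrightarrow> l u" by metis
  have "l u = 0" if "u \<notin> S" for u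
  proof -
    have "(\<lambda>k. s k u) = (\<lambda>_. 0)" using s that by (auto simp: fin_hilbert_simps)
    then show ?thesis using l[of u] by (simp add: LIMSEQ_const_iff)
  qed
  then have lc: "l \<in> carrier (fin_hilbert S)" by (simp add: fin_hilbert_simps)
  have "(\<lambda>k. sqrt (\<Sum>u\<in>S. (cmod (s k u - l u))\<^sup>2)) \<longlonglongrightarrow> sqrt (\<Sum>u\<in>S. (cmod (l u - l u))\<^sup>2)"
    by (intro tendsto_intros l)
  then show "\<exists>l\<in>carrier (fin_hilbert S). (\<lambda>k. hdist (fin_hilbert S) (s k) l) \<longlonglongrightarrow> 0"
    using lc by (intro bexI[of _ l]) (simp_all add: hdist_fin_hilbert[OF s lc])
qed (auto simp: fin_hilbert_simps sum.distrib distrib_left distrib_right sum_distrib_left mult_ac)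

lemma finite_dimensional_fin_hilbert:
  assumes S: "finite S" shows "finite_dimensional (fin_hilbert S)"
proof -
  interpret abelian_group "fin_hilbert S" by (rule abelian_group_fin_hilbert)
  define \<delta> :: "'a \<Rightarrow> 'a \<Rightarrow> complex" where "\<delta> v u = (if u = v then 1 else 0)" for v u
  have inj: "inj \<delta>" by (intro injI) (metis \<delta>_def zero_neq_one)
  have finsum: "(\<Oplus>\<^bsub>fin_hilbert S\<^esub>b\<in>A. h b) = (\<lambda>u. \<Sum>b\<in>A. h b u)"
    if "finite A" "h \<in> A \<rightarrow> carrier (fin_hilbert S)" for A and h :: "('a \<Rightarrow> complex) \<Rightarrow> 'a \<Rightarrow> complex"
    using that
  proof (induction A rule: finite_induct)
    case (insert a A)
    then show ?case by (subst finsum_insert) (auto simp: fin_hilbert_simps(3))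
  qed (simp add: fin_hilbert_simps)
  have "x = (\<Oplus>\<^bsub>fin_hilbert S\<^esub>b\<in>\<delta> ` S. (\<Sum>v\<in>S. x v * b v) \<odot>\<^bsub>fin_hilbert S\<^esub> b)"
    if x: "x \<in> carrier (fin_hilbert S)" for x
  proof -
    have "(\<Oplus>\<^bsub>fin_hilbert S\<^esub>b\<in>\<delta> ` S. (\<Sum>v\<in>S. x v * b v) \<odot>\<^bsub>fin_hilbert S\<^esub> b)
        = (\<lambda>u. \<Sum>b\<in>\<delta> ` S. (\<Sum>v\<in>S. x v * b v) * b u)"
      using S by (subst finsum) (auto simp: fin_hilbert_simps \<delta>_def)
    also have "\<dots> = (\<lambda>u. \<Sum>w\<in>S. (\<Sum>v\<in>S. x v * \<delta> w v) * \<delta> w u)"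
      by (simp add: sum.reindex[OF inj_on_subset[OF inj subset_UNIV]])
    also have "\<dots> = x"
    proof
      fix u
      have "(\<Sum>v\<in>S. x v * \<delta> w v) = x w" if "w \<in> S" for w
        using S that by (simp add: \<delta>_def if_distrib[of "(*) _"] cong: if_cong)
      then have "(\<Sum>w\<in>S. (\<Sum>v\<in>S. x v * \<delta> w v) * \<delta> w u) = (\<Sum>w\<in>S. if u = w then x w else 0)"
        by (intro sum.cong) (auto simp: \<delta>_def)
      then show "(\<Sum>w\<in>S. (\<Sum>v\<in>S. x v * \<delta> w v) * \<delta> w u) = x u"
        using x S by (simp add: fin_hilbert_simps)
    qed
    finally show ?thesis by simp
  qed
  moreover have "\<delta> ` S \<subseteq> carrier (fin_hilbert S)" by (auto simp: \<delta>_def fin_hilbert_simps)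
  ultimately show ?thesis unfolding finite_dimensional_def using S
    by (intro exI[of _ "\<delta> ` S"] conjI finite_imageI ballI
        exI[of _ "\<lambda>b. \<Sum>v\<in>S. _ v * b v"])
qed

lemma cmod_cis_diff_sq: "(cmod (cis a - cis b))\<^sup>2 = 2 * (1 - cos (a - b))"
proof -
  have "(cmod (cis a - cis b))\<^sup>2 = (cos a - cos b)\<^sup>2 + (sin a - sin b)\<^sup>2" by (simp add: cmod_power2)
  also have "\<dots> = ((sin a)\<^sup>2 + (cos a)\<^sup>2) + ((sin b)\<^sup>2 + (cos b)\<^sup>2) - 2 * (cos a * cos b + sin a * sin b)"
    by (simp add: power2_diff algebra_simps)
  finally show ?thesis by (simp add: cos_diff)
qed

lemma one_minus_cos_le: "2 * (1 - cos y) \<le> y\<^sup>2" for y :: real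
proof -
  have "1 - cos y = 2 * (sin (y / 2))\<^sup>2" using cos_double_sin[of "y / 2"] by simp
  moreover have "\<bar>sin (y / 2)\<bar>\<^sup>2 \<le> \<bar>y / 2\<bar>\<^sup>2" by (intro power_mono abs_sin_x_le_abs_x) auto
  ultimately show ?thesis by (simp add: power_divide)
qed

context lattice_basis
begin

text \<open>On the support of \<open>z\<close> the result is independent of the chosen representative of the class. Off
  the support the factor \<open>sqrt (z u)\<close> vanishes, which places the values in \<open>fin_hilbert\<close>.\<close>

definition trig_embedding :: "(real^'n \<Rightarrow> real) \<Rightarrow> (real^'n) set \<Rightarrow> real^'n \<Rightarrow> complex" where
  "trig_embedding z X u = of_real (sqrt (z u)) * cis (2 * pi * (u \<bullet> (SOME x. cls x = X)))"

text \<open>Since \<open>2 * (1 - cos y) \<le> y\<^sup>2\<close>, the quadratic forms of the certificate bound the energy at every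
  representative of a class, in particular at the shortest one.\<close>

lemma energy_le:
  assumes z: "certificate C z" and fin: "finite {u. z u \<noteq> 0}"
  shows "energy z x \<le> C * (infdist x L)\<^sup>2"
proof -
  obtain v where v: "v \<in> L" "infdist x L = norm (x - v)" by (rule infdist_lattice_attained)
  have nn: "0 \<le> z u" for u using z by (simp add: certificate_def)
  have sub: "{u. z u \<noteq> 0} \<subseteq> D" using z by (auto simp: certificate_def)
  have "energy z x = energy z (x - v)" using energy_shift[OF v(1)] by simp
  also have "\<dots> = (\<Sum>u | z u \<noteq> 0. z u * (2 * (1 - cos (2 * pi * (u \<bullet> (x - v))))))"
    using fin sub by (subst energy_eq_sum[of "{u. z u \<noteq> 0}"]) (auto simp: sum_distrib_left mult.left_commute)
  also have "\<dots> \<le> (\<Sum>u | z u \<noteq> 0. z u * (2 * pi * (u \<bullet> (x - v)))\<^sup>2)"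
    by (intro sum_mono mult_left_mono one_minus_cos_le nn)
  also have "\<dots> = 4 * pi\<^sup>2 * (\<Sum>u | z u \<noteq> 0. z u * (u \<bullet> (x - v))\<^sup>2)"
    by (simp add: sum_distrib_left power_mult_distrib mult_ac)
  also have "\<dots> \<le> C * (norm (x - v))\<^sup>2" using z fin sub unfolding certificate_def by blast
  finally show ?thesis by (simp add: v(2))
qed

text \<open>The squared distance of two image points is the energy of their difference, which lies between the square of the torus
  distance and \<open>C\<close> times this square.\<close>

lemma trig_embedding:
  assumes z: "certificate C z" and fin: "finite {u. z u \<noteq> 0}"
  defines "H \<equiv> fin_hilbert {u. z u \<noteq> 0}"
  shows "euclidean_embedding L H (trig_embedding z)"
    and "distortion L H (trig_embedding z) \<le> ennreal (sqrt C)"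
proof -
  have nn: "0 \<le> z u" for u using z by (simp add: certificate_def)
  have sub: "{u. z u \<noteq> 0} \<subseteq> D" using z by (auto simp: certificate_def)
  have car: "trig_embedding z X \<in> carrier H" for X
    by (simp add: H_def fin_hilbert_simps trig_embedding_def)
  have dist: "hdist H (trig_embedding z (cls x)) (trig_embedding z (cls y)) = sqrt (energy z (x - y))" for x y
  proof -
    define p q where "p = (SOME p. cls p = cls x)" and "q = (SOME q. cls q = cls y)"
    have "cls p = cls x" "cls q = cls y" unfolding p_def q_def by (rule someI, rule refl)+
    then have "(p - x) - (q - y) \<in> L" using full_lattice_group(2)[OF full] by (simp add: cls_eq_iff)
    then have "energy z (p - q) = energy z (x - y)"
      using energy_shift[of "(p - x) - (q - y)" z "p - q"] by simp
    moreover have "(\<Sum>u | z u \<noteq> 0. (cmod (trig_embedding z (cls x) u - trig_embedding z (cls y) u))\<^sup>2)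
        = energy z (p - q)"
    proof -
      have "(\<Sum>u | z u \<noteq> 0. (cmod (trig_embedding z (cls x) u - trig_embedding z (cls y) u))\<^sup>2)
          = (\<Sum>u | z u \<noteq> 0. 2 * (z u * (1 - cos (2 * pi * (u \<bullet> (p - q))))))"
      proof (rule sum.cong[OF refl])
        fix u
        have "trig_embedding z (cls x) u - trig_embedding z (cls y) u
            = of_real (sqrt (z u)) * (cis (2 * pi * (u \<bullet> p)) - cis (2 * pi * (u \<bullet> q)))"
          by (simp add: trig_embedding_def p_def q_def right_diff_distrib)
        moreover have "2 * pi * (u \<bullet> p) - 2 * pi * (u \<bullet> q) = 2 * pi * (u \<bullet> (p - q))"
          by (simp add: inner_diff_right right_diff_distrib)
        ultimately show "(cmod (trig_embedding z (cls x) u - trig_embedding z (cls y) u))\<^sup>2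
            = 2 * (z u * (1 - cos (2 * pi * (u \<bullet> (p - q)))))"
          using nn by (simp only: norm_mult power_mult_distrib cmod_cis_diff_sq) simp
      qed
      also have "\<dots> = energy z (p - q)"
        using fin sub by (subst energy_eq_sum[of "{u. z u \<noteq> 0}"]) (auto simp: sum_distrib_left)
      finally show ?thesis .
    qed
    ultimately show ?thesis
      using hdist_fin_hilbert[OF car[unfolded H_def] car[unfolded H_def]] by (simp add: H_def)
  qed
  have lower: "infdist x L \<le> sqrt (energy z x)" for x
    using certificate_lower[OF z, of x] by (rule real_le_rsqrt)
  have upper: "sqrt (energy z x) \<le> sqrt C * infdist x L" for x
  proof -
    have "sqrt (energy z x) \<le> sqrt (C * (infdist x L)\<^sup>2)" using energy_le[OF z fin, of x] by simp
    then show ?thesis by (simp add: real_sqrt_mult infdist_nonneg)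
  qed
  show "euclidean_embedding L H (trig_embedding z)"
    unfolding euclidean_embedding_def
  proof (intro conjI inj_onI)
    show "hilbert_space H" unfolding H_def by (rule hilbert_space_fin_hilbert[OF fin])
    show "trig_embedding z \<in> flat_torus L \<rightarrow> carrier H" using car by simp
    fix X Y assume XY: "X \<in> flat_torus L" "Y \<in> flat_torus L" "trig_embedding z X = trig_embedding z Y"
    then obtain x y where xy: "X = cls x" "Y = cls y" by (auto simp: flat_torus_eq)
    have "hdist H (trig_embedding z X) (trig_embedding z Y) = 0"
      using car unfolding XY(3) H_def by (subst hdist_fin_hilbert) auto
    then have "infdist (x - y) L = 0"
      using lower[of "x - y"] infdist_nonneg[of "x - y" L] by (simp add: xy dist)
    then show "X = Y" by (simp add: xy cls_eq_iff infdist_eq_0_iff)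
  qed
  have "distortion L H (trig_embedding z) \<le> ennreal (sqrt C) * 1"
    unfolding distortion_def
  proof (intro mult_mono SUP_least, clarify)
    fix X Y assume "(X, Y) \<in> distinct_pairs L"
    then obtain x y where xy: "X = cls x" "Y = cls y" "cls x \<noteq> cls y"
      by (auto simp: distinct_pairs_def flat_torus_eq)
    then have "0 < infdist (x - y) L"
      using infdist_nonneg[of "x - y" L] infdist_eq_0_iff[of "x - y"] by (simp add: cls_eq_iff)
    then show "ennreal (hdist H (trig_embedding z X) (trig_embedding z Y) / torus_dist L X Y) \<le> ennreal (sqrt C)"
      using upper[of "x - y"] by (intro ennreal_leI) (simp add: xy dist torus_dist_cls field_simps)
  next
    fix p assume "p \<in> distinct_pairs L"
    then obtain x y where xy: "p = (cls x, cls y)" "cls x \<noteq> cls y"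
      by (auto simp: distinct_pairs_def flat_torus_eq)
    then have "0 < infdist (x - y) L"
      using infdist_nonneg[of "x - y" L] infdist_eq_0_iff[of "x - y"] by (simp add: cls_eq_iff)
    then have "torus_dist L (cls x) (cls y) / hdist H (trig_embedding z (cls x)) (trig_embedding z (cls y)) \<le> 1"
      using lower[of "x - y"] unfolding dist torus_dist_cls by (subst divide_le_eq_1_pos) linarith+
    then show "(case p of (X, Y) \<Rightarrow> ennreal (torus_dist L X Y / hdist H (trig_embedding z X) (trig_embedding z Y))) \<le> 1"
      by (simp add: xy)
  qed auto
  then show "distortion L H (trig_embedding z) \<le> ennreal (sqrt C)" by simp
qed

end

section \<open>Averaging a kernel over torsion points\<close>

text \<open>Orthogonality of the characters of a cyclic group of odd order, summed over representatives of the
  residues that are symmetric about \<open>0\<close>.\<close>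

lemma sum_cis_symmetric_interval:
  fixes m :: int and r :: nat
  defines "N \<equiv> 2 * r + 1"
  shows "(\<Sum>k\<in>{- int r..int r}. cis (2 * pi * (of_int k * (of_int m / real N))))
    = (if int N dvd m then of_nat N else 0)"
proof (cases "int N dvd m")
  case True
  then obtain l where l: "m = int N * l" by (rule dvdE)
  have "cis (2 * pi * (of_int k * (of_int m / real N))) = 1" for k :: int
  proof -
    have "of_int k * (of_int m / real N) = of_int (k * l)" by (simp add: l N_def)
    then show ?thesis by (simp only: cis_multiple_2pi[OF Ints_of_int])
  qed
  then show ?thesis using True by (simp add: N_def)
next
  case False
  define w where "w = cis (2 * pi * (of_int m / real N))"
  have wN: "w ^ N = 1"
  proof -
    have "w ^ N = cis (real N * (2 * pi * (of_int m / real N)))" by (simp only: w_def Complex.DeMoivre)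
    also have "real N * (2 * pi * (of_int m / real N)) = 2 * pi * of_int m" by (simp add: N_def field_simps)
    finally show ?thesis by (simp only: cis_multiple_2pi[OF Ints_of_int])
  qed
  have w1: "w \<noteq> 1"
  proof
    assume "w = 1"
    then have "cos (2 * pi * (of_int m / real N)) = 1" by (metis w_def cis.sel(1) one_complex.sel(1))
    then obtain k :: int where "2 * pi * (of_int m / real N) = of_int k * 2 * pi"
      by (auto simp: cos_one_2pi_int)
    then have "(2 * pi) * (of_int m / real N) = (2 * pi) * of_int k" by (simp only: mult_ac)
    then have "of_int m / real N = of_int k" by (subst (asm) mult_left_cancel) auto
    then have "real_of_int m = of_int k * real N" by (simp add: N_def field_simps)
    then have "m = k * int N" by (metis of_int_eq_iff of_int_mult of_int_of_nat_eq)
    then show False using False by simp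
  qed
  have "(\<Sum>k\<in>{- int r..int r}. cis (2 * pi * (of_int k * (of_int m / real N))))
      = (\<Sum>j<N. cis (- (2 * pi * (real r * (of_int m / real N)))) * w ^ j)"
  proof (rule sum.reindex_bij_witness[of _ "\<lambda>j. int j - int r" "\<lambda>k. nat (k + int r)"])
    fix k assume k: "k \<in> {- int r..int r}"
    define x where "x = 2 * pi * (of_int m / real N)"
    have "w ^ nat (k + int r) = cis (real (nat (k + int r)) * x)" by (simp add: w_def Complex.DeMoivre x_def)
    also have "real (nat (k + int r)) = of_int k + real r" using k by simp
    finally have "cis (- (real r * x)) * w ^ nat (k + int r) = cis (of_int k * x)"
      by (simp add: cis_mult algebra_simps)
    then show "cis (- (2 * pi * (real r * (of_int m / real N)))) * w ^ nat (k + int r)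
        = cis (2 * pi * (of_int k * (of_int m / real N)))"
      by (simp add: x_def mult_ac)
  qed (auto simp: N_def)
  also have "\<dots> = cis (- (2 * pi * (real r * (of_int m / real N)))) * (\<Sum>j<N. w ^ j)"
    by (simp add: sum_distrib_left)
  also have "(\<Sum>j<N. w ^ j) = 0" using w1 wN by (simp add: geometric_sum)
  finally show ?thesis using False by simp
qed

lemma floor_mem_symmetric_interval: "\<lfloor>t\<rfloor> \<in> {- int r..int r}" if "\<bar>t\<bar> \<le> real r" for t :: real
proof -
  have "- real r \<le> t" "t \<le> real r" using that by linarith+
  from this[THEN floor_mono] show ?thesis by (simp add: floor_minus)
qed

lemma prod_if_all: "(\<Prod>i\<in>(UNIV :: 'i::finite set). if P i then c else 0)
    = (if \<forall>i. P i then c ^ CARD('i) else 0)" for c :: complex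
  by (cases "\<forall>i. P i") auto

lemma cis_sum: "finite A \<Longrightarrow> cis (\<Sum>i\<in>A. f i) = (\<Prod>i\<in>A. cis (f i))"
  by (induction A rule: finite_induct) (simp_all add: cis_mult[symmetric])

context lattice_basis
begin

abbreviation int_box :: "nat \<Rightarrow> ('n \<Rightarrow> int) set" where
  "int_box r \<equiv> PiE UNIV (\<lambda>_. {- int r..int r})"

text \<open>For odd \<open>N = 2 * r + 1\<close>, \<open>freqs r\<close> represents the characters of the group \<open>(1/N) L / L\<close> and \<open>cell r\<close> represents its elements. Odd
  orders allow representatives symmetric about the origin; for the frequencies this gives \<open>z (- u) = z u\<close> and the smallest
  possible coordinates, on which the uniform moment bound rests.\<close>

definition freqs :: "nat \<Rightarrow> (real^'n) set" where
  "freqs r = {u\<in>D. \<forall>i. \<bar>u \<bullet> b i\<bar> \<le> real r}"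

definition grid :: "nat \<Rightarrow> (real^'n) set" where
  "grid N = {x. \<forall>i. real N * (x \<bullet> b' i) \<in> \<int>}"

definition cell :: "nat \<Rightarrow> (real^'n) set" where
  "cell r = {x\<in>grid (2 * r + 1). \<forall>i. \<bar>real (2 * r + 1) * (x \<bullet> b' i)\<bar> \<le> real r}"

lemma bij_betw_freqs: "bij_betw (\<lambda>k. \<Sum>i\<in>UNIV. of_int (k i) *\<^sub>R b' i) (int_box r) (freqs r)"
proof (rule bij_betw_byWitness[where f' = "\<lambda>u i. \<lfloor>u \<bullet> b i\<rfloor>"])
  show "\<forall>k\<in>int_box r. (\<lambda>i. \<lfloor>(\<Sum>i\<in>UNIV. of_int (k i) *\<^sub>R b' i) \<bullet> b i\<rfloor>) = k"
    by (simp add: inner_dual_combination)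
  show "\<forall>u\<in>freqs r. (\<Sum>i\<in>UNIV. of_int \<lfloor>u \<bullet> b i\<rfloor> *\<^sub>R b' i) = u"
  proof
    fix u assume "u \<in> freqs r"
    then have "of_int \<lfloor>u \<bullet> b i\<rfloor> = u \<bullet> b i" for i
      unfolding freqs_def mem_dual_iff by (metis (mono_tags, lifting) Ints_cases floor_of_int mem_Collect_eq)
    then have "(\<Sum>i\<in>UNIV. of_int \<lfloor>u \<bullet> b i\<rfloor> *\<^sub>R b' i) = (\<Sum>i\<in>UNIV. (u \<bullet> b i) *\<^sub>R b' i)" by (simp only:)
    then show "(\<Sum>i\<in>UNIV. of_int \<lfloor>u \<bullet> b i\<rfloor> *\<^sub>R b' i) = u" by (simp only: expand_dual[symmetric])
  qed
  show "(\<lambda>k. \<Sum>i\<in>UNIV. of_int (k i) *\<^sub>R b' i) ` int_box r \<subseteq> freqs r"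
  proof clarify
    fix k assume k: "k \<in> int_box r"
    have "\<bar>real_of_int (k i)\<bar> \<le> real r" for i
    proof -
      have "- int r \<le> k i \<and> k i \<le> int r" using k by auto
      then show ?thesis by linarith
    qed
    then show "(\<Sum>i\<in>UNIV. of_int (k i) *\<^sub>R b' i) \<in> freqs r"
      by (simp add: freqs_def mem_dual_iff inner_dual_combination)
  qed
  show "(\<lambda>u i. \<lfloor>u \<bullet> b i\<rfloor>) ` freqs r \<subseteq> int_box r"
  proof clarify
    fix u assume "u \<in> freqs r"
    then have "\<bar>u \<bullet> b i\<bar> \<le> real r" for i by (simp add: freqs_def)
    then have "\<lfloor>u \<bullet> b i\<rfloor> \<in> {- int r..int r}" for i by (rule floor_mem_symmetric_interval)
    then show "(\<lambda>i. \<lfloor>u \<bullet> b i\<rfloor>) \<in> int_box r" by (intro PiE_I) simp_all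
  qed
qed

lemma bij_betw_cell:
  "bij_betw (\<lambda>k. \<Sum>i\<in>UNIV. (of_int (k i) / real (2 * r + 1)) *\<^sub>R b i) (int_box r) (cell r)"
proof (rule bij_betw_byWitness[where f' = "\<lambda>x i. \<lfloor>real (2 * r + 1) * (x \<bullet> b' i)\<rfloor>"])
  show "\<forall>k\<in>int_box r. (\<lambda>i. \<lfloor>real (2 * r + 1) *
      ((\<Sum>i\<in>UNIV. (of_int (k i) / real (2 * r + 1)) *\<^sub>R b i) \<bullet> b' i)\<rfloor>) = k"
    by (simp add: inner_combination_dual del: of_nat_Suc of_nat_add)
  show "\<forall>x\<in>cell r. (\<Sum>i\<in>UNIV. (of_int \<lfloor>real (2 * r + 1) * (x \<bullet> b' i)\<rfloor> / real (2 * r + 1)) *\<^sub>R b i) = x"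
  proof
    fix x assume "x \<in> cell r"
    then have "of_int \<lfloor>real (2 * r + 1) * (x \<bullet> b' i)\<rfloor> = real (2 * r + 1) * (x \<bullet> b' i)" for i
      unfolding cell_def grid_def by (metis (mono_tags, lifting) Ints_cases floor_of_int mem_Collect_eq)
    then have "(\<Sum>i\<in>UNIV. (of_int \<lfloor>real (2 * r + 1) * (x \<bullet> b' i)\<rfloor> / real (2 * r + 1)) *\<^sub>R b i)
        = (\<Sum>i\<in>UNIV. (real (2 * r + 1) * (x \<bullet> b' i) / real (2 * r + 1)) *\<^sub>R b i)" by (simp only:)
    also have "\<dots> = (\<Sum>i\<in>UNIV. (x \<bullet> b' i) *\<^sub>R b i)" by simp
    finally show "(\<Sum>i\<in>UNIV. (of_int \<lfloor>real (2 * r + 1) * (x \<bullet> b' i)\<rfloor> / real (2 * r + 1)) *\<^sub>R b i) = x"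
      by (simp only: expand[symmetric])
  qed
  show "(\<lambda>k. \<Sum>i\<in>UNIV. (of_int (k i) / real (2 * r + 1)) *\<^sub>R b i) ` int_box r \<subseteq> cell r"
  proof clarify
    fix k assume k: "k \<in> int_box r"
    have "\<bar>real_of_int (k i)\<bar> \<le> real r" for i
    proof -
      have "- int r \<le> k i \<and> k i \<le> int r" using k by auto
      then show ?thesis by linarith
    qed
    then show "(\<Sum>i\<in>UNIV. (of_int (k i) / real (2 * r + 1)) *\<^sub>R b i) \<in> cell r"
      by (simp add: cell_def grid_def inner_combination_dual del: of_nat_Suc of_nat_add)
  qed
  show "(\<lambda>x i. \<lfloor>real (2 * r + 1) * (x \<bullet> b' i)\<rfloor>) ` cell r \<subseteq> int_box r"
  proof clarify
    fix x assume "x \<in> cell r"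
    then have "\<bar>real (2 * r + 1) * (x \<bullet> b' i)\<bar> \<le> real r" for i by (simp only: cell_def mem_Collect_eq)
    then have "\<lfloor>real (2 * r + 1) * (x \<bullet> b' i)\<rfloor> \<in> {- int r..int r}" for i by (rule floor_mem_symmetric_interval)
    then show "(\<lambda>i. \<lfloor>real (2 * r + 1) * (x \<bullet> b' i)\<rfloor>) \<in> int_box r" by (intro PiE_I) simp_all
  qed
qed

lemma finite_int_box: "finite (int_box r)"
  by (rule finite_PiE) auto

lemma finite_freqs: "finite (freqs r)"
  using bij_betw_finite[OF bij_betw_freqs] finite_int_box by blast

lemma finite_cell: "finite (cell r)"
  using bij_betw_finite[OF bij_betw_cell] finite_int_box by blast

lemma card_cell: "card (cell r) = (2 * r + 1) ^ CARD('n)"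
proof -
  have "card (cell r) = card (int_box r)" by (rule bij_betw_same_card[OF bij_betw_cell, symmetric])
  moreover have "nat (2 * int r + 1) = 2 * r + 1" by linarith
  ultimately show ?thesis by (simp add: card_PiE)
qed

lemma grid_diff: "x \<in> grid N \<Longrightarrow> y \<in> grid N \<Longrightarrow> x - y \<in> grid N"
  by (auto simp: grid_def inner_diff_left right_diff_distrib)

lemma grid_add: "x \<in> grid N \<Longrightarrow> y \<in> grid N \<Longrightarrow> x + y \<in> grid N"
  by (auto simp: grid_def inner_add_left distrib_left)

text \<open>Expanding \<open>u \<bullet> x\<close> in coordinates turns the sum over the box of frequencies into a product of sums
  over intervals.\<close>

lemma character_sum:
  assumes x: "x \<in> grid (2 * r + 1)"
  shows "(\<Sum>u\<in>freqs r. cos (2 * pi * (u \<bullet> x))) = (if x \<in> L then real (card (cell r)) else 0)"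
proof -
  define N where "N = 2 * r + 1"
  have N: "real N \<noteq> 0" by (simp add: N_def)
  obtain m :: "'n \<Rightarrow> int" where m: "\<And>i. real N * (x \<bullet> b' i) = of_int (m i)"
    using x unfolding grid_def N_def[symmetric] Ints_def by (simp add: image_iff) metis
  then have xm: "x \<bullet> b' i = of_int (m i) / real N" for i using N by (simp add: field_simps)
  have xL: "x \<in> L \<longleftrightarrow> (\<forall>i. int N dvd m i)"
  proof -
    have "x \<bullet> b' i \<in> \<int> \<longleftrightarrow> int N dvd m i" for i
    proof
      assume "x \<bullet> b' i \<in> \<int>"
      then obtain k where "x \<bullet> b' i = of_int k" by (rule Ints_cases)
      then have "real_of_int (m i) = of_int (int N * k)" using m[of i] by simp
      then show "int N dvd m i" by (metis of_int_eq_iff dvd_triv_left)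
    next
      assume "int N dvd m i"
      then obtain k where "m i = int N * k" by (rule dvdE)
      then show "x \<bullet> b' i \<in> \<int>" using N by (simp add: xm)
    qed
    then show ?thesis by (simp add: mem_lattice_iff)
  qed
  have "(\<Sum>u\<in>freqs r. cis (2 * pi * (u \<bullet> x)))
      = (\<Sum>k\<in>int_box r. cis (2 * pi * ((\<Sum>i\<in>UNIV. of_int (k i) *\<^sub>R b' i) \<bullet> x)))"
    by (rule sum.reindex_bij_betw[OF bij_betw_freqs, symmetric])
  also have "\<dots> = (\<Sum>k\<in>int_box r. \<Prod>i\<in>UNIV. cis (2 * pi * (of_int (k i) * (of_int (m i) / real N))))"
    by (intro sum.cong refl)
       (simp add: inner_eq_sum_coordinates[of _ x] inner_dual_combination xm sum_distrib_left cis_sum)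
  also have "\<dots> = (\<Prod>i\<in>(UNIV :: 'n set). \<Sum>k\<in>{- int r..int r}. cis (2 * pi * (of_int k * (of_int (m i) / real N))))"
    by (rule prod_sum_PiE[symmetric]) auto
  also have "\<dots> = (\<Prod>i\<in>(UNIV :: 'n set). if int N dvd m i then of_nat N else 0)"
    unfolding N_def by (intro prod.cong refl sum_cis_symmetric_interval)
  also have "\<dots> = (if x \<in> L then of_nat (card (cell r)) else 0)"
    unfolding prod_if_all xL card_cell N_def by simp
  finally have "Re (\<Sum>u\<in>freqs r. cis (2 * pi * (u \<bullet> x))) = Re (if x \<in> L then of_nat (card (cell r)) else 0)"
    by simp
  then show ?thesis by (simp add: if_distrib[of Re] cong: if_cong)
qed

lemma cell_representative:
  assumes x: "x \<in> grid (2 * r + 1)"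
  shows "\<exists>!p. p \<in> cell r \<and> p - x \<in> L"
proof (rule ex_ex1I)
  define N where "N = 2 * r + 1"
  have N: "real N \<noteq> 0" "0 < int N" and int_N: "int N = 2 * int r + 1" by (simp_all add: N_def)
  obtain m :: "'n \<Rightarrow> int" where m: "\<And>i. real N * (x \<bullet> b' i) = of_int (m i)"
    using x unfolding grid_def N_def[symmetric] Ints_def by (simp add: image_iff) metis
  then have xm: "x \<bullet> b' i = of_int (m i) / real N" for i using N by (simp add: field_simps)
  \<comment> \<open>The residue of \<open>m i\<close> in the symmetric interval from \<open>- r\<close> to \<open>r\<close>.\<close>
  define k where "k i = (m i + int r) mod int N - int r" for i
  define p where "p = (\<Sum>i\<in>UNIV. (of_int (k i) / real N) *\<^sub>R b i)"
  have "k \<in> int_box r"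
  proof (rule PiE_I)
    fix i show "k i \<in> {- int r..int r}"
      using pos_mod_bound[OF N(2), of "m i + int r"] pos_mod_sign[OF N(2), of "m i + int r"] int_N
      unfolding k_def by simp
  qed simp
  then have "p \<in> cell r" using bij_betw_cell[of r] unfolding p_def N_def by (blast dest: bij_betw_apply)
  moreover have "(p - x) \<bullet> b' i \<in> \<int>" for i
  proof -
    have "k i - m i = - (int N * ((m i + int r) div int N))"
      by (simp add: k_def minus_div_mult_eq_mod[symmetric] algebra_simps)
    then have "real_of_int (k i) - of_int (m i) = - (real N * of_int ((m i + int r) div int N))"
      by (metis of_int_diff of_int_minus of_int_mult of_int_of_nat_eq)
    then have "(p - x) \<bullet> b' i = of_int (- ((m i + int r) div int N))"
      using N by (simp add: p_def inner_diff_left inner_combination_dual xm field_simps)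
    then show ?thesis by (metis Ints_of_int)
  qed
  ultimately show "\<exists>p. p \<in> cell r \<and> p - x \<in> L" by (auto simp: mem_lattice_iff)
next
  fix p q assume pq: "p \<in> cell r \<and> p - x \<in> L" "q \<in> cell r \<and> q - x \<in> L"
  define N where "N = 2 * r + 1"
  have "p \<bullet> b' i = q \<bullet> b' i" for i
  proof -
    have "(p - x) - (q - x) \<in> L" using pq full_lattice_group(2)[OF full] by blast
    then obtain l where l: "p \<bullet> b' i - q \<bullet> b' i = of_int l"
      by (auto simp: mem_lattice_iff inner_diff_left elim: Ints_cases)
    have "\<bar>real N * (p \<bullet> b' i)\<bar> \<le> real r" "\<bar>real N * (q \<bullet> b' i)\<bar> \<le> real r"
      using pq by (auto simp: cell_def N_def)
    then have "\<bar>real N * (p \<bullet> b' i) - real N * (q \<bullet> b' i)\<bar> < real N" by (simp add: N_def)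
    then have "real N * \<bar>of_int l\<bar> < real N * 1"
      by (simp add: right_diff_distrib[symmetric] l abs_mult)
    then have "\<bar>real_of_int l\<bar> < 1" by (simp add: N_def)
    then have "l = 0" by linarith
    then show ?thesis using l by simp
  qed
  then show "p = q" using expand[of p] expand[of q] by simp
qed

end

context lattice_basis
begin

text \<open>The finite Fourier transform of the average of \<open>R\<close> over the translations of \<open>(1/N) L / L\<close>.\<close>

definition spectrum :: "nat \<Rightarrow> (real^'n \<Rightarrow> real^'n \<Rightarrow> real) \<Rightarrow> real^'n \<Rightarrow> real" where
  "spectrum r R u = (\<Sum>p\<in>cell r. \<Sum>q\<in>cell r. cos (2 * pi * (u \<bullet> (p - q))) * R p q) / (real (card (cell r)))\<^sup>2"

definition spectral_weight :: "nat \<Rightarrow> (real^'n \<Rightarrow> real^'n \<Rightarrow> real) \<Rightarrow> real^'n \<Rightarrow> real" where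
  "spectral_weight r R u = (if u \<in> freqs r \<and> u \<noteq> 0 then spectrum r R u else 0)"

lemma card_cell_pos: "0 < card (cell r)"
  by (simp add: card_cell)

lemma cell_subset_grid: "p \<in> cell r \<Longrightarrow> p \<in> grid (2 * r + 1)"
  by (simp add: cell_def)

context
  fixes R :: "real^'n \<Rightarrow> real^'n \<Rightarrow> real"
  assumes sym: "\<And>x y. R x y = R y x"
    and periodic: "\<And>x y v. v \<in> L \<Longrightarrow> R (x + v) y = R x y"
begin

lemma kernel_cong: "x' - x \<in> L \<Longrightarrow> y' - y \<in> L \<Longrightarrow> R x' y' = R x y"
  using periodic[of "x' - x" x y'] periodic[of "y' - y" y x] sym by (metis add_diff_cancel_left' diff_add_cancel add.commute)

text \<open>The condition selects the single representative of \<open>q + x\<close>, which need not be \<open>q + x\<close> itself;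
  periodicity of the kernel absorbs the difference.\<close>

lemma cell_kernel_sum:
  assumes x: "x \<in> grid (2 * r + 1)" and q: "q \<in> cell r"
  shows "(\<Sum>p\<in>cell r. if p - q - x \<in> L then R p q else 0) = R (q + x) q"
proof -
  obtain p0 where p0: "p0 \<in> cell r" "p0 - (q + x) \<in> L"
    and uniq: "\<And>p. p \<in> cell r \<Longrightarrow> p - (q + x) \<in> L \<Longrightarrow> p = p0"
    using cell_representative[OF grid_add[OF cell_subset_grid[OF q] x]] by blast
  have "(\<Sum>p\<in>cell r. if p - q - x \<in> L then R p q else 0) = (\<Sum>p\<in>cell r. if p = p0 then R p q else 0)"
  proof (rule sum.cong[OF refl])
    fix p assume "p \<in> cell r"
    then have "p - q - x \<in> L \<longleftrightarrow> p = p0" using uniq[of p] p0(2) by (auto simp: diff_diff_eq)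
    then show "(if p - q - x \<in> L then R p q else 0) = (if p = p0 then R p q else 0)" by simp
  qed
  also have "\<dots> = R p0 q" using p0(1) finite_cell by simp
  also have "\<dots> = R (q + x) q" using full_lattice_group(1)[OF full] p0(2) by (intro kernel_cong) auto
  finally show ?thesis .
qed

text \<open>Multiplying the two cosines into a sum makes the characters act on \<open>p - q - x\<close> and on \<open>q - p - x\<close>.
  By symmetry of \<open>R\<close> both halves contribute the same.\<close>

lemma spectrum_inversion:
  assumes x: "x \<in> grid (2 * r + 1)"
  shows "(\<Sum>u\<in>freqs r. spectrum r R u * cos (2 * pi * (u \<bullet> x))) = (\<Sum>q\<in>cell r. R (q + x) q) / card (cell r)"
proof -
  define c where "c = real (card (cell r))"
  have c: "c \<noteq> 0" using card_cell_pos[of r] by (simp add: c_def)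
  have prod: "cos (2 * pi * (u \<bullet> (p - q))) * cos (2 * pi * (u \<bullet> x))
      = (cos (2 * pi * (u \<bullet> (p - q - x))) + cos (2 * pi * (u \<bullet> (q - p - x)))) / 2" for u p q
  proof -
    have "cos (2 * pi * (u \<bullet> (q - p - x))) = cos (- (2 * pi * (u \<bullet> (q - p - x))))" by simp
    also have "- (2 * pi * (u \<bullet> (q - p - x))) = 2 * pi * (u \<bullet> (p - q)) + 2 * pi * (u \<bullet> x)"
      by (simp add: inner_diff_right algebra_simps)
    finally have 1: "cos (2 * pi * (u \<bullet> (q - p - x))) = cos (2 * pi * (u \<bullet> (p - q)) + 2 * pi * (u \<bullet> x))" .
    have "2 * pi * (u \<bullet> (p - q - x)) = 2 * pi * (u \<bullet> (p - q)) - 2 * pi * (u \<bullet> x)"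
      by (simp add: inner_diff_right algebra_simps)
    then show ?thesis unfolding 1 by (simp add: cos_add cos_diff)
  qed
  have char: "(\<Sum>u\<in>freqs r. cos (2 * pi * (u \<bullet> (p - q - x)))) = c * (if p - q - x \<in> L then 1 else 0)"
    if "p \<in> cell r" "q \<in> cell r" for p q
    using character_sum[OF grid_diff[OF grid_diff[OF that[THEN cell_subset_grid]] x]] by (simp add: c_def)
  have scaled: "c\<^sup>2 * spectrum r R u = (\<Sum>p\<in>cell r. \<Sum>q\<in>cell r. cos (2 * pi * (u \<bullet> (p - q))) * R p q)" for u
    using c by (simp add: spectrum_def c_def[symmetric])
  have "c\<^sup>2 * (\<Sum>u\<in>freqs r. spectrum r R u * cos (2 * pi * (u \<bullet> x)))
      = (\<Sum>u\<in>freqs r. (c\<^sup>2 * spectrum r R u) * cos (2 * pi * (u \<bullet> x)))"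
    by (simp only: sum_distrib_left mult.assoc)
  also have "\<dots> = (\<Sum>u\<in>freqs r. \<Sum>p\<in>cell r. \<Sum>q\<in>cell r. R p q * (cos (2 * pi * (u \<bullet> (p - q))) * cos (2 * pi * (u \<bullet> x))))"
    unfolding scaled sum_distrib_right by (intro sum.cong refl) (simp only: mult_ac)
  also have "\<dots> = (\<Sum>p\<in>cell r. \<Sum>q\<in>cell r. R p q *
      (\<Sum>u\<in>freqs r. (cos (2 * pi * (u \<bullet> (p - q - x))) + cos (2 * pi * (u \<bullet> (q - p - x)))) / 2))"
    unfolding prod sum_distrib_left
    by (rule trans[OF sum.swap], rule sum.cong[OF refl], rule sum.swap)
  also have "\<dots> = (\<Sum>p\<in>cell r. \<Sum>q\<in>cell r. (c / 2) * (if p - q - x \<in> L then R p q else 0)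
      + (c / 2) * (if q - p - x \<in> L then R q p else 0))"
  proof (intro sum.cong refl)
    fix p q assume pq: "p \<in> cell r" "q \<in> cell r"
    have "(\<Sum>u\<in>freqs r. (cos (2 * pi * (u \<bullet> (p - q - x))) + cos (2 * pi * (u \<bullet> (q - p - x)))) / 2)
        = (c * (if p - q - x \<in> L then 1 else 0) + c * (if q - p - x \<in> L then 1 else 0)) / 2"
      by (simp only: sum_divide_distrib[symmetric] sum.distrib char[OF pq] char[OF pq(2,1)])
    from this sym[of p q] show "R p q * (\<Sum>u\<in>freqs r. (cos (2 * pi * (u \<bullet> (p - q - x))) + cos (2 * pi * (u \<bullet> (q - p - x)))) / 2)
        = (c / 2) * (if p - q - x \<in> L then R p q else 0) + (c / 2) * (if q - p - x \<in> L then R q p else 0)"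
      by (simp only:) auto
  qed
  also have "\<dots> = (c / 2) * (\<Sum>p\<in>cell r. \<Sum>q\<in>cell r. if p - q - x \<in> L then R p q else 0)
      + (c / 2) * (\<Sum>p\<in>cell r. \<Sum>q\<in>cell r. if q - p - x \<in> L then R q p else 0)"
    by (simp add: sum.distrib sum_distrib_left)
  also have "(\<Sum>p\<in>cell r. \<Sum>q\<in>cell r. if p - q - x \<in> L then R p q else 0)
      = (\<Sum>p\<in>cell r. \<Sum>q\<in>cell r. if q - p - x \<in> L then R q p else 0)"
    by (rule sum.swap)
  also have "(\<Sum>p\<in>cell r. \<Sum>q\<in>cell r. if q - p - x \<in> L then R q p else 0) = (\<Sum>q\<in>cell r. R (q + x) q)"
    by (intro sum.cong refl cell_kernel_sum x)
  finally show ?thesis using c by (simp add: c_def[symmetric] field_simps power2_eq_square)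
qed

lemma cell_diagonal_shift:
  assumes x: "x \<in> grid (2 * r + 1)"
  shows "(\<Sum>q\<in>cell r. R (q + x) (q + x)) = (\<Sum>q\<in>cell r. R q q)"
proof -
  note grp = full_lattice_group[OF full]
  define red where "red y = (THE p. p \<in> cell r \<and> p - y \<in> L)" for y
  have red: "red y \<in> cell r" "red y - y \<in> L" if "y \<in> grid (2 * r + 1)" for y
    using theI'[OF cell_representative[OF that]] unfolding red_def by blast+
  have red_eq: "red y = p" if "y \<in> grid (2 * r + 1)" "p \<in> cell r" "p - y \<in> L" for y p
    using cell_representative[OF that(1)] red[OF that(1)] that(2,3) by blast
  show ?thesis
  proof (rule sum.reindex_bij_witness[of _ "\<lambda>p. red (p - x)" "\<lambda>q. red (q + x)"])
    fix q assume q: "q \<in> cell r"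
    then have g: "q + x \<in> grid (2 * r + 1)" "q - x \<in> grid (2 * r + 1)"
      using grid_add grid_diff cell_subset_grid x by blast+
    show "red (q + x) \<in> cell r" "red (q - x) \<in> cell r" using red g by blast+
    show "red (red (q + x) - x) = q"
    proof (rule red_eq[OF _ q])
      show "red (q + x) - x \<in> grid (2 * r + 1)"
        using red(1)[OF g(1)] grid_diff cell_subset_grid x by blast
      show "q - (red (q + x) - x) \<in> L"
        using grp(3)[OF red(2)[OF g(1)]] by (simp add: algebra_simps)
    qed
    show "red (red (q - x) + x) = q"
    proof (rule red_eq[OF _ q])
      show "red (q - x) + x \<in> grid (2 * r + 1)"
        using red(1)[OF g(2)] grid_add cell_subset_grid x by blast
      show "q - (red (q - x) + x) \<in> L"
        using grp(3)[OF red(2)[OF g(2)]] by (simp add: algebra_simps)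
    qed
    show "R (red (q + x)) (red (q + x)) = R (q + x) (q + x)"
      using red(2)[OF g(1)] by (intro kernel_cong)
  qed
qed

text \<open>If \<open>R\<close> is the Gram kernel of an embedding, the right-hand side is the average over \<open>q\<close> of the squared distance between
  the images of \<open>q + x\<close> and \<open>q\<close>.\<close>

lemma spectral_energy:
  assumes x: "x \<in> grid (2 * r + 1)"
  shows "energy (spectral_weight r R) x
    = (\<Sum>q\<in>cell r. R (q + x) (q + x) + R q q - 2 * R (q + x) q) / card (cell r)"
proof -
  have "freqs r \<subseteq> D" by (auto simp: freqs_def)
  then have "(\<Sum>\<^sub>\<infinity>u\<in>D. spectral_weight r R u * (1 - cos (2 * pi * (u \<bullet> x))))
      = (\<Sum>\<^sub>\<infinity>u\<in>freqs r. spectrum r R u * (1 - cos (2 * pi * (u \<bullet> x))))"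
    by (intro infsum_cong_neutral) (auto simp: spectral_weight_def)
  then have "energy (spectral_weight r R) x = 2 * (\<Sum>u\<in>freqs r. spectrum r R u * (1 - cos (2 * pi * (u \<bullet> x))))"
    using finite_freqs by (simp add: energy_def)
  also have "\<dots> = 2 * ((\<Sum>u\<in>freqs r. spectrum r R u * cos (2 * pi * (u \<bullet> 0)))
      - (\<Sum>u\<in>freqs r. spectrum r R u * cos (2 * pi * (u \<bullet> x))))"
    by (simp add: right_diff_distrib sum_subtractf)
  also have "\<dots> = 2 * ((\<Sum>q\<in>cell r. R (q + 0) q) / card (cell r) - (\<Sum>q\<in>cell r. R (q + x) q) / card (cell r))"
    using spectrum_inversion[OF x] spectrum_inversion[of 0 r] by (simp add: grid_def)
  also have "\<dots> = (\<Sum>q\<in>cell r. R (q + x) (q + x) + R q q - 2 * R (q + x) q) / card (cell r)"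
    by (simp add: sum.distrib sum_subtractf cell_diagonal_shift[OF x] sum_distrib_left[symmetric]
        diff_divide_distrib[symmetric])
  finally show ?thesis .
qed

context
  fixes C :: real
  assumes psd: "\<And>c J. finite J \<Longrightarrow> 0 \<le> (\<Sum>p\<in>J. \<Sum>q\<in>J. c p * c q * R p q)"
    and lower: "\<And>x y. (infdist (x - y) L)\<^sup>2 \<le> R x x + R y y - 2 * R x y"
    and upper: "\<And>x y. R x x + R y y - 2 * R x y \<le> C * (infdist (x - y) L)\<^sup>2"
begin

lemma spectrum_nonneg: "0 \<le> spectrum r R u"
proof -
  have "(\<Sum>p\<in>cell r. \<Sum>q\<in>cell r. cos (2 * pi * (u \<bullet> (p - q))) * R p q)
      = (\<Sum>p\<in>cell r. \<Sum>q\<in>cell r. cos (2 * pi * (u \<bullet> p)) * cos (2 * pi * (u \<bullet> q)) * R p q)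
      + (\<Sum>p\<in>cell r. \<Sum>q\<in>cell r. sin (2 * pi * (u \<bullet> p)) * sin (2 * pi * (u \<bullet> q)) * R p q)"
    by (simp add: inner_diff_right right_diff_distrib cos_diff distrib_right sum.distrib)
  also have "\<dots> \<ge> 0" by (intro add_nonneg_nonneg psd finite_cell)
  finally show ?thesis by (simp add: spectrum_def)
qed

lemma spectrum_minus: "spectrum r R (- u) = spectrum r R u"
  by (simp add: spectrum_def)

lemma spectral_energy_bounds:
  assumes x: "x \<in> grid (2 * r + 1)"
  shows "(infdist x L)\<^sup>2 \<le> energy (spectral_weight r R) x"
    and "energy (spectral_weight r R) x \<le> C * (infdist x L)\<^sup>2"
proof -
  have c: "0 < real (card (cell r))" using card_cell_pos by simp
  have "(\<Sum>q\<in>cell r. (infdist x L)\<^sup>2) \<le> (\<Sum>q\<in>cell r. R (q + x) (q + x) + R q q - 2 * R (q + x) q)"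
    using lower[of "_ + x"] by (intro sum_mono) (metis add_diff_cancel_left')
  then show "(infdist x L)\<^sup>2 \<le> energy (spectral_weight r R) x"
    using c by (simp add: spectral_energy[OF x] pos_le_divide_eq mult.commute)
  have "(\<Sum>q\<in>cell r. R (q + x) (q + x) + R q q - 2 * R (q + x) q) \<le> (\<Sum>q\<in>cell r. C * (infdist x L)\<^sup>2)"
    using upper[of "_ + x"] by (intro sum_mono) (metis add_diff_cancel_left')
  then show "energy (spectral_weight r R) x \<le> C * (infdist x L)\<^sup>2"
    using c by (simp add: spectral_energy[OF x] pos_divide_le_eq mult.commute)
qed

text \<open>Both distance bounds hold at a point of positive distance from the lattice, such as half a basis vector.\<close>

lemma kernel_constant_nonneg: "0 \<le> C"
proof -
  define x where "x = (1 / 2) *\<^sub>R b undefined"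
  have "x \<notin> L" unfolding x_def by (rule half_basis_vector_notin)
  then have "0 < (infdist x L)\<^sup>2" using infdist_eq_0_iff[of x] by auto
  moreover have "(infdist x L)\<^sup>2 \<le> C * (infdist x L)\<^sup>2" using lower[of x 0] upper[of x 0] by simp
  ultimately have "0 \<le> C * (infdist x L)\<^sup>2" by linarith
  then show ?thesis using \<open>0 < (infdist x L)\<^sup>2\<close> by (simp add: zero_le_mult_iff)
qed

definition frequency_moment_bound :: real where
  "frequency_moment_bound = (\<Sum>i\<in>UNIV. C * (norm (b i))\<^sup>2 / 16) * (\<Sum>i\<in>UNIV. (norm (b' i))\<^sup>2)"

text \<open>Evaluate the energy at \<open>x = (1/N) b i\<close>. All frequencies satisfy \<open>\<bar>u \<bullet> x\<bar> \<le> 1/2\<close>, so Jordan's inequality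
  bounds the energy from below by \<open>16 / N\<^sup>2\<close> times the moment of the i-th coordinate, while the upper bound \<open>C * (norm x)\<^sup>2\<close> also
  carries the factor \<open>1 / N\<^sup>2\<close>. The factors cancel, and the bound does not depend on \<open>r\<close>.\<close>

lemma spectral_weight_in_weights: "spectral_weight r R \<in> weights D frequency_moment_bound"
proof -
  define N where "N = real (2 * r + 1)"
  have N: "0 < N" by (simp add: N_def)
  have fD: "freqs r \<subseteq> D" by (auto simp: freqs_def)
  have nn: "0 \<le> spectral_weight r R u" for u by (simp add: spectral_weight_def spectrum_nonneg)
  have freqs_minus: "- u \<in> freqs r \<longleftrightarrow> u \<in> freqs r" for u
    using dual_group(2)[of u] dual_group(2)[of "- u"] by (auto simp: freqs_def)
  have coord: "(\<Sum>u\<in>freqs r. spectral_weight r R u * (u \<bullet> b i)\<^sup>2) \<le> C * (norm (b i))\<^sup>2 / 16" for i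
  proof -
    define x where "x = (1 / N) *\<^sub>R b i"
    have x: "x \<in> grid (2 * r + 1)" using N by (auto simp: grid_def x_def N_def biorthogonal)
    have "16 / N\<^sup>2 * (\<Sum>u\<in>freqs r. spectral_weight r R u * (u \<bullet> b i)\<^sup>2)
        = (\<Sum>u\<in>freqs r. spectral_weight r R u * (2 * (8 * (u \<bullet> x)\<^sup>2)))"
      by (simp add: sum_distrib_left x_def power_divide mult_ac)
    also have "\<dots> \<le> (\<Sum>u\<in>freqs r. spectral_weight r R u * (2 * (1 - cos (2 * pi * (u \<bullet> x)))))"
    proof (intro sum_mono mult_left_mono nn one_minus_cos_ge)
      fix u assume "u \<in> freqs r"
      then have "\<bar>u \<bullet> b i\<bar> \<le> N / 2" by (auto simp: freqs_def N_def dest: spec[of _ i])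
      then show "\<bar>u \<bullet> x\<bar> \<le> 1 / 2" using N by (simp add: x_def abs_mult field_simps)
    qed auto
    also have "\<dots> = energy (spectral_weight r R) x"
    proof -
      have "energy (spectral_weight r R) x
          = 2 * (\<Sum>u\<in>freqs r. spectral_weight r R u * (1 - cos (2 * pi * (u \<bullet> x))))"
        by (rule energy_eq_sum[OF finite_freqs fD]) (simp add: spectral_weight_def)
      then show ?thesis unfolding sum_distrib_left by (simp only: mult.left_commute)
    qed
    also have "\<dots> \<le> C * (infdist x L)\<^sup>2" by (rule spectral_energy_bounds(2)[OF x])
    also have "\<dots> \<le> C * (norm x)\<^sup>2"
      using infdist_le[of 0 L x] full_lattice_group(1)[OF full] kernel_constant_nonneg
      by (intro mult_left_mono power_mono infdist_nonneg) auto
    also have "\<dots> = 16 / N\<^sup>2 * (C * (norm (b i))\<^sup>2 / 16)" using N by (simp add: x_def power_divide)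
    finally show ?thesis using N by (subst (asm) mult_le_cancel_left_pos) auto
  qed
  have "(\<Sum>u\<in>F. spectral_weight r R u * (norm u)\<^sup>2) \<le> frequency_moment_bound" if F: "finite F" "F \<subseteq> D" for F
  proof -
    define B where "B = (\<Sum>i\<in>UNIV. (norm (b' i))\<^sup>2)"
    have B: "0 \<le> B" by (simp add: B_def sum_nonneg)
    have "(\<Sum>u\<in>F. spectral_weight r R u * (norm u)\<^sup>2) = (\<Sum>u\<in>F \<inter> freqs r. spectral_weight r R u * (norm u)\<^sup>2)"
      using F by (intro sum.mono_neutral_right) (auto simp: spectral_weight_def)
    also have "\<dots> \<le> (\<Sum>u\<in>freqs r. spectral_weight r R u * (norm u)\<^sup>2)"
      using nn finite_freqs by (intro sum_mono2) auto
    also have "\<dots> \<le> (\<Sum>u\<in>freqs r. spectral_weight r R u * ((\<Sum>i\<in>UNIV. (u \<bullet> b i)\<^sup>2) * B))"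
      unfolding B_def by (intro sum_mono mult_left_mono norm_sq_le_dual_coordinates nn)
    also have "\<dots> = (\<Sum>u\<in>freqs r. \<Sum>i\<in>UNIV. spectral_weight r R u * (u \<bullet> b i)\<^sup>2) * B"
      by (simp add: sum_distrib_left sum_distrib_right mult.assoc)
    also have "\<dots> = (\<Sum>i\<in>UNIV. \<Sum>u\<in>freqs r. spectral_weight r R u * (u \<bullet> b i)\<^sup>2) * B"
      by (subst sum.swap) (rule refl)
    also have "\<dots> \<le> frequency_moment_bound"
      unfolding frequency_moment_bound_def B_def[symmetric] by (intro mult_right_mono sum_mono coord B)
    finally show ?thesis .
  qed
  then show ?thesis
    using nn fD by (auto simp: weights_def) (auto simp: spectral_weight_def freqs_minus spectrum_minus)
qed

text \<open>The grids \<open>(1 / 3 ^ k) L\<close> are nested, so the weights obtained from a large grid satisfy the conditions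
  of all smaller ones. Compactness gives a weight for all grids together. Powers of \<open>3\<close> are
  used because the orders have to be odd.\<close>

lemma ex_invariant_weight:
  "\<exists>z\<in>weights D frequency_moment_bound. \<forall>k. \<forall>x\<in>grid (3 ^ k).
     (infdist x L)\<^sup>2 \<le> energy z x \<and> energy z x \<le> C * (norm x)\<^sup>2"
proof -
  define K where "K = frequency_moment_bound"
  define S where "S k = {z\<in>weights D K. \<forall>x\<in>grid (3 ^ k).
      (infdist x L)\<^sup>2 \<le> energy z x \<and> energy z x \<le> C * (norm x)\<^sup>2}" for k :: nat
  have grid_mono: "grid (3 ^ k) \<subseteq> grid (3 ^ l)" if "k \<le> l" for k l
  proof
    fix x assume x: "x \<in> grid (3 ^ k)"
    have "real (3 ^ l) = real (3 ^ (l - k)) * real (3 ^ k)" using that by (simp flip: power_add)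
    then have "real (3 ^ l) * (x \<bullet> b' i) = real (3 ^ (l - k)) * (real (3 ^ k) * (x \<bullet> b' i))" for i
      by (simp only: mult.assoc)
    moreover have "real (3 ^ (l - k)) * (real (3 ^ k) * (x \<bullet> b' i)) \<in> \<int>" for i
      using x unfolding grid_def by (blast intro: Ints_mult[OF Ints_of_nat])
    ultimately show "x \<in> grid (3 ^ l)" unfolding grid_def by (simp only: mem_Collect_eq) blast
  qed
  have "weights D K \<inter> (\<Inter>k\<in>UNIV. S k) \<noteq> {}"
  proof (rule compact_imp_fip_image[OF compact_weights])
    fix k
    have "S k = weights D K \<inter> (\<Inter>x\<in>grid (3 ^ k). {z\<in>weights D K. (infdist x L)\<^sup>2 \<le> energy z x} \<inter>
        {z\<in>weights D K. energy z x \<le> C * (norm x)\<^sup>2})"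
      by (auto simp: S_def)
    moreover have "closed \<dots>"
      by (intro closed_Int closed_INT ballI continuous_on_closed_Collect_le continuous_on_const
          energy_continuous_left closed_weights)
    ultimately show "closed (S k)" by simp
  next
    fix I :: "nat set" assume I: "finite I"
    obtain l where l: "\<And>k. k \<in> I \<Longrightarrow> k \<le> l" using I by (meson finite_nat_set_iff_bounded_le)
    define r where "r = ((3 ^ l - 1) div 2 :: nat)"
    have "odd (3 ^ l :: nat)" by simp
    then have r: "2 * r + 1 = 3 ^ l" unfolding r_def by presburger
    define z where "z = spectral_weight r R"
    have z: "z \<in> weights D K" unfolding z_def K_def by (rule spectral_weight_in_weights)
    have "z \<in> S k" if "k \<in> I" for k
    proof -
      have "(infdist x L)\<^sup>2 \<le> energy z x \<and> energy z x \<le> C * (norm x)\<^sup>2" if "x \<in> grid (3 ^ k)" for x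
      proof -
        have x: "x \<in> grid (2 * r + 1)" using that grid_mono[OF l[OF \<open>k \<in> I\<close>]] r by auto
        have "C * (infdist x L)\<^sup>2 \<le> C * (norm x)\<^sup>2"
          using infdist_le[of 0 L x] full_lattice_group(1)[OF full] kernel_constant_nonneg
          by (intro mult_left_mono power_mono infdist_nonneg) auto
        then show ?thesis using spectral_energy_bounds[OF x] by (auto simp: z_def)
      qed
      then show ?thesis using z by (simp add: S_def)
    qed
    then show "weights D K \<inter> (\<Inter>k\<in>I. S k) \<noteq> {}" using z by blast
  qed
  then show ?thesis by (auto simp: S_def K_def)
qed

lemma grid_approximation:
  obtains s where "\<And>k. s k \<in> grid (3 ^ k)" "s \<longlonglongrightarrow> x"
proof
  define s where "s k = (\<Sum>i\<in>UNIV. (of_int \<lfloor>3 ^ k * (x \<bullet> b' i)\<rfloor> / 3 ^ k) *\<^sub>R b i)" for k :: nat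
  show "s k \<in> grid (3 ^ k)" for k by (simp add: grid_def s_def inner_combination_dual)
  have "(\<lambda>k. of_int \<lfloor>3 ^ k * t\<rfloor> / 3 ^ k) \<longlonglongrightarrow> t" for t :: real
  proof (rule LIMSEQ_I)
    fix e :: real assume "0 < e"
    then obtain n where n: "(1 / 3) ^ n < e" using real_arch_pow_inv[of e "1 / 3"] by auto
    have "\<bar>of_int \<lfloor>3 ^ k * t\<rfloor> / 3 ^ k - t\<bar> < e" if "n \<le> k" for k
    proof -
      have "\<bar>of_int \<lfloor>3 ^ k * t\<rfloor> - 3 ^ k * t\<bar> \<le> 1" by linarith
      then have "\<bar>of_int \<lfloor>3 ^ k * t\<rfloor> - 3 ^ k * t\<bar> / 3 ^ k \<le> 1 / 3 ^ k" by (rule divide_right_mono) simp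
      moreover have "of_int \<lfloor>3 ^ k * t\<rfloor> / 3 ^ k - t = (of_int \<lfloor>3 ^ k * t\<rfloor> - 3 ^ k * t) / 3 ^ k"
        by (simp add: diff_divide_distrib)
      moreover have "(1 / 3 :: real) ^ k \<le> (1 / 3) ^ n" using that by (intro power_decreasing) auto
      ultimately show ?thesis using n by (simp add: power_divide abs_divide)
    qed
    then show "\<exists>n. \<forall>k\<ge>n. norm (of_int \<lfloor>3 ^ k * t\<rfloor> / 3 ^ k - t) < e" by auto
  qed
  then have "s \<longlonglongrightarrow> (\<Sum>i\<in>UNIV. (x \<bullet> b' i) *\<^sub>R b i)" unfolding s_def by (intro tendsto_intros)
  then show "s \<longlonglongrightarrow> x" by (simp only: expand[symmetric])
qed

text \<open>Both bounds pass from the dense union of the grids to the whole space by continuity of the energy. The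
  quadratic form is recovered as the limit of \<open>energy z (e x) / e\<^sup>2\<close> as \<open>e\<close> tends to \<open>0\<close>, taken in finite partial
  sums only.\<close>

lemma kernel_imp_certificate: "\<exists>z. certificate C z"
proof -
  obtain z where z: "z \<in> weights D frequency_moment_bound"
    and grid: "\<And>k x. x \<in> grid (3 ^ k) \<Longrightarrow> (infdist x L)\<^sup>2 \<le> energy z x \<and> energy z x \<le> C * (norm x)\<^sup>2"
    using ex_invariant_weight by blast
  have bounds: "(infdist x L)\<^sup>2 \<le> energy z x" "energy z x \<le> C * (norm x)\<^sup>2" for x
  proof -
    obtain s where s: "\<And>k. s k \<in> grid (3 ^ k)" "s \<longlonglongrightarrow> x" by (rule grid_approximation) blast
    have en: "(\<lambda>k. energy z (s k)) \<longlonglongrightarrow> energy z x"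
      using continuous_on_tendsto_compose[OF energy_continuous_right[OF z] s(2)] by simp
    have "(\<lambda>k. (infdist (s k) L)\<^sup>2) \<longlonglongrightarrow> (infdist x L)\<^sup>2" by (intro tendsto_intros s(2))
    then show "(infdist x L)\<^sup>2 \<le> energy z x"
      by (rule LIMSEQ_le[OF _ en]) (use grid s(1) in blast)
    have "(\<lambda>k. C * (norm (s k))\<^sup>2) \<longlonglongrightarrow> C * (norm x)\<^sup>2" by (intro tendsto_intros s(2))
    then show "energy z x \<le> C * (norm x)\<^sup>2"
      by (rule LIMSEQ_le[OF en]) (use grid s(1) in blast)
  qed
  have nn: "0 \<le> z u" for u using z by (simp add: weights_def)
  have moment: "4 * pi\<^sup>2 * (\<Sum>u\<in>F. z u * (u \<bullet> x)\<^sup>2) \<le> C * (norm x)\<^sup>2" if F: "finite F" "F \<subseteq> D" for F x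
  proof -
    \<comment> \<open>A partial sum of \<open>energy z (e x) / e\<^sup>2\<close>, written with half angles.\<close>
    define g where "g e = (\<Sum>u\<in>F. z u * (4 * (sin (pi * (u \<bullet> x) * e) / e)\<^sup>2))" for e :: real
    have "g e \<le> C * (norm x)\<^sup>2" if e: "e \<noteq> 0" for e
    proof -
      have "e\<^sup>2 * g e = (\<Sum>u\<in>F. z u * (4 * (sin (pi * (u \<bullet> x) * e))\<^sup>2))"
        using e by (simp add: g_def sum_distrib_left power_divide)
      also have "\<dots> = 2 * (\<Sum>u\<in>F. z u * (1 - cos (2 * pi * (u \<bullet> (e *\<^sub>R x)))))"
      proof -
        have "1 - cos (2 * pi * (u \<bullet> (e *\<^sub>R x))) = 2 * (sin (pi * (u \<bullet> x) * e))\<^sup>2" for u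
          using cos_double_sin[of "pi * (u \<bullet> x) * e"] by (simp add: mult_ac)
        then show ?thesis by (simp add: sum_distrib_left mult.left_commute)
      qed
      also have "\<dots> \<le> energy z (e *\<^sub>R x)"
        unfolding energy_def
        by (intro mult_left_mono finite_sum_le_infsum energy_summable[OF z] F) (use nn in auto)
      also have "\<dots> \<le> e\<^sup>2 * (C * (norm x)\<^sup>2)" using bounds(2)[of "e *\<^sub>R x"] by (simp add: power_mult_distrib mult_ac)
      finally show ?thesis using e by (subst (asm) mult_le_cancel_left_pos) auto
    qed
    then have "\<forall>\<^sub>F e in at 0. g e \<le> C * (norm x)\<^sup>2" by (auto simp: eventually_at_filter)
    moreover have "(g \<longlongrightarrow> (\<Sum>u\<in>F. z u * (4 * (pi * (u \<bullet> x))\<^sup>2))) (at 0)"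
    proof -
      have "((\<lambda>e. sin (a * e) / e) \<longlongrightarrow> a) (at 0)" for a :: real
      proof -
        have "((\<lambda>e. sin (a * e)) has_real_derivative a) (at 0)"
          by (auto intro!: derivative_eq_intros)
        then show ?thesis by (simp add: has_field_derivative_iff)
      qed
      then show ?thesis unfolding g_def by (intro tendsto_intros)
    qed
    ultimately have "(\<Sum>u\<in>F. z u * (4 * (pi * (u \<bullet> x))\<^sup>2)) \<le> C * (norm x)\<^sup>2"
      by (intro tendsto_upperbound) auto
    then show ?thesis by (simp add: sum_distrib_left power_mult_distrib mult_ac)
  qed
  have "(norm x)\<^sup>2 \<le> energy z x" if "x \<in> voronoi_cell L" for x
    using bounds(1)[of x] infdist_voronoi[OF that] by simp
  then have "certificate C z" using z moment by (auto simp: certificate_def weights_def)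
  then show ?thesis by blast
qed

end

end

end

section \<open>From embeddings to certificates\<close>

context hilbert_space
begin

text \<open>The double sum is the squared norm of the combination of the \<open>f p\<close> with coefficients \<open>c p\<close>. The
  combination is described by its inner products, which avoids sums in the carrier.\<close>

lemma real_gram_nonneg:
  fixes c :: "'b \<Rightarrow> real"
  assumes J: "finite J" and f: "\<And>p. f p \<in> carrier H"
  shows "0 \<le> (\<Sum>p\<in>J. \<Sum>q\<in>J. c p * c q * Re (ip H (f p) (f q)))"
proof -
  have "\<exists>v\<in>carrier H. \<forall>y\<in>carrier H. ip H v y = (\<Sum>p\<in>J. of_real (c p) * ip H (f p) y)"
    using J
  proof (induction J rule: finite_induct)
    case empty
    show ?case by (intro bexI[of _ "\<zero>"]) auto
  next
    case (insert a A)
    then obtain v where v: "v \<in> carrier H" "\<forall>y\<in>carrier H. ip H v y = (\<Sum>p\<in>A. of_real (c p) * ip H (f p) y)"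
      by blast
    then show ?case using insert.hyps f
      by (intro bexI[of _ "(of_real (c a) \<odot> f a) \<oplus> v"]) (auto simp: ip_add_left ip_smult_left)
  qed
  then obtain v where v: "v \<in> carrier H"
    and ip_v: "\<And>y. y \<in> carrier H \<Longrightarrow> ip H v y = (\<Sum>p\<in>J. of_real (c p) * ip H (f p) y)" by blast
  have "Re (ip H (f p) v) = (\<Sum>q\<in>J. c q * Re (ip H (f p) (f q)))" for p
  proof -
    have "Re (ip H (f p) v) = Re (ip H v (f p))" using ip_commute[OF v f] by simp
    also have "\<dots> = (\<Sum>q\<in>J. c q * Re (ip H (f q) (f p)))" by (simp add: ip_v f)
    also have "\<dots> = (\<Sum>q\<in>J. c q * Re (ip H (f p) (f q)))"
    proof (rule sum.cong[OF refl])
      fix q show "c q * Re (ip H (f q) (f p)) = c q * Re (ip H (f p) (f q))"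
        using ip_commute[OF f f, of p q] by simp
    qed
    finally show ?thesis .
  qed
  then have "(\<Sum>p\<in>J. \<Sum>q\<in>J. c p * c q * Re (ip H (f p) (f q))) = Re (ip H v v)"
    by (simp add: ip_v[OF v] mult.assoc sum_distrib_left[symmetric])
  then show ?thesis using ip_self_nonneg[OF v] by simp
qed

lemma hdist_sq:
  assumes "x \<in> carrier H" "y \<in> carrier H"
  shows "(hdist H x y)\<^sup>2 = Re (ip H x x) + Re (ip H y y) - 2 * Re (ip H x y)"
proof -
  have "(hdist H x y)\<^sup>2 = Re (ip H (x \<ominus> y) (x \<ominus> y))"
    using assms by (simp add: hdist_def hnorm_def ip_self_nonneg)
  also have "\<dots> = Re (ip H x x) + Re (ip H y y) - 2 * Re (ip H x y)"
    using assms ip_commute[of x y] by (simp add: ip_diff_left ip_diff_right)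
  finally show ?thesis .
qed

lemma hdist_nonneg: "x \<in> carrier H \<Longrightarrow> y \<in> carrier H \<Longrightarrow> 0 \<le> hdist H x y"
  by (simp add: hdist_def hnorm_def ip_self_nonneg)

lemma hdist_pos: "x \<in> carrier H \<Longrightarrow> y \<in> carrier H \<Longrightarrow> x \<noteq> y \<Longrightarrow> 0 < hdist H x y"
proof -
  assume xy: "x \<in> carrier H" "y \<in> carrier H" "x \<noteq> y"
  have "x \<ominus> y \<noteq> \<zero>"
  proof
    assume "x \<ominus> y = \<zero>"
    then have "(x \<ominus> y) \<oplus> y = y" using xy by simp
    then show False using xy by (simp add: a_minus_def M.a_assoc M.l_neg)
  qed
  then show ?thesis using xy ip_pos[of "x \<ominus> y"] by (simp add: hdist_def hnorm_def)
qed

end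

context lattice_basis
begin

lemma distinct_pairs_nonempty: "distinct_pairs L \<noteq> {}"
proof -
  define x where "x = (1 / 2) *\<^sub>R b undefined"
  have "x \<notin> L" unfolding x_def by (rule half_basis_vector_notin)
  then have "cls x \<noteq> cls 0" by (simp add: cls_eq_iff)
  then have "(cls x, cls 0) \<in> distinct_pairs L" by (simp add: distinct_pairs_def flat_torus_eq)
  then show ?thesis by blast
qed

text \<open>Let \<open>A\<close> and \<open>B\<close> be the two Lipschitz constants. The real part of the Gram kernel, scaled by \<open>B\<^sup>2\<close>, has
  squared distances between the square of the torus distance and \<open>(A * B)\<^sup>2\<close> times this square.\<close>

lemma embedding_imp_certificate:
  fixes H :: "'a hilbert"
  assumes emb: "euclidean_embedding L H \<phi>" and E: "distortion L H \<phi> = ennreal E" "0 \<le> E"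
  shows "\<exists>z. certificate (E\<^sup>2) z"
proof -
  interpret hilbert_space H using emb by (simp add: euclidean_embedding_def)
  define f where "f x = \<phi> (cls x)" for x
  have f: "f x \<in> carrier H" for x using emb by (auto simp: f_def euclidean_embedding_def flat_torus_eq)
  have dist_pos: "0 < infdist (x - y) L" if "cls x \<noteq> cls y" for x y
    using that infdist_nonneg[of "x - y" L] infdist_eq_0_iff[of "x - y"] by (simp add: cls_eq_iff)
  have f_pos: "0 < hdist H (f x) (f y)" if "cls x \<noteq> cls y" for x y
  proof (rule hdist_pos[OF f f])
    show "f x \<noteq> f y" using emb that unfolding euclidean_embedding_def f_def inj_on_def flat_torus_eq by blast
  qed
  define \<alpha> where "\<alpha> = (SUP (X, Y)\<in>distinct_pairs L. ennreal (hdist H (\<phi> X) (\<phi> Y) / torus_dist L X Y))"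
  define \<beta> where "\<beta> = (SUP (X, Y)\<in>distinct_pairs L. ennreal (torus_dist L X Y / hdist H (\<phi> X) (\<phi> Y)))"
  have \<alpha>\<beta>: "\<alpha> * \<beta> = ennreal E" using E(1) by (simp add: distortion_def \<alpha>_def \<beta>_def)
  have pair: "(cls x, cls y) \<in> distinct_pairs L" if "cls x \<noteq> cls y" for x y
    using that by (simp add: distinct_pairs_def flat_torus_eq)
  have \<alpha>_ge: "ennreal (hdist H (f x) (f y) / infdist (x - y) L) \<le> \<alpha>" if "cls x \<noteq> cls y" for x y
    unfolding \<alpha>_def by (rule SUP_upper2[OF pair[OF that]]) (simp add: f_def torus_dist_cls)
  have \<beta>_ge: "ennreal (infdist (x - y) L / hdist H (f x) (f y)) \<le> \<beta>" if "cls x \<noteq> cls y" for x y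
    unfolding \<beta>_def by (rule SUP_upper2[OF pair[OF that]]) (simp add: f_def torus_dist_cls)
  obtain x0 y0 where x0: "cls x0 \<noteq> cls y0"
    using distinct_pairs_nonempty by (auto simp: distinct_pairs_def flat_torus_eq)
  \<comment> \<open>Neither factor vanishes, so neither can be infinite when the product is finite.\<close>
  have "\<alpha> \<noteq> 0" "\<beta> \<noteq> 0"
    using \<alpha>_ge[OF x0] \<beta>_ge[OF x0] divide_pos_pos[OF f_pos[OF x0] dist_pos[OF x0]]
      divide_pos_pos[OF dist_pos[OF x0] f_pos[OF x0]] by auto
  then have "\<alpha> \<noteq> \<infinity>" "\<beta> \<noteq> \<infinity>"
    using \<alpha>\<beta> by (auto simp: ennreal_mult_top ennreal_top_mult)
  then obtain A B where A: "\<alpha> = ennreal A" "0 \<le> A" and B: "\<beta> = ennreal B" "0 \<le> B"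
    unfolding infinity_ennreal_def by (metis ennreal_cases)
  have AB: "A * B = E" using \<alpha>\<beta> A B E(2) by (simp add: ennreal_mult[symmetric])
  have diag: "hdist H (f x) (f y) = 0" "infdist (x - y) L = 0" if "cls x = cls y" for x y
  proof -
    have "f x = f y" using that by (simp add: f_def)
    then have "(hdist H (f x) (f y))\<^sup>2 = 0" using hdist_sq[OF f f, of y y] by simp
    then show "hdist H (f x) (f y) = 0" by simp
    show "infdist (x - y) L = 0" using that by (simp add: cls_eq_iff infdist_eq_0_iff)
  qed
  have up: "hdist H (f x) (f y) \<le> A * infdist (x - y) L" for x y
  proof (cases "cls x = cls y")
    case False
    then have "hdist H (f x) (f y) / infdist (x - y) L \<le> A"
      using \<alpha>_ge[OF False] A by (simp add: ennreal_le_iff)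
    then show ?thesis using dist_pos[OF False] by (simp add: pos_divide_le_eq)
  qed (simp add: diag)
  have lo: "infdist (x - y) L \<le> B * hdist H (f x) (f y)" for x y
  proof (cases "cls x = cls y")
    case False
    then have "infdist (x - y) L / hdist H (f x) (f y) \<le> B"
      using \<beta>_ge[OF False] B by (simp add: ennreal_le_iff)
    then show ?thesis using f_pos[OF False] by (simp add: pos_divide_le_eq)
  qed (simp add: diag)
  define R where "R x y = B\<^sup>2 * Re (ip H (f x) (f y))" for x y
  have R_dist: "R x x + R y y - 2 * R x y = (B * hdist H (f x) (f y))\<^sup>2" for x y
    by (simp add: R_def power_mult_distrib hdist_sq[OF f f] algebra_simps)
  show ?thesis
  proof (rule kernel_imp_certificate[of R])
    show "R x y = R y x" for x y using ip_commute[OF f f, of x y] by (simp add: R_def)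
    show "R (x + v) y = R x y" if "v \<in> L" for x y v
    proof -
      have "cls (x + v) = cls x" using that by (simp add: cls_eq_iff)
      then show ?thesis by (simp add: R_def f_def)
    qed
    show "0 \<le> (\<Sum>p\<in>J. \<Sum>q\<in>J. c p * c q * R p q)" if "finite J" for c J
    proof -
      have "(\<Sum>p\<in>J. \<Sum>q\<in>J. c p * c q * R p q) = (\<Sum>p\<in>J. \<Sum>q\<in>J. (B * c p) * (B * c q) * Re (ip H (f p) (f q)))"
        by (intro sum.cong refl) (simp add: R_def power2_eq_square)
      then show ?thesis using real_gram_nonneg[OF that f, of "\<lambda>p. B * c p"] by simp
    qed
    show "(infdist (x - y) L)\<^sup>2 \<le> R x x + R y y - 2 * R x y" for x y
      unfolding R_dist by (intro power_mono lo infdist_nonneg)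
    show "R x x + R y y - 2 * R x y \<le> E\<^sup>2 * (infdist (x - y) L)\<^sup>2" for x y
    proof -
      have "B * hdist H (f x) (f y) \<le> B * (A * infdist (x - y) L)" by (intro mult_left_mono up B)
      also have "\<dots> = E * infdist (x - y) L" by (simp add: AB[symmetric])
      finally have "(B * hdist H (f x) (f y))\<^sup>2 \<le> (E * infdist (x - y) L)\<^sup>2"
        using B f hdist_nonneg by (intro power_mono) auto
      then show ?thesis by (simp add: R_dist power_mult_distrib)
    qed
  qed
qed

lemma support_meets_coset_in_pair:
  assumes z: "certificate C z"
    and max: "\<And>z'. certificate C z' \<Longrightarrow> infsum z' D \<le> infsum z D"
    and v: "v \<in> D"
  shows "program_supp L z \<inter> (\<lambda>w. v + 2 *\<^sub>R w) ` D = {} \<or>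
    (\<exists>u. program_supp L z \<inter> (\<lambda>w. v + 2 *\<^sub>R w) ` D = {u, - u})"
proof (cases "program_supp L z \<inter> (\<lambda>w. v + 2 *\<^sub>R w) ` D = {}")
  case False
  then obtain w where w: "w \<in> D" and u: "v + 2 *\<^sub>R w \<in> program_supp L z" by blast
  define u where "u = v + 2 *\<^sub>R w"
  have zu: "z u \<noteq> 0" "u \<in> D" using u by (auto simp: program_supp_def u_def)
  have "z (- u) = z u" using z by (simp add: certificate_def)
  then have minus: "- u \<in> program_supp L z" using zu dual_group(2) by (simp add: program_supp_def)
  have "- u = v + 2 *\<^sub>R (- w - v)" by (simp add: u_def algebra_simps scaleR_2)
  moreover have "- w - v \<in> D" using dual_group w v by blast
  ultimately have "- u \<in> (\<lambda>w. v + 2 *\<^sub>R w) ` D" by (rule image_eqI)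
  moreover have "x = u \<or> x = - u" if x: "x \<in> program_supp L z \<inter> (\<lambda>w. v + 2 *\<^sub>R w) ` D" for x
  proof -
    obtain w' where w': "w' \<in> D" "x = v + 2 *\<^sub>R w'" using x by blast
    have "x - u = 2 *\<^sub>R (w' - w)" by (simp add: w'(2) u_def algebra_simps)
    moreover have "z x \<noteq> 0" using x by (simp add: program_supp_def)
    ultimately show ?thesis using maximal_mass_parity[OF z max _ zu(1) dual_group(4)[OF w'(1) w]] by blast
  qed
  ultimately have "program_supp L z \<inter> (\<lambda>w. v + 2 *\<^sub>R w) ` D = {u, - u}"
    using minus u w unfolding u_def[symmetric] by (auto simp: u_def)
  then show ?thesis by blast
qed blast

end

theorem theorem4p2:
  fixes L :: "(real^'n) set"
  assumes "full_lattice L"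
  shows "(\<exists>(H :: (real^'n \<Rightarrow> complex) hilbert) \<phi>.
            euclidean_embedding L H \<phi> \<and> finite_dimensional H \<and>
            distortion L H \<phi> = least_distortion L) \<and>
         (\<exists>C z. program_optimal L C z \<and>
            (\<forall>v\<in>dual_lattice L.
               program_supp L z \<inter> (\<lambda>w. v + 2 *\<^sub>R w) ` dual_lattice L = {} \<or>
               (\<exists>u. program_supp L z \<inter> (\<lambda>w. v + 2 *\<^sub>R w) ` dual_lattice L = {u, - u})) \<and>
            (\<forall>u\<in>program_supp L z. primitive_in (dual_lattice L) u))"
proof -
  obtain b b' :: "'n \<Rightarrow> real^'n" where "lattice_basis L b b'"
    using full_lattice_imp_basis[OF assms] by blast
  then interpret lattice_basis L b b' .
  obtain C z where z: "certificate C z"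
    and least: "\<And>C' z'. certificate C' z' \<Longrightarrow> C \<le> C'"
    and max: "\<And>z'. certificate C z' \<Longrightarrow> infsum z' D \<le> infsum z D"
    by (rule ex_optimal_certificate) blast
  have fin: "finite {u. z u \<noteq> 0}" by (rule maximal_mass_finite_support[OF z max])
  have "program_optimal L C z"
    unfolding program_optimal_def
    using certificate_imp_feasible[OF z] least feasible_imp_certificate by blast
  moreover have "\<forall>v\<in>D. program_supp L z \<inter> (\<lambda>w. v + 2 *\<^sub>R w) ` D = {} \<or>
      (\<exists>u. program_supp L z \<inter> (\<lambda>w. v + 2 *\<^sub>R w) ` D = {u, - u})"
    using support_meets_coset_in_pair[OF z max] by blast
  moreover have "\<forall>u\<in>program_supp L z. primitive_in D u"
    using maximal_mass_primitive[OF z max] by (simp add: program_supp_def)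
  moreover have "distortion L (fin_hilbert {u. z u \<noteq> 0}) (trig_embedding z) = least_distortion L"
  proof (rule antisym)
    have "ennreal (sqrt C) \<le> least_distortion L"
      unfolding least_distortion_def
    proof (rule Inf_greatest, clarify)
      fix H' :: "(real^'n \<Rightarrow> complex) hilbert" and \<phi>
      assume emb: "euclidean_embedding L H' \<phi>"
      show "ennreal (sqrt C) \<le> distortion L H' \<phi>"
      proof (cases "distortion L H' \<phi>" rule: ennreal_cases)
        case (real E)
        then have "C \<le> E\<^sup>2" using embedding_imp_certificate[OF emb] least by blast
        then have "sqrt C \<le> E" by (rule real_le_lsqrt[OF real(1)])
        then show ?thesis using real by (simp add: ennreal_leI)
      qed simp
    qed
    then show "distortion L (fin_hilbert {u. z u \<noteq> 0}) (trig_embedding z) \<le> least_distortion L"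
      using trig_embedding(2)[OF z fin] by (rule order_trans[rotated])
    show "least_distortion L \<le> distortion L (fin_hilbert {u. z u \<noteq> 0}) (trig_embedding z)"
      by (rule least_distortion_le[OF trig_embedding(1)[OF z fin]])
  qed
  ultimately show ?thesis
    using trig_embedding(1)[OF z fin] finite_dimensional_fin_hilbert[OF fin] by blast
qed

end
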